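(* Let $\alpha\in\mathbb C$, let $\boldsymbol a=(a_-,a_0,a_+)\in\mathbb Z_{\geq0}^3$ with $a_-+a_0+a_+=n\geq1$, and let $K(h)\in\mathrm{GL}_n(\mathbb C[h])$. The decomposition of $\mathcal W\big(M(\alpha,\boldsymbol a,K(h))\big)$ into a direct sum of coherent families of degree $1$ is as follows. (i) Assume that either $(a_-,a_+)\in\{(0,0),(m,0),(0,m): m\geq1\}$, or $(a_-,a_+)\in\mathbb Z_{\geq1}\times\mathbb Z_{\geq1}$ and $\alpha\in(\mathbb C\setminus\tfrac12\mathbb Z)\cup\{\tfrac12\}$. Then for every $K(h)\in\mathrm{GL}_n(\mathbb C[h])$, $$\mathcal W\big(M(\alpha,\boldsymbol a,K(h))\big)\simeq\mathcal F_-(\alpha)^{\oplus a_-}\oplus\mathcal F_0^+(\alpha)^{\oplus a_0}\oplus\mathcal F_+(\alpha)^{\oplus a_+}.$$ (ii) If $(a_-,a_+)\in\mathbb Z_{\geq1}\times\mathbb Z_{\geq1}$ and $\alpha\in\tfrac12\mathbb Z\setminus\{\tfrac12\}$, then $$\mathcal W\big(M(\alpha,\boldsymbol a,K(h))\big)\simeq\mathcal F_-(\alpha)^{\oplus(a_--d)}\oplus\mathcal F_0^+(\alpha)^{\oplus(a_0+d)}\oplus\mathcal F_0^-(\alpha)^{\oplus d}\oplus\mathcal F_+(\alpha)^{\oplus(a_+-d)},$$ where $d:=a_-+a_+-\mathrm{rank}\big(\boldsymbol M_{\boldsymbol a}(\mathcal K_{\alpha,\boldsymbol a,K})\big)$.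
   Context: The Lie algebra $\mathfrak{sl}(2)$ over $\mathbb C$ has basis $e,f,h$ with $[h,e]=e$, $[h,f]=-f$, $[e,f]=2h$; $\mathfrak h=\mathbb Ch$; $c=(2h+1)^2+4fe$. The automorphism $\sigma$ of $\mathbb C[h]$ is $\sigma(g(h))=g(h-1)$, applied entrywise. For $E,F\in\mathrm{Mat}_n(\mathbb C[h])$ with $E\sigma(F)-F\sigma^{-1}(E)=2h\,\mathrm I_n$, $M(E,F)$ is the $\mathfrak{sl}(2)$-module on $\mathbb C[h]^{\oplus n}$ with $h$ acting by multiplication, $e\cdot\boldsymbol g=E\sigma(\boldsymbol g)$, $f\cdot\boldsymbol g=F\sigma^{-1}(\boldsymbol g)$. Put $\lambda_\alpha(h)=-(h-\alpha+1)(h+\alpha)$. For $\boldsymbol a\in\mathbb Z_{\geq0}^3$ with $a_-+a_0+a_+=n$, $P_{(\boldsymbol a,\alpha)}(h)$ is the diagonal $n\times n$ matrix with diagonal entries: $1$ ($a_-$ times), then $h-\alpha+1$ ($a_0$ times), then $(h-\alpha+1)(h+\alpha)$ ($a_+$ times); $\overline P_{(\boldsymbol a,\alpha)}(h)$ is the diagonal matrix with $\overline P_{(\boldsymbol a,\alpha)}P_{(\boldsymbol a,\alpha)}=\lambda_\alpha(h)\mathrm I_n$. Set $M(\alpha,\boldsymbol a,K(h)):=M\big(\sigma(K^{-1}(h)\overline P_{(\boldsymbol a,\alpha)}(h)),P_{(\boldsymbol a,\alpha)}(h)K(h)\big)$. Weighting: for an $\mathfrak{sl}(2)$-module $M$,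 $\mathcal W(M):=\bigoplus_{\lambda\in\mathbb C}M/(h-\lambda)M$, with action $h\cdot(v+(h-\lambda)M)=hv+(h-\lambda)M$, $e\cdot(v+(h-\lambda)M)=ev+(h-\lambda-1)M$, $f\cdot(v+(h-\lambda)M)=fv+(h-\lambda+1)M$. A coherent family of degree $d\ge 1$ is a weight module $\bigoplus_{\lambda\in\mathbb C}M_\lambda$ ($M_\lambda$ the $\lambda$-eigenspace of $h$) with $\dim M_\lambda=d$ for all $\lambda\in\mathbb C$ and $\lambda\mapsto\mathrm{Tr}(c|_{M_\lambda})$ polynomial in $\lambda$. The following degree $1$ coherent families have basis $\{v_\lambda:\lambda\in\mathbb C\}$ and $h\cdot v_\lambda=\lambda v_\lambda$: - $\mathcal F_-(\alpha)$: $e v_\lambda=-(\lambda-\alpha+1)(\lambda+\alpha)v_{\lambda+1}$, $f v_\lambda=v_{\lambda-1}$; - $\mathcal F_0^-(\alpha)$: $e v_\lambda=-(\lambda-\alpha+1)v_{\lambda+1}$, $f v_\lambda=(\lambda+\alpha-1)v_{\lambda-1}$; - $\mathcal F_0^+(\alpha)$: $e v_\lambda=-(\lambda+\alpha)v_{\lambda+1}$, $f v_\lambda=(\lambda-\alpha)v_{\lambda-1}$; - $\mathcal F_+(\alpha)$: $e v_\lambda=-v_{\lambda+1}$, $f v_\lambda=(\lambda-\alpha)(\lambda+\alpha-1)v_{\lambda-1}$. For $\alpha\in\tfrac12\mathbb Z\setminus\{\tfrac12\}$ define the complex $n\times n$ matrix (products are ordered with $j$ increasing from left to right) $$\mathcal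 K_{\alpha,\boldsymbol a,K}:=\begin{cases}K(-\alpha)\prod_{j=1}^{2\alpha-2}\big(P_{(\boldsymbol a,\alpha)}(-\alpha+j)K(-\alpha+j)\big),&\alpha\geq\tfrac32,\\ K(-\alpha),&\alpha=1,\\ K(\alpha-1),&\alpha=0,\\ K(\alpha-1)\prod_{j=1}^{-2\alpha}\big(P_{(\boldsymbol a,\alpha)}(\alpha-1+j)K(\alpha-1+j)\big),&\alpha\leq-\tfrac12.\end{cases}$$ For $T\in\mathrm{Mat}_n(\mathbb C)$, $\boldsymbol M_{\boldsymbol a}(T)$ is the $n\times(a_-+a_+)$ matrix with columns $T\mathsf e_1,\dots,T\mathsf e_{a_-},\mathsf e_{a_-+a_0+1},\dots,\mathsf e_n$, where $\mathsf e_i$ is the standard basis of $\mathbb C^n$.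
   Formalization: In (ii), for α ≤ 0 and a_0 ≥ 1, d is computed with the transpose of 𝒦_{α,a,K} in place of 𝒦_{α,a,K}; the formula as printed fails there, e.g. for α = 0, a = (1,1,1), K the cyclic permutation matrix e_1→e_2→e_3→e_1. *)

theory Defs
  imports "Jordan_Normal_Form.DL_Rank" "HOL-Algebra.AbelCoset" Complex_Main
begin

section \<open>Modules over sl(2)\<close>

text \<open>
  A representation of sl(2) is a complex vector space (a \<open>module\<close> record over the field
  \<open>class_ring\<close> of complex numbers) with three linear operators obeying the bracket relations of
  the basis e, f, h, normalised by [h,e] = e, [h,f] = -f, [e,f] = 2h.  The fields \<open>mult\<close> and \<open>one\<close>
  that the record inherits from \<open>ring\<close> are irrelevant.
\<close>

record 'v sl2_rep = "(complex, 'v) module" +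
  act_e :: "'v \<Rightarrow> 'v"
  act_f :: "'v \<Rightarrow> 'v"
  act_h :: "'v \<Rightarrow> 'v"

abbreviation complex_field :: "complex ring" where
  "complex_field \<equiv> class_ring"

definition sl2_module :: "'v sl2_rep \<Rightarrow> bool" where
  "sl2_module M \<longleftrightarrow>
     vectorspace complex_field M \<and>
     act_e M \<in> LinearCombinations.module_hom complex_field M M \<and>
     act_f M \<in> LinearCombinations.module_hom complex_field M M \<and>
     act_h M \<in> LinearCombinations.module_hom complex_field M M \<and>
     (\<forall>v\<in>carrier M.
        act_h M (act_e M v) \<ominus>\<^bsub>M\<^esub> act_e M (act_h M v) = act_e M v \<and>
        act_h M (act_f M v) \<ominus>\<^bsub>M\<^esub> act_f M (act_h M v) = \<ominus>\<^bsub>M\<^esub> act_f M v \<and>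
        act_e M (act_f M v) \<ominus>\<^bsub>M\<^esub> act_f M (act_e M v) = 2 \<odot>\<^bsub>M\<^esub> act_h M v)"

definition sl2_iso :: "'v sl2_rep \<Rightarrow> 'w sl2_rep \<Rightarrow> bool" (infix "\<simeq>\<^sub>s" 50) where
  "M \<simeq>\<^sub>s N \<longleftrightarrow>
     sl2_module M \<and> sl2_module N \<and>
     (\<exists>\<phi>\<in>LinearCombinations.module_hom complex_field M N.
        bij_betw \<phi> (carrier M) (carrier N) \<and>
        (\<forall>v\<in>carrier M.
           \<phi> (act_e M v) = act_e N (\<phi> v) \<and>
           \<phi> (act_f M v) = act_f N (\<phi> v) \<and>
           \<phi> (act_h M v) = act_h N (\<phi> v)))"

definition sl2_direct_sum :: "'v sl2_rep list \<Rightarrow> (nat \<Rightarrow> 'v) sl2_rep" where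
  "sl2_direct_sum Ms =
     \<lparr>carrier = (\<Pi>\<^sub>E i\<in>{..<length Ms}. carrier (Ms ! i)),
      mult = undefined,
      one = undefined,
      zero = (\<lambda>i\<in>{..<length Ms}. \<zero>\<^bsub>Ms ! i\<^esub>),
      add = (\<lambda>x y. \<lambda>i\<in>{..<length Ms}. x i \<oplus>\<^bsub>Ms ! i\<^esub> y i),
      smult = (\<lambda>c x. \<lambda>i\<in>{..<length Ms}. c \<odot>\<^bsub>Ms ! i\<^esub> x i),
      act_e = (\<lambda>x. \<lambda>i\<in>{..<length Ms}. act_e (Ms ! i) (x i)),
      act_f = (\<lambda>x. \<lambda>i\<in>{..<length Ms}. act_f (Ms ! i) (x i)),
      act_h = (\<lambda>x. \<lambda>i\<in>{..<length Ms}. act_h (Ms ! i) (x i))\<rparr>"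


section \<open>Coherent families\<close>

definition weight_space :: "'v sl2_rep \<Rightarrow> complex \<Rightarrow> 'v set" where
  "weight_space M \<nu> = {v \<in> carrier M. act_h M v = \<nu> \<odot>\<^bsub>M\<^esub> v}"

definition weight_module :: "'v sl2_rep \<Rightarrow> bool" where
  "weight_module M \<longleftrightarrow> sl2_module M \<and>
     (\<forall>v\<in>carrier M. \<exists>!x. (\<forall>\<nu>. x \<nu> \<in> weight_space M \<nu>) \<and> finite {\<nu>. x \<nu> \<noteq> \<zero>\<^bsub>M\<^esub>} \<and>
        v = (\<Oplus>\<^bsub>M\<^esub>\<nu>\<in>{\<nu>. x \<nu> \<noteq> \<zero>\<^bsub>M\<^esub>}. x \<nu>))"

text \<open>The action of c = (2h+1)^2 + 4fe.\<close>

definition casimir :: "'v sl2_rep \<Rightarrow> 'v \<Rightarrow> 'v" where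
  "casimir M v =
     (let H = (\<lambda>w. 2 \<odot>\<^bsub>M\<^esub> act_h M w \<oplus>\<^bsub>M\<^esub> w) in H (H v) \<oplus>\<^bsub>M\<^esub> 4 \<odot>\<^bsub>M\<^esub> act_f M (act_e M v))"

text \<open>\<open>has_trace V T t\<close>: the linear endomorphism \<open>T\<close> of the finite-dimensional space \<open>V\<close> has
  trace \<open>t\<close>; as the trace does not depend on the basis, some basis suffices.\<close>

definition has_trace :: "(complex, 'v, 'z) module_scheme \<Rightarrow> ('v \<Rightarrow> 'v) \<Rightarrow> complex \<Rightarrow> bool" where
  "has_trace V T t \<longleftrightarrow>
     (\<exists>b (A :: nat \<Rightarrow> nat \<Rightarrow> complex). distinct b \<and> vectorspace.basis complex_field V (set b) \<and>
        (\<forall>j<length b. T (b ! j) = (\<Oplus>\<^bsub>V\<^esub>i\<in>{..<length b}. A i j \<odot>\<^bsub>V\<^esub> (b ! i))) \<and>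
        t = (\<Sum>i<length b. A i i))"

definition coherent_family :: "nat \<Rightarrow> 'v sl2_rep \<Rightarrow> bool" where
  "coherent_family d M \<longleftrightarrow> d \<ge> 1 \<and> weight_module M \<and>
     (\<forall>\<nu>. vectorspace.fin_dim complex_field (M\<lparr>carrier := weight_space M \<nu>\<rparr>) \<and>
          vectorspace.dim complex_field (M\<lparr>carrier := weight_space M \<nu>\<rparr>) = d) \<and>
     (\<exists>p :: complex poly. \<forall>\<nu>.
          has_trace (M\<lparr>carrier := weight_space M \<nu>\<rparr>) (casimir M) (poly p \<nu>))"

text \<open>
  \<open>degree1_family p q\<close> has a basis of vectors \<open>v\<^sub>\<nu>\<close> indexed by the complex numbers, with
  \<open>h v\<^sub>\<nu> = \<nu> v\<^sub>\<nu>\<close>, \<open>e v\<^sub>\<nu> = p \<nu> v\<^bsub>\<nu>+1\<^esub>\<close> and \<open>f v\<^sub>\<nu> = q \<nu> v\<^bsub>\<nu>-1\<^esub>\<close>.  The vector \<open>\<Sum>\<^sub>\<nu> x \<nu> v\<^sub>\<nu>\<close> is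
  represented by its finitely supported coefficient function \<open>x\<close>.
\<close>

definition degree1_family ::
    "(complex \<Rightarrow> complex) \<Rightarrow> (complex \<Rightarrow> complex) \<Rightarrow> (complex \<Rightarrow> complex) sl2_rep" where
  "degree1_family p q =
     \<lparr>carrier = {x. finite {\<nu>. x \<nu> \<noteq> 0}},
      mult = undefined,
      one = undefined,
      zero = (\<lambda>_. 0),
      add = (\<lambda>x y \<mu>. x \<mu> + y \<mu>),
      smult = (\<lambda>c x \<mu>. c * x \<mu>),
      act_e = (\<lambda>x \<mu>. p (\<mu> - 1) * x (\<mu> - 1)),
      act_f = (\<lambda>x \<mu>. q (\<mu> + 1) * x (\<mu> + 1)),
      act_h = (\<lambda>x \<mu>. \<mu> * x \<mu>)\<rparr>"

definition F_minus :: "complex \<Rightarrow> (complex \<Rightarrow> complex) sl2_rep" where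
  "F_minus \<alpha> = degree1_family (\<lambda>\<nu>. - (\<nu> - \<alpha> + 1) * (\<nu> + \<alpha>)) (\<lambda>\<nu>. 1)"

definition F_zero_minus :: "complex \<Rightarrow> (complex \<Rightarrow> complex) sl2_rep" where
  "F_zero_minus \<alpha> = degree1_family (\<lambda>\<nu>. - (\<nu> - \<alpha> + 1)) (\<lambda>\<nu>. \<nu> + \<alpha> - 1)"

definition F_zero_plus :: "complex \<Rightarrow> (complex \<Rightarrow> complex) sl2_rep" where
  "F_zero_plus \<alpha> = degree1_family (\<lambda>\<nu>. - (\<nu> + \<alpha>)) (\<lambda>\<nu>. \<nu> - \<alpha>)"

definition F_plus :: "complex \<Rightarrow> (complex \<Rightarrow> complex) sl2_rep" where
  "F_plus \<alpha> = degree1_family (\<lambda>\<nu>. - 1) (\<lambda>\<nu>. (\<nu> - \<alpha>) * (\<nu> + \<alpha> - 1))"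


section \<open>The weighting functor\<close>

text \<open>The subspace (h - \<nu>)M.\<close>

definition h_image :: "'v sl2_rep \<Rightarrow> complex \<Rightarrow> 'v set" where
  "h_image M \<nu> = (\<lambda>v. act_h M v \<ominus>\<^bsub>M\<^esub> \<nu> \<odot>\<^bsub>M\<^esub> v) ` carrier M"

text \<open>
  An element of \<open>weighting M\<close> is a family \<open>\<phi>\<close> of cosets, \<open>\<phi> \<nu>\<close> in M/(h - \<nu>)M, with \<open>\<phi> \<nu>\<close> zero for
  all but finitely many \<open>\<nu>\<close>.  As for \<open>rcoset_mult\<close> in the library, an operation on cosets is
  the union of its values over all representatives.  The operator e sends the coset of \<open>v\<close>
  modulo (h - \<nu>)M to the coset of \<open>e v\<close> modulo (h - \<nu> - 1)M; hence the component of index \<open>\<mu>\<close> of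
  the image comes from the component of index \<open>\<mu> - 1\<close>, and likewise from \<open>\<mu> + 1\<close> for f.
\<close>

definition weighting :: "'v sl2_rep \<Rightarrow> (complex \<Rightarrow> 'v set) sl2_rep" where
  "weighting M =
     \<lparr>carrier = {\<phi>. (\<forall>\<nu>. \<phi> \<nu> \<in> a_rcosets\<^bsub>M\<^esub> (h_image M \<nu>)) \<and> finite {\<nu>. \<phi> \<nu> \<noteq> h_image M \<nu>}},
      mult = undefined,
      one = undefined,
      zero = h_image M,
      add = (\<lambda>\<phi> \<psi> \<mu>. \<phi> \<mu> <+>\<^bsub>M\<^esub> \<psi> \<mu>),
      smult = (\<lambda>c \<phi> \<mu>. \<Union>v\<in>\<phi> \<mu>. h_image M \<mu> +>\<^bsub>M\<^esub> (c \<odot>\<^bsub>M\<^esub> v)),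
      act_e = (\<lambda>\<phi> \<mu>. \<Union>v\<in>\<phi> (\<mu> - 1). h_image M \<mu> +>\<^bsub>M\<^esub> act_e M v),
      act_f = (\<lambda>\<phi> \<mu>. \<Union>v\<in>\<phi> (\<mu> + 1). h_image M \<mu> +>\<^bsub>M\<^esub> act_f M v),
      act_h = (\<lambda>\<phi> \<mu>. \<Union>v\<in>\<phi> \<mu>. h_image M \<mu> +>\<^bsub>M\<^esub> act_h M v)\<rparr>"


section \<open>The modules M(E,F)\<close>

text \<open>\<open>shift p\<close> is \<open>\<sigma>(p) = p(h - 1)\<close>, and \<open>unshift\<close> is its inverse.\<close>

definition shift :: "complex poly \<Rightarrow> complex poly" where
  "shift p = pcompose p [:- 1, 1:]"

definition unshift :: "complex poly \<Rightarrow> complex poly" where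
  "unshift p = pcompose p [:1, 1:]"

text \<open>This is a module over sl(2) when \<open>E \<sigma>(F) - F \<sigma>\<^sup>-\<^sup>1(E) = 2h I\<^sub>n\<close>.\<close>

definition M_EF :: "nat \<Rightarrow> complex poly mat \<Rightarrow> complex poly mat \<Rightarrow> complex poly vec sl2_rep" where
  "M_EF n E F =
     \<lparr>carrier = carrier_vec n,
      mult = undefined,
      one = undefined,
      zero = 0\<^sub>v n,
      add = (+),
      smult = (\<lambda>c g. [:c:] \<cdot>\<^sub>v g),
      act_e = (\<lambda>g. E *\<^sub>v map_vec shift g),
      act_f = (\<lambda>g. F *\<^sub>v map_vec unshift g),
      act_h = (\<lambda>g. [:0, 1:] \<cdot>\<^sub>v g)\<rparr>"

definition lam :: "complex \<Rightarrow> complex poly" where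
  "lam \<alpha> = - ([:1 - \<alpha>, 1:] * [:\<alpha>, 1:])"

definition P_mat :: "nat \<Rightarrow> nat \<Rightarrow> nat \<Rightarrow> complex \<Rightarrow> complex poly mat" where
  "P_mat am a0 ap \<alpha> = mat_diag (am + a0 + ap)
     (\<lambda>i. if i < am then 1
          else if i < am + a0 then [:1 - \<alpha>, 1:]
          else [:1 - \<alpha>, 1:] * [:\<alpha>, 1:])"

definition Pbar_mat :: "nat \<Rightarrow> nat \<Rightarrow> nat \<Rightarrow> complex \<Rightarrow> complex poly mat" where
  "Pbar_mat am a0 ap \<alpha> = mat_diag (am + a0 + ap)
     (\<lambda>i. if i < am then - ([:1 - \<alpha>, 1:] * [:\<alpha>, 1:])
          else if i < am + a0 then - [:\<alpha>, 1:]
          else - 1)"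

lemma Pbar_mat_P_mat:
  "Pbar_mat am a0 ap \<alpha> * P_mat am a0 ap \<alpha> = lam \<alpha> \<cdot>\<^sub>m 1\<^sub>m (am + a0 + ap)"
  unfolding Pbar_mat_def P_mat_def lam_def mat_diag_diag
  by (rule eq_matI) (auto simp: mat_diag_def one_pCons)

abbreviation poly_mat_ring :: "nat \<Rightarrow> complex poly mat ring" where
  "poly_mat_ring n \<equiv> ring_mat TYPE(complex poly) n ()"

abbreviation GL_poly :: "nat \<Rightarrow> complex poly mat set" where
  "GL_poly n \<equiv> Units (poly_mat_ring n)"

definition M_aK ::
    "complex \<Rightarrow> nat \<Rightarrow> nat \<Rightarrow> nat \<Rightarrow> complex poly mat \<Rightarrow> complex poly vec sl2_rep" where
  "M_aK \<alpha> am a0 ap K =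
     (let n = am + a0 + ap in
      M_EF n (map_mat shift (inv\<^bsub>poly_mat_ring n\<^esub> K * Pbar_mat am a0 ap \<alpha>))
             (P_mat am a0 ap \<alpha> * K))"


section \<open>The defect\<close>

definition half_ints :: "complex set" where
  "half_ints = {of_int k / 2 | k. True}"

definition eval_mat :: "complex poly mat \<Rightarrow> complex \<Rightarrow> complex mat" where
  "eval_mat A z = map_mat (\<lambda>p. poly p z) A"

text \<open>\<open>ordered_prod n m A\<close> is the product \<open>A 1 * A 2 * \<dots> * A m\<close>, in this order.\<close>

definition ordered_prod :: "nat \<Rightarrow> nat \<Rightarrow> (nat \<Rightarrow> complex mat) \<Rightarrow> complex mat" where
  "ordered_prod n m A = foldr (*) (map A [1..<Suc m]) (1\<^sub>m n)"

text \<open>Only meaningful for \<open>\<alpha>\<close> in \<open>half_ints - {1/2}\<close>; then \<open>\<alpha> = Re \<alpha>\<close> and the floors are exact.\<close>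

definition calK :: "complex \<Rightarrow> nat \<Rightarrow> nat \<Rightarrow> nat \<Rightarrow> complex poly mat \<Rightarrow> complex mat" where
  "calK \<alpha> am a0 ap K =
     (let n = am + a0 + ap;
          PK = (\<lambda>z. eval_mat (P_mat am a0 ap \<alpha>) z * eval_mat K z)
      in if Re \<alpha> \<ge> 3 / 2 then
           eval_mat K (- \<alpha>) * ordered_prod n (nat \<lfloor>2 * Re \<alpha> - 2\<rfloor>) (\<lambda>j. PK (- \<alpha> + of_nat j))
         else if \<alpha> = 1 then eval_mat K (- \<alpha>)
         else if \<alpha> = 0 then eval_mat K (\<alpha> - 1)
         else
           eval_mat K (\<alpha> - 1) * ordered_prod n (nat \<lfloor>- 2 * Re \<alpha>\<rfloor>) (\<lambda>j. PK (\<alpha> - 1 + of_nat j)))"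

definition bold_M :: "nat \<Rightarrow> nat \<Rightarrow> nat \<Rightarrow> complex mat \<Rightarrow> complex mat" where
  "bold_M am a0 ap T =
     (let n = am + a0 + ap in
      mat_of_cols n (map (\<lambda>i. T *\<^sub>v unit_vec n i) [0..<am] @ map (unit_vec n) [am + a0..<n]))"

text \<open>
  The number d of the decomposition is \<open>am + ap - rank (bold_M am a0 ap T)\<close>, where \<open>T\<close> is
  \<open>calK \<alpha> am a0 ap K\<close>, except that \<open>T\<close> has to be transposed if \<open>\<alpha> \<le> 0\<close> and \<open>a0 \<ge> 1\<close>.  (As \<open>bold_M\<close> has
  \<open>am + ap\<close> columns, the subtraction never truncates.)  Indeed, number the blocks of
  coordinates of sizes \<open>am\<close>, \<open>a0\<close>, \<open>ap\<close> by 1, 2, 3.  In the weighting the number \<open>am - d\<close> has to be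
  the rank of a power of f: for \<open>\<alpha> \<ge> 1\<close> of the map from weight \<open>\<alpha>\<close> to weight \<open>- \<alpha>\<close>, whose rank is
  that of the submatrix of \<open>T\<close> with rows in blocks 1, 2 and columns in block 1; for \<open>\<alpha> \<le> 0\<close> of the
  map from weight \<open>1 - \<alpha>\<close> to weight \<open>\<alpha> - 1\<close>, whose rank is that of the submatrix with rows in
  block 1 and columns in blocks 1, 2.  Without the transposition
  the formula fails: for \<open>\<alpha> = 0\<close>, \<open>am = a0 = ap = 1\<close> and \<open>K\<close> the matrix of the cyclic
  permutation of the basis that maps the first vector to the second and the second to the third,
  \<open>bold_M am a0 ap T\<close> has rank 2, but on the weight space of 0 in the weighting the common kernel
  of e and f has dimension 2, which forces d = 1.  For \<open>a0 = 0\<close> transposing makes no difference.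
\<close>

end

theory Submission
  imports Defs
begin

text \<open>
  Evaluation at \<open>\<mu>\<close> identifies the weight space of weight \<open>\<mu>\<close> of the weighting with \<open>\<complex>\<^sup>n\<close>; there f is
  \<open>P(\<mu>) K(\<mu>)\<close> from weight \<open>\<mu> + 1\<close> to \<open>\<mu>\<close>, and e is \<open>K(\<mu>)\<^sup>-\<^sup>1 Pbar(\<mu>)\<close> back.  The proposed
  direct sum has the same shape, with K = 1 and other diagonal matrices.  An isomorphism is a family
  of invertible matrices \<open>\<phi> \<mu>\<close> that intertwines these maps.  Such a family propagates along each coset
  of the integers through the weights where \<open>lam \<alpha>\<close> does not vanish.  At a simple zero of
  \<open>lam \<alpha>\<close> it extends to the other side exactly when \<open>\<phi>\<close> matches kernel and image of the diagonal
  matrices, which are coordinate subspaces.  So the only obstruction arises when both zeros \<open>\<alpha> - 1\<close> and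
  \<open>- \<alpha>\<close> lie in one coset: transported to one weight space by calK, the two conditions concern the
  relative position of two coordinate subspaces under an invertible matrix.  A Bruhat decomposition
  \<open>L T R\<close> = permutation brings them into normal position, and their intersection has dimension d.
\<close>

subsection \<open>Invertible matrices and coordinate subspaces\<close>

text \<open>Only the values of \<open>K\<close> matter, and a relation couples weight \<mu> with
  \<mu> + 1 alone, so the cosets are independent and no regularity in \<mu> is required. The zeros
  \<alpha> - 1 and - \<alpha> differ by 2\<alpha> - 1: they share a coset only for half-integral
  \<alpha>, and for \<alpha> = 1/2 they coincide. A single singular weight is harmless for d = 0, as
  a chain may start there with the identity. For \<alpha> \<ge> 1 the lower zero is - \<alpha>;
  there e is nonzero exactly on block 3 of the source, and at the upper zero f is nonzero exactly on
  block 1. So U must preserve span(block 3), while U T takes span(block 1) to a subspace dictated by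
  the summands. For \<alpha> \<le> 0 the zeros change places and the subspaces become spans of
  complements: blocks 2, 3 below and blocks 1, 2 above. Inverse transposes turn these into their
  annihilators, the spans of blocks 1 and 3, and lead to the problem for
  \<open>transpose_mat T\<close>. This is the origin of the transposition in the theorem.\<close>

definition inv_pair :: "nat \<Rightarrow> 'a :: field mat \<Rightarrow> 'a mat \<Rightarrow> bool" where
  "inv_pair n X X' \<longleftrightarrow> X \<in> carrier_mat n n \<and> X' \<in> carrier_mat n n \<and> X * X' = 1\<^sub>m n \<and> X' * X = 1\<^sub>m n"

lemma inv_pairD:
  assumes "inv_pair n X X'"
  shows "X \<in> carrier_mat n n" "X' \<in> carrier_mat n n" "X * X' = 1\<^sub>m n" "X' * X = 1\<^sub>m n"
  using assms by (auto simp: inv_pair_def)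

lemma inv_pairI:
  assumes "X \<in> carrier_mat n n" "X' \<in> carrier_mat n n" "X * X' = 1\<^sub>m n"
  shows "inv_pair n X X'"
  using assms mat_mult_left_right_inverse[OF assms] by (simp add: inv_pair_def)

lemma inv_pair_sym: "inv_pair n X X' \<Longrightarrow> inv_pair n X' X"
  by (auto simp: inv_pair_def)

lemma inv_pair_one: "inv_pair n (1\<^sub>m n) (1\<^sub>m n)"
  by (auto simp: inv_pair_def)

lemma inv_pair_mult:
  assumes "inv_pair n X X'" "inv_pair n Y Y'"
  shows "inv_pair n (X * Y) (Y' * X')"
proof (rule inv_pairI)
  note [simp] = inv_pairD(3,4)[OF assms(1)] inv_pairD(3,4)[OF assms(2)]
  show "X * Y \<in> carrier_mat n n" "Y' * X' \<in> carrier_mat n n"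
    by (auto intro: mult_carrier_mat inv_pairD[OF assms(1)] inv_pairD[OF assms(2)])
  have "X * Y * (Y' * X') = X * (Y * (Y' * X'))"
    by (rule assoc_mult_mat) (auto intro: mult_carrier_mat inv_pairD[OF assms(1)] inv_pairD[OF assms(2)])
  also have "Y * (Y' * X') = Y * Y' * X'"
    by (rule assoc_mult_mat[symmetric]) (rule inv_pairD[OF assms(1)] inv_pairD[OF assms(2)])+
  finally show "X * Y * (Y' * X') = 1\<^sub>m n" by (simp add: left_mult_one_mat[OF inv_pairD(2)[OF assms(1)]])
qed

lemma inv_pair_transpose:
  assumes "inv_pair n X X'"
  shows "inv_pair n (transpose_mat X) (transpose_mat X')"
  using assms unfolding inv_pair_def
  by (metis transpose_carrier_mat transpose_mult transpose_one)

lemma inv_pair_row_nonzero: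
  assumes "inv_pair n X X'" "k < n"
  shows "\<exists>j<n. X $$ (k, j) \<noteq> 0"
proof (rule ccontr)
  assume *: "\<not> ?thesis"
  have "(X * X') $$ (k, k) = (\<Sum>j = 0..<n. X $$ (k, j) * X' $$ (j, k))"
    using assms(2) inv_pairD(1,2)[OF assms(1)] by (auto simp: scalar_prod_def)
  also have "\<dots> = 0" using * by (intro sum.neutral) auto
  finally show False using assms by (auto simp: inv_pair_def)
qed

text \<open>Inclusion of the image of one coordinate subspace in another. Indices from n on are
  ignored, so complements and infinite segments can serve as index sets.\<close>

definition maps_coords :: "nat \<Rightarrow> nat set \<Rightarrow> nat set \<Rightarrow> 'a :: field mat \<Rightarrow> bool" where
  "maps_coords n I J X \<longleftrightarrow> (\<forall>i<n. \<forall>j<n. j \<in> I \<longrightarrow> i \<notin> J \<longrightarrow> X $$ (i, j) = 0)"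

lemma maps_coordsD: "maps_coords n I J X \<Longrightarrow> i < n \<Longrightarrow> j < n \<Longrightarrow> j \<in> I \<Longrightarrow> i \<notin> J \<Longrightarrow> X $$ (i, j) = 0"
  by (auto simp: maps_coords_def)

lemma maps_coords_mult:
  assumes X: "X \<in> carrier_mat n n" and Y: "Y \<in> carrier_mat n n"
    and "maps_coords n I J X" "maps_coords n J L Y"
  shows "maps_coords n I L (Y * X)"
  unfolding maps_coords_def
proof (intro allI impI)
  fix i j assume ij: "i < n" "j < n" "j \<in> I" "i \<notin> L"
  have "(Y * X) $$ (i, j) = (\<Sum>k = 0..<n. Y $$ (i, k) * X $$ (k, j))"
    using ij X Y by (auto simp: scalar_prod_def)
  also have "\<dots> = 0"
  proof (intro sum.neutral ballI)
    fix k assume "k \<in> {0..<n}"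
    then show "Y $$ (i, k) * X $$ (k, j) = 0"
      using ij assms(3,4) by (cases "k \<in> J") (auto simp: maps_coords_def)
  qed
  finally show "(Y * X) $$ (i, j) = 0" .
qed

text \<open>The condition on the inverse turns "into" into "onto".\<close>

definition carries :: "nat \<Rightarrow> nat set \<Rightarrow> nat set \<Rightarrow> 'a :: field mat \<Rightarrow> 'a mat \<Rightarrow> bool" where
  "carries n I J X X' \<longleftrightarrow> inv_pair n X X' \<and> maps_coords n I J X \<and> maps_coords n J I X'"

lemma carries_mult:
  assumes "carries n I J X X'" "carries n J L Y Y'"
  shows "carries n I L (Y * X) (X' * Y')"
  using assms maps_coords_mult[of X n Y I J L] maps_coords_mult[of Y' n X' L J I]
    inv_pair_mult[of n Y Y' X X']
  by (auto simp: carries_def inv_pair_def)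

text \<open>The inverse transpose acts on the dual space, where the annihilator of a coordinate
  subspace is the coordinate subspace of the complementary indices.\<close>

lemma carries_dual:
  assumes "carries n I J X X'"
  shows "carries n (- I) (- J) (transpose_mat X') (transpose_mat X)"
  using assms inv_pair_transpose[OF inv_pair_sym[of n X X']]
  by (auto simp: carries_def maps_coords_def inv_pair_def)

text \<open>Triangularity is phrased as preservation of a flag, so that products are triangular by
  \<open>maps_coords_mult\<close> and the last block is preserved by specialisation.\<close>

definition lower_tri :: "nat \<Rightarrow> 'a :: field mat \<Rightarrow> bool" where
  "lower_tri n X \<longleftrightarrow> (\<forall>k. maps_coords n {k..} {k..} X)"

definition upper_tri :: "nat \<Rightarrow> 'a :: field mat \<Rightarrow> bool" where
  "upper_tri n X \<longleftrightarrow> (\<forall>k. maps_coords n {..<k} {..<k} X)"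

lemma lower_tri_transpose:
  "X \<in> carrier_mat n n \<Longrightarrow> lower_tri n (transpose_mat X) \<longleftrightarrow> upper_tri n X"
  unfolding lower_tri_def upper_tri_def maps_coords_def
  by (auto simp: not_le not_less)

subsection \<open>Bruhat decomposition\<close>

text \<open>Column operations with a single source column: multiplication on the right rescales
  column j by \<open>v j\<close> and adds \<open>v b\<close> times the old column j to column b. The
  transpose, used on the left, gives the row operations.\<close>

definition elem_row :: "nat \<Rightarrow> nat \<Rightarrow> (nat \<Rightarrow> 'a) \<Rightarrow> 'a :: field mat" where
  "elem_row n j v = Matrix.mat n n (\<lambda>(a, b). if a = j then v b else if a = b then 1 else 0)"

lemma elem_row_carrier [simp]: "elem_row n j v \<in> carrier_mat n n"
  "dim_row (elem_row n j v) = n" "dim_col (elem_row n j v) = n"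
  by (auto simp: elem_row_def)

lemma mult_elem_row_index:
  assumes "X \<in> carrier_mat n n" "m < n" "b < n" "j < n"
  shows "(X * elem_row n j v) $$ (m, b) = (if b = j then 0 else X $$ (m, b)) + X $$ (m, j) * v b"
proof -
  have "(X * elem_row n j v) $$ (m, b)
      = (\<Sum>a = 0..<n. X $$ (m, a) * (if a = j then v b else if a = b then 1 else 0))"
    using assms by (auto simp: scalar_prod_def elem_row_def)
  also have "\<dots> = (\<Sum>a = 0..<n. (if a = j then X $$ (m, j) * v b else 0) +
      (if a = b then if b = j then 0 else X $$ (m, b) else 0))"
    by (intro sum.cong) auto
  also have "\<dots> = X $$ (m, j) * v b + (if b = j then 0 else X $$ (m, b))"
    using assms by (simp add: sum.distrib)
  finally show ?thesis by simp
qed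

text \<open>The inverse has the same shape and the same zero pattern, so it is triangular whenever
  the matrix is.\<close>

lemma elem_row_inv_pair:
  assumes "j < n" "v j \<noteq> 0"
  shows "inv_pair n (elem_row n j v) (elem_row n j (\<lambda>b. if b = j then 1 / v j else - v b / v j))"
proof (rule inv_pairI)
  let ?u = "\<lambda>b. if b = j then 1 / v j else - v b / v j"
  show "elem_row n j v * elem_row n j ?u = 1\<^sub>m n"
  proof (rule eq_matI)
    fix a b assume "a < dim_row (1\<^sub>m n :: 'a mat)" "b < dim_col (1\<^sub>m n :: 'a mat)"
    then have ab: "a < n" "b < n" by auto
    show "(elem_row n j v * elem_row n j ?u) $$ (a, b) = 1\<^sub>m n $$ (a, b)"
      by (subst mult_elem_row_index) (use ab assms in \<open>auto simp: elem_row_def\<close>)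
  qed auto
qed auto

lemma elem_row_upper:
  assumes "\<And>b. b < j \<Longrightarrow> v b = 0"
  shows "upper_tri n (elem_row n j v)"
  using assms by (auto simp: upper_tri_def maps_coords_def elem_row_def)

text \<open>
  The first k rows of \<open>L T R\<close> are already unit vectors; the pivot in row k is its first nonzero entry, so that
  clearing the row to the right and the column below keeps R upper and L lower triangular.
\<close>

lemma bruhat_step:
  fixes T :: "'a :: field mat"
  assumes T: "inv_pair n T T'" and k: "k \<le> n"
  shows "\<exists>L L' R R' w. inv_pair n L L' \<and> inv_pair n R R' \<and> lower_tri n L \<and> lower_tri n L' \<and>
     upper_tri n R \<and> upper_tri n R' \<and> (\<forall>i<k. w i < n) \<and>
     (\<forall>i<k. \<forall>b<n. (L * T * R) $$ (i, b) = (if b = w i then 1 else 0)) \<and>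
     (\<forall>i<k. \<forall>m<n. (L * T * R) $$ (m, w i) = (if m = i then 1 else 0))"
  using k
proof (induction k)
  case 0
  have "lower_tri n (1\<^sub>m n)" "upper_tri n (1\<^sub>m n)"
    by (auto simp: lower_tri_def upper_tri_def maps_coords_def)
  then show ?case using inv_pair_one by (auto intro!: exI[of _ "1\<^sub>m n"])
next
  case (Suc k)
  then obtain L L' R R' w where L: "inv_pair n L L'" and R: "inv_pair n R R'"
    and tri: "lower_tri n L" "lower_tri n L'" "upper_tri n R" "upper_tri n R'"
    and w: "\<And>i. i < k \<Longrightarrow> w i < n"
    and row0: "\<And>i b. i < k \<Longrightarrow> b < n \<Longrightarrow> (L * T * R) $$ (i, b) = (if b = w i then 1 else 0)"
    and col0: "\<And>i m. i < k \<Longrightarrow> m < n \<Longrightarrow> (L * T * R) $$ (m, w i) = (if m = i then 1 else 0)"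
    by fastforce
  define A where "A = L * T * R"
  note row = row0[folded A_def] and col = col0[folded A_def]
  have kn: "k < n" using Suc by auto
  have A: "A \<in> carrier_mat n n" unfolding A_def
    using inv_pairD(1)[OF L] inv_pairD(1)[OF R] inv_pairD(1)[OF T] by auto
  have "inv_pair n A (R' * (T' * L'))"
    unfolding A_def by (rule inv_pair_mult[OF inv_pair_mult[OF L T] R])
  from inv_pair_row_nonzero[OF this kn] have ex: "\<exists>j. j < n \<and> A $$ (k, j) \<noteq> 0" by auto
  define j where "j = (LEAST j. j < n \<and> A $$ (k, j) \<noteq> 0)"
  have j: "j < n" "A $$ (k, j) \<noteq> 0" using LeastI_ex[OF ex] by (auto simp: j_def)
  have minj: "A $$ (k, b) = 0" if "b < j" for b
    using not_less_Least[OF that[unfolded j_def]] that j(1) by auto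
  define p where "p = A $$ (k, j)"
  have p: "p \<noteq> 0" using j p_def by auto
  \<comment> \<open>Row k is zero in every earlier pivot column, whereas p is not zero: the new
    pivot lies in a new column.\<close>
  have wj: "w i \<noteq> j" if "i < k" for i
    using col[OF that kn] j that by auto
  define v where "v = (\<lambda>b. if b = j then 1 / p else if b > j then - A $$ (k, b) / p else 0)"
  define B where "B = A * elem_row n j v"
  have Bc: "B \<in> carrier_mat n n" using A by (auto simp: B_def)
  have Bi: "B $$ (m, b) = (if b = j then 0 else A $$ (m, b)) + A $$ (m, j) * v b" if "m < n" "b < n" for m b
    unfolding B_def by (rule mult_elem_row_index[OF A that j(1)])
  have Bk: "B $$ (k, b) = (if b = j then 1 else 0)" if "b < n" for b
    using that kn Bi[of k b] p minj[of b] by (auto simp: v_def p_def[symmetric] split: if_splits)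
  have Brow: "B $$ (i, b) = (if b = w i then 1 else 0)" if "i < k" "b < n" for i b
    using that kn j wj[OF that(1)] by (auto simp: Bi row)
  have Bcol: "B $$ (m, w i) = (if m = i then 1 else 0)" if "i < k" "m < n" for i m
    using that wj[OF that(1)] kn w col[OF that(1) kn] by (auto simp: Bi col v_def)
  define u where "u = (\<lambda>a. if a = k then 1 else if a > k then - B $$ (a, j) else 0)"
  let ?E = "transpose_mat (elem_row n k u)"
  define C where "C = ?E * B"
  have CT: "C = transpose_mat (transpose_mat B * elem_row n k u)"
    unfolding C_def using transpose_mult[of "transpose_mat B" n n "elem_row n k u" n] Bc by simp
  have Ci: "C $$ (a, b) = (if a = k then 0 else B $$ (a, b)) + B $$ (k, b) * u a" if "a < n" "b < n" for a b
  proof -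
    have "C $$ (a, b) = (transpose_mat B * elem_row n k u) $$ (b, a)"
      using that Bc unfolding CT by (subst index_transpose_mat) auto
    also have "\<dots> = (if a = k then 0 else transpose_mat B $$ (b, a)) + transpose_mat B $$ (b, k) * u a"
      by (rule mult_elem_row_index) (use that kn Bc in auto)
    finally show ?thesis using that kn Bc by auto
  qed
  have C0: "C = ?E * L * T * (R * elem_row n j v)"
  proof -
    have c: "L \<in> carrier_mat n n" "T \<in> carrier_mat n n" "R \<in> carrier_mat n n" "?E \<in> carrier_mat n n"
      "elem_row n j v \<in> carrier_mat n n"
      using inv_pairD(1)[OF L] inv_pairD(1)[OF R] inv_pairD(1)[OF T] by auto
    then show ?thesis unfolding C_def B_def A_def
      by (smt (verit) assoc_mult_mat mult_carrier_mat)
  qed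
  have pE: "inv_pair n (elem_row n k u) (elem_row n k (\<lambda>b. if b = k then 1 / u k else - u b / u k))"
    by (rule elem_row_inv_pair) (use kn in \<open>auto simp: u_def\<close>)
  have pv: "inv_pair n (elem_row n j v) (elem_row n j (\<lambda>b. if b = j then 1 / v j else - v b / v j))"
    by (rule elem_row_inv_pair) (use j p in \<open>auto simp: v_def\<close>)
  let ?E' = "transpose_mat (elem_row n k (\<lambda>b. if b = k then 1 / u k else - u b / u k))"
  let ?V' = "elem_row n j (\<lambda>b. if b = j then 1 / v j else - v b / v j)"
  define w' where "w' = w(k := j)"
  have lowmult: "lower_tri n (X * Y)" if "lower_tri n X" "lower_tri n Y" "X \<in> carrier_mat n n" "Y \<in> carrier_mat n n"
    for X Y :: "'a mat"
    using that maps_coords_mult[of Y n X] unfolding lower_tri_def by blast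
  have upmult: "upper_tri n (X * Y)" if "upper_tri n X" "upper_tri n Y" "X \<in> carrier_mat n n" "Y \<in> carrier_mat n n"
    for X Y :: "'a mat"
    using that maps_coords_mult[of Y n X] unfolding upper_tri_def by blast
  have "lower_tri n ?E" "lower_tri n ?E'"
    by (auto simp: lower_tri_transpose u_def intro!: elem_row_upper)
  moreover have "upper_tri n (elem_row n j v)" "upper_tri n ?V'"
    by (auto simp: v_def intro!: elem_row_upper)
  moreover have "\<forall>i<Suc k. w' i < n" using w j by (auto simp: w'_def less_Suc_eq)
  moreover have "\<forall>i<Suc k. \<forall>b<n. C $$ (i, b) = (if b = w' i then 1 else 0)"
    using kn by (auto simp: less_Suc_eq w'_def Ci Brow Bk u_def)
  moreover have "\<forall>i<Suc k. \<forall>m<n. C $$ (m, w' i) = (if m = i then 1 else 0)"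
  proof (intro allI impI)
    fix i m assume im: "i < Suc k" "m < n"
    show "C $$ (m, w' i) = (if m = i then 1 else 0)"
    proof (cases "i = k")
      case True
      \<comment> \<open>Rows above k are unit vectors with their 1 in another column, so column j
        already vanishes above the pivot and only the part below had to be cleared.\<close>
      have "B $$ (m, j) = 0" if "m < k" using Brow[OF that j(1)] wj[OF that] by auto
      then show ?thesis using True im kn j by (auto simp: w'_def Ci Bk u_def)
    next
      case False
      then have "i < k" using im by auto
      then show ?thesis using im kn j wj[of i] w[of i]
        by (auto simp: w'_def Ci Bk Bcol)
    qed
  qed
  ultimately show ?case
    apply -
    apply (rule exI[of _ "?E * L"], rule exI[of _ "L' * ?E'"], rule exI[of _ "R * elem_row n j v"],
        rule exI[of _ "?V' * R'"], rule exI[of _ w'])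
    unfolding C0[symmetric]
    using tri inv_pair_mult[OF inv_pair_transpose[OF pE] L] inv_pair_mult[OF R pv]
      lowmult upmult inv_pairD(1,2)[OF L] inv_pairD(1,2)[OF R]
    by auto
qed

lemma bruhat:
  fixes T :: "'a :: field mat"
  assumes T: "inv_pair n T T'"
  obtains L L' R R' \<pi> where "inv_pair n L L'" "inv_pair n R R'" "lower_tri n L" "lower_tri n L'"
     "upper_tri n R" "upper_tri n R'" "bij_betw \<pi> {..<n} {..<n}"
     "L * T * R = Matrix.mat n n (\<lambda>(i, j). if i = \<pi> j then 1 else 0)"
proof -
  from bruhat_step[OF T order_refl] obtain L L' R R' w where *: "inv_pair n L L'" "inv_pair n R R'"
      "lower_tri n L" "lower_tri n L'" "upper_tri n R" "upper_tri n R'"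
    and w: "\<And>i. i < n \<Longrightarrow> w i < n"
    and row: "\<And>i b. i < n \<Longrightarrow> b < n \<Longrightarrow> (L * T * R) $$ (i, b) = (if b = w i then 1 else 0)"
    and col: "\<And>i m. i < n \<Longrightarrow> m < n \<Longrightarrow> (L * T * R) $$ (m, w i) = (if m = i then 1 else 0)"
    by fastforce
  have "inj_on w {..<n}"
  proof (rule inj_onI)
    fix x y assume "x \<in> {..<n}" "y \<in> {..<n}" "w x = w y"
    then show "x = y" using row[of x "w y"] col[of y x] w by (auto split: if_splits)
  qed
  moreover have "w ` {..<n} \<subseteq> {..<n}" using w by auto
  ultimately have bij: "bij_betw w {..<n} {..<n}"
    by (simp add: bij_betw_def endo_inj_surj)
  \<comment> \<open>\<open>w\<close> sends a row to its pivot column; the matrix in the claim sends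
    unit vector j to unit vector \<open>\<pi> j\<close> and so asks for the inverse.\<close>
  define \<pi> where "\<pi> = inv_into {..<n} w"
  have "bij_betw \<pi> {..<n} {..<n}" unfolding \<pi>_def by (rule bij_betw_inv_into[OF bij])
  moreover have "L * T * R = Matrix.mat n n (\<lambda>(i, j). if i = \<pi> j then 1 else 0)"
  proof (rule eq_matI)
    fix i j assume "i < dim_row (Matrix.mat n n (\<lambda>(i, j). if i = \<pi> j then 1 else 0 :: 'a))"
      "j < dim_col (Matrix.mat n n (\<lambda>(i, j). if i = \<pi> j then 1 else 0 :: 'a))"
    then have ij: "i < n" "j < n" by auto
    have "j = w i \<longleftrightarrow> i = \<pi> j"
      using bij ij bij_betw_inv_into_left[OF bij, of i] bij_betw_inv_into_right[OF bij, of j]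
      unfolding \<pi>_def by auto
    then show "(L * T * R) $$ (i, j) = Matrix.mat n n (\<lambda>(i, j). if i = \<pi> j then 1 else 0) $$ (i, j)"
      using ij row by auto
  qed (use inv_pairD(1)[OF *(1)] inv_pairD(1)[OF *(2)] in auto)
  ultimately show thesis using that * by blast
qed

subsection \<open>The relative position of two coordinate subspaces\<close>

text \<open>Unit vector j goes to unit vector \<open>\<pi> j\<close>, a convention under which
  composition becomes the product in the same order.\<close>

definition perm_mat :: "nat \<Rightarrow> (nat \<Rightarrow> nat) \<Rightarrow> 'a :: field mat" where
  "perm_mat n \<pi> = Matrix.mat n n (\<lambda>(i, j). if i = \<pi> j then 1 else 0)"

lemma perm_mat_carrier [simp]: "perm_mat n \<pi> \<in> carrier_mat n n"
  by (simp add: perm_mat_def)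

lemma perm_mat_mult:
  assumes "\<pi> \<in> {..<n} \<rightarrow> {..<n}"
  shows "perm_mat n \<rho> * perm_mat n \<pi> = (perm_mat n (\<rho> \<circ> \<pi>) :: 'a :: field mat)"
proof (rule eq_matI)
  fix i j assume "i < dim_row (perm_mat n (\<rho> \<circ> \<pi>) :: 'a mat)" "j < dim_col (perm_mat n (\<rho> \<circ> \<pi>) :: 'a mat)"
  then have ij: "i < n" "j < n" by (auto simp: perm_mat_def)
  have "(perm_mat n \<rho> * perm_mat n \<pi>) $$ (i, j)
      = (\<Sum>k = 0..<n. (if i = \<rho> k then 1 else 0) * (if k = \<pi> j then 1 else (0 :: 'a)))"
    using ij by (simp add: perm_mat_def scalar_prod_def)
  also have "\<dots> = (\<Sum>k = 0..<n. if k = \<pi> j then if i = \<rho> (\<pi> j) then 1 else 0 else 0)"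
    by (intro sum.cong) auto
  also have "\<dots> = perm_mat n (\<rho> \<circ> \<pi>) $$ (i, j)"
    using ij assms by (auto simp: perm_mat_def)
  finally show "(perm_mat n \<rho> * perm_mat n \<pi>) $$ (i, j) = (perm_mat n (\<rho> \<circ> \<pi>) :: 'a mat) $$ (i, j)" .
qed (auto simp: perm_mat_def)

lemma perm_mat_inv_pair:
  assumes "bij_betw \<pi> {..<n} {..<n}"
  shows "inv_pair n (perm_mat n \<pi>) (perm_mat n (inv_into {..<n} \<pi>))"
proof (rule inv_pairI)
  have "perm_mat n \<pi> * perm_mat n (inv_into {..<n} \<pi>) = (perm_mat n (\<pi> \<circ> inv_into {..<n} \<pi>) :: 'a mat)"
    using bij_betw_inv_into[OF assms] by (intro perm_mat_mult) (auto simp: bij_betw_def)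
  also have "\<dots> = 1\<^sub>m n"
    using bij_betw_inv_into_right[OF assms] by (intro eq_matI) (auto simp: perm_mat_def)
  finally show "perm_mat n \<pi> * perm_mat n (inv_into {..<n} \<pi>) = (1\<^sub>m n :: 'a mat)" .
qed auto

lemma transpose_perm_mat:
  assumes "bij_betw \<pi> {..<n} {..<n}"
  shows "transpose_mat (perm_mat n \<pi>) = (perm_mat n (inv_into {..<n} \<pi>) :: 'a :: field mat)"
proof (rule eq_matI)
  fix i j assume "i < dim_row (perm_mat n (inv_into {..<n} \<pi>) :: 'a mat)"
    "j < dim_col (perm_mat n (inv_into {..<n} \<pi>) :: 'a mat)"
  then have "i < n" "j < n" by (auto simp: perm_mat_def)
  moreover from this have "j = \<pi> i \<longleftrightarrow> i = inv_into {..<n} \<pi> j"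
    using assms bij_betw_inv_into_left[OF assms, of i] bij_betw_inv_into_right[OF assms, of j] by auto
  ultimately show "transpose_mat (perm_mat n \<pi>) $$ (i, j) = (perm_mat n (inv_into {..<n} \<pi>) :: 'a mat) $$ (i, j)"
    by (auto simp: perm_mat_def)
qed (auto simp: perm_mat_def)

lemma perm_mat_carries:
  assumes "bij_betw \<pi> {..<n} {..<n}" "I \<subseteq> {..<n}"
  shows "carries n I (\<pi> ` I) (perm_mat n \<pi>) (perm_mat n (inv_into {..<n} \<pi>))"
  using perm_mat_inv_pair[OF assms(1)] assms
  by (auto simp: carries_def maps_coords_def perm_mat_def bij_betw_def inj_on_def inv_into_f_f
    intro: inv_into_f_f[symmetric])

text \<open>The complements have equal size as well, so two bijections can be put together. This
  serves to move a set of pivots into standard position inside one block.\<close>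

lemma perm_of_subsets:
  assumes "finite X" "A \<subseteq> X" "B \<subseteq> X" "card A = card B"
  obtains \<sigma> where "bij_betw \<sigma> X X" "\<sigma> ` A = B"
proof -
  have f: "finite A" "finite B" using assms finite_subset by auto
  obtain g where g: "bij_betw g A B" using finite_same_card_bij[OF f assms(4)] by auto
  have "card (X - A) = card (X - B)" using assms f by (simp add: card_Diff_subset)
  then obtain h where h: "bij_betw h (X - A) (X - B)"
    using finite_same_card_bij[of "X - A" "X - B"] assms(1) by auto
  define \<sigma> where "\<sigma> = (\<lambda>x. if x \<in> A then g x else h x)"
  have "bij_betw \<sigma> A B" using g by (subst bij_betw_cong[of A \<sigma> g]) (auto simp: \<sigma>_def)
  moreover have "bij_betw \<sigma> (X - A) (X - B)"
    using h by (subst bij_betw_cong[of "X - A" \<sigma> h]) (auto simp: \<sigma>_def)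
  ultimately have "bij_betw \<sigma> (A \<union> (X - A)) (B \<union> (X - B))" by (intro bij_betw_combine) auto
  moreover have "A \<union> (X - A) = X" "B \<union> (X - B) = X" using assms by auto
  ultimately show thesis using that \<open>bij_betw \<sigma> A B\<close> by (auto simp: bij_betw_def)
qed

section \<open>Column spans and the rank of \<open>bold_M\<close>\<close>

lemma (in vec_space) mult_mat_vec_in_span:
  assumes A: "A \<in> carrier_mat n m" and v: "v \<in> carrier_vec m" and X: "X \<subseteq> carrier_vec n"
    and col: "\<And>i. i < m \<Longrightarrow> v $ i \<noteq> 0 \<Longrightarrow> col A i \<in> span X"
  shows "A *\<^sub>v v \<in> span X"
proof -
  \<comment> \<open>Columns with coefficient zero may lie outside the span; putting the zero vector
    in their place leaves the product unchanged.\<close>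
  define ws where "ws = map (\<lambda>i. if v $ i = 0 then 0\<^sub>v n else col A i) [0..<m]"
  have len: "length ws = m" by (simp add: ws_def)
  have "\<forall>w\<in>set ws. dim_vec w = n" using A by (auto simp: ws_def)
  note * = lincomb_list_as_mat_mult[OF this, of "\<lambda>i. v $ i"]
  have "lincomb_list (\<lambda>i. v $ i) ws = mat_of_cols n ws *\<^sub>v v"
  proof -
    have "vec m (\<lambda>i. v $ i) = v" using v by auto
    then show ?thesis using * len by simp
  qed
  also have "\<dots> = A *\<^sub>v v"
  proof (rule eq_vecI)
    fix i assume "i < dim_vec (A *\<^sub>v v)"
    then have i: "i < n" using A by auto
    show "(mat_of_cols n ws *\<^sub>v v) $ i = (A *\<^sub>v v) $ i"
      using i A v len by (auto simp: scalar_prod_def mat_of_cols_def ws_def intro!: sum.cong)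
  qed (use A in auto)
  finally have "A *\<^sub>v v = lincomb_list (\<lambda>i. v $ i) ws" ..
  also have "\<dots> \<in> span X"
    unfolding lincomb_list_def
  proof (rule sumlist_in_span[OF X])
    fix x assume "x \<in> set (map (\<lambda>i. v $ i \<cdot>\<^sub>v ws ! i) [0..<length ws])"
    then obtain i where i: "i < m" "x = v $ i \<cdot>\<^sub>v ws ! i" using len by auto
    show "x \<in> span X"
    proof (cases "v $ i = 0")
      case True
      have "0\<^sub>v n \<in> span X" by (rule in_spanI[of _ undefined "{}"]) (auto simp: lincomb_def)
      then show ?thesis using True i by (simp add: ws_def)
    next
      case False
      then show ?thesis using i smult_in_span[OF X col[of i]] by (simp add: ws_def)
    qed
  qed
  finally show ?thesis .
qed

lemma (in vec_space) inv_pair_cols_lin_indpt: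
  assumes "inv_pair n A A'"
  shows "lin_indpt (set (cols A))"
proof
  assume "lin_dep (set (cols A))"
  then have "det A = 0" using lin_dep_cols_imp_det_0 inv_pairD(1)[OF assms] by blast
  moreover have "det A * det A' = 1"
    using det_mult[of A n A'] inv_pairD[OF assms] by simp
  ultimately show False by simp
qed

lemma (in vec_space) dim_span_cols_subset:
  assumes A: "inv_pair n A A'" and I: "I \<subseteq> {..<n}"
  shows "vectorspace.dim class_ring (span_vs (col A ` I)) = card I"
proof -
  let ?X = "col A ` I"
  have Ac: "A \<in> carrier_mat n n" using inv_pairD[OF A] by auto
  have sub: "?X \<subseteq> set (cols A)" using I Ac by (auto simp: cols_def)
  have X: "?X \<subseteq> carrier_vec n" using Ac by auto
  have "lin_indpt ?X" using subset_li_is_li[OF inv_pair_cols_lin_indpt[OF A]] sub by auto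
  then have "maximal ?X (\<lambda>T. T \<subseteq> ?X \<and> lin_indpt T)" by (auto simp: maximal_def)
  then have "vectorspace.dim class_ring (span_vs ?X) = card ?X"
    using X I finite_subset[OF I] by (intro dim_span) auto
  also have "card ?X = card I"
  proof (rule card_image, rule inj_onI)
    fix i j assume ij: "i \<in> I" "j \<in> I" "col A i = col A j"
    have u: "A' *\<^sub>v col A k = unit_vec n k" if "k \<in> I" for k
    proof -
      have "A' *\<^sub>v col A k = col (A' * A) k"
        using that I inv_pairD(1,2)[OF A] by (intro col_mult2[symmetric]) auto
      then show ?thesis using inv_pairD[OF A] that I by auto
    qed
    have "unit_vec n i = (unit_vec n j :: 'a vec)" using u ij by metis
    then show "i = j" using ij I by (metis index_unit_vec(1) lessThan_iff subsetD zero_neq_one)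
  qed
  finally show ?thesis .
qed


lemma mult_unit_vec:
  assumes "A \<in> carrier_mat m n" "i < n"
  shows "A *\<^sub>v unit_vec n i = col (A :: 'a :: field mat) i"
proof -
  have "col (A * 1\<^sub>m n) i = A *\<^sub>v col (1\<^sub>m n) i" using assms by (intro col_mult2) auto
  then show ?thesis using assms by simp
qed

lemma col_mult_perm_mat:
  assumes "A \<in> carrier_mat n n" "\<pi> \<in> {..<n} \<rightarrow> {..<n}" "k < n"
  shows "col (A * perm_mat n \<pi>) k = col (A :: 'a :: field mat) (\<pi> k)"
proof -
  have "col (A * perm_mat n \<pi>) k = A *\<^sub>v col (perm_mat n \<pi>) k" using assms by (intro col_mult2) auto
  also have "col (perm_mat n \<pi>) k = (unit_vec n (\<pi> k) :: 'a vec)"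
    using assms by (intro eq_vecI) (auto simp: perm_mat_def unit_vec_def)
  also have "A *\<^sub>v \<dots> = col A (\<pi> k)" using assms by (intro mult_unit_vec) auto
  finally show ?thesis .
qed

lemma inv_pair_unique:
  assumes "inv_pair n X X'" "inv_pair n X X''"
  shows "X' = X''"
proof -
  have "X' = X' * (X * X'')" using inv_pairD[OF assms(1)] inv_pairD[OF assms(2)] by simp
  also have "\<dots> = X' * X * X''"
    using inv_pairD[OF assms(1)] inv_pairD[OF assms(2)] by (intro assoc_mult_mat[symmetric]) auto
  finally show ?thesis using inv_pairD[OF assms(1)] inv_pairD[OF assms(2)] by simp
qed

lemma inv_pair_cancel_left:
  assumes "inv_pair n X X'" "Y \<in> carrier_mat n n" "X * Y = Z"
  shows "Y = X' * Z"
  using assms assoc_mult_mat[of X' n n X n Y n] inv_pairD[OF assms(1)] by simp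

lemma inv_pair_cancel_right:
  assumes "inv_pair n X X'" "Y \<in> carrier_mat n n" "Y * X = Z"
  shows "Y = Z * X'"
  using assms assoc_mult_mat[of Y n n X n X' n] inv_pairD[OF assms(1)] by simp

lemma upper_triD: "upper_tri n X \<Longrightarrow> a < n \<Longrightarrow> b < a \<Longrightarrow> X $$ (a, b) = 0"
  unfolding upper_tri_def maps_coords_def by (metis lessThan_iff less_irrefl less_trans)

lemma lower_triD: "lower_tri n X \<Longrightarrow> b < n \<Longrightarrow> a < b \<Longrightarrow> X $$ (a, b) = 0"
  unfolding lower_tri_def maps_coords_def by (metis atLeast_iff le_refl less_trans not_less)

text \<open>In T = L' \<open>perm_mat n \<pi>\<close> R' the factor R' preserves the span of the
  first \<open>am\<close> unit vectors and L' that of the last \<open>ap\<close>. Hence the column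
  space of \<open>bold_M\<close> is the image under the injective L' of the coordinate subspace
  whose indices are counted on the right.\<close>

lemma rank_bold_M:
  fixes T :: "complex mat"
  assumes n: "n = am + a0 + ap" and T: "T \<in> carrier_mat n n"
    and L: "inv_pair n L L'" and R: "inv_pair n R R'"
    and tri: "lower_tri n L" "lower_tri n L'" "upper_tri n R" "upper_tri n R'"
    and \<pi>: "bij_betw \<pi> {..<n} {..<n}" and LTR: "L * T * R = perm_mat n \<pi>"
  shows "vec_space.rank n (bold_M am a0 ap T) = card (\<pi> ` {..<am} \<union> {am + a0..<n})"
proof -
  interpret vec_space "TYPE(complex)" n .
  note Lc = inv_pairD(1,2)[OF L] and Rc = inv_pairD(1,2)[OF R]
  have \<pi>n: "\<pi> \<in> {..<n} \<rightarrow> {..<n}" using \<pi> by (auto simp: bij_betw_def)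
  have TR: "T * R = L' * perm_mat n \<pi>"
    by (rule inv_pair_cancel_left[OF L]) (use T Lc Rc LTR assoc_mult_mat[of L n n T n R n] in auto)
  have T1: "T = L' * perm_mat n \<pi> * R'"
    by (rule inv_pair_cancel_right[OF R]) (use T TR in auto)
  let ?S = "set (cols (bold_M am a0 ap T))"
  let ?I = "\<pi> ` {..<am} \<union> {am + a0..<n}"
  let ?X = "col L' ` ?I"
  have cols: "?S = col T ` {..<am} \<union> unit_vec n ` {am + a0..<n}"
  proof -
    have "cols (bold_M am a0 ap T) = map (\<lambda>i. T *\<^sub>v unit_vec n i) [0..<am] @ map (unit_vec n) [am + a0..<n]"
      unfolding bold_M_def Let_def n[symmetric] using T by (intro cols_mat_of_cols) auto
    then show ?thesis using T n by (auto simp: mult_unit_vec)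
  qed
  have S: "?S \<subseteq> carrier_vec n" unfolding cols using T n by (auto intro!: carrier_vecI)
  have I: "?I \<subseteq> {..<n}" using \<pi>n n by auto
  then have X: "?X \<subseteq> carrier_vec n" using Lc by auto
  have "?S \<subseteq> span ?X"
  proof
    fix x assume "x \<in> ?S"
    then consider i where "i < am" "x = col T i" | j where "am + a0 \<le> j" "j < n" "x = unit_vec n j"
      unfolding cols by auto
    then show "x \<in> span ?X"
    proof cases
      case 1
      then have i: "i < n" using n by auto
      have "x = (L' * perm_mat n \<pi>) *\<^sub>v col R' i"
        unfolding 1 by (subst T1, rule col_mult2[of _ n n]) (use i Lc Rc in auto)
      also have "\<dots> \<in> span ?X"
      proof (rule mult_mat_vec_in_span[OF _ _ X])
        fix k assume k: "k < n" "col R' i $ k \<noteq> 0"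
        have "k \<le> i"
        proof (rule ccontr)
          assume "\<not> k \<le> i"
          then have "R' $$ (k, i) = 0"
            using upper_triD[OF tri(4)] k i by auto
          then show False using k i Rc by auto
        qed
        then have "col L' (\<pi> k) \<in> ?X" using 1 by auto
        then show "col (L' * perm_mat n \<pi>) k \<in> span ?X"
          using col_mult_perm_mat[OF Lc(2) \<pi>n k(1)] in_own_span[OF X] by auto
      qed (use Lc Rc i in auto)
      finally show ?thesis .
    next
      case 2
      \<comment> \<open>The unit vector is L' applied to column j of L, which has nonzero entries
        only from position j on; so only columns of L' in the last block occur.\<close>
      have "x = col (L' * L) j" using 2 inv_pairD(4)[OF L] by auto
      also have "\<dots> = L' *\<^sub>v col L j" by (rule col_mult2) (use 2 Lc in auto)
      also have "\<dots> \<in> span ?X"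
      proof (rule mult_mat_vec_in_span[OF _ _ X])
        fix k assume k: "k < n" "col L j $ k \<noteq> 0"
        have "j \<le> k"
        proof (rule ccontr)
          assume "\<not> j \<le> k"
          then have "L $$ (k, j) = 0"
            using lower_triD[OF tri(1)] k 2 by auto
          then show False using k 2 Lc by auto
        qed
        then have "col L' k \<in> ?X" using 2 k by auto
        then show "col L' k \<in> span ?X" using in_own_span[OF X] by auto
      qed (use Lc 2 in auto)
      finally show ?thesis .
    qed
  qed
  moreover have "?X \<subseteq> span ?S"
  proof
    fix x assume "x \<in> ?X"
    then consider i where "i < am" "x = col L' (\<pi> i)" | j where "am + a0 \<le> j" "j < n" "x = col L' j"
      by auto
    then show "x \<in> span ?S"
    proof cases
      case 1
      then have i: "i < n" using n by auto
      have "x = col (T * R) i" unfolding 1 TR col_mult_perm_mat[OF Lc(2) \<pi>n i] ..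
      also have "\<dots> = T *\<^sub>v col R i" by (rule col_mult2) (use i T Rc in auto)
      also have "\<dots> \<in> span ?S"
      proof (rule mult_mat_vec_in_span[OF _ _ S])
        fix k assume k: "k < n" "col R i $ k \<noteq> 0"
        have "k \<le> i"
        proof (rule ccontr)
          assume "\<not> k \<le> i"
          then have "R $$ (k, i) = 0"
            using upper_triD[OF tri(3)] k i by auto
          then show False using k i Rc by auto
        qed
        then have "col T k \<in> ?S" using 1 unfolding cols by auto
        then show "col T k \<in> span ?S" using in_own_span[OF S] by auto
      qed (use T Rc i in auto)
      finally show ?thesis .
    next
      case 2
      have "x = 1\<^sub>m n *\<^sub>v col L' j" unfolding 2 using Lc 2 by simp
      also have "\<dots> \<in> span ?S"
      proof (rule mult_mat_vec_in_span[OF _ _ S])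
        fix k assume k: "k < n" "col L' j $ k \<noteq> 0"
        have "j \<le> k"
        proof (rule ccontr)
          assume "\<not> j \<le> k"
          then have "L' $$ (k, j) = 0"
            using lower_triD[OF tri(2)] k 2 by auto
          then show False using k 2 Lc by auto
        qed
        then have "unit_vec n k \<in> ?S" using 2 k unfolding cols by auto
        then show "col (1\<^sub>m n) k \<in> span ?S" using in_own_span[OF S] k by auto
      qed (use Lc 2 in auto)
      finally show ?thesis .
    qed
  qed
  ultimately have "span ?S = span ?X"
    using span_subsetI[OF X, of ?S] span_subsetI[OF S, of ?X] by blast
  then show ?thesis
    unfolding rank_def using dim_span_cols_subset[OF inv_pair_sym[OF L] I] by simp
qed

text \<open>Here d is the dimension of the intersection of T span(block 1) with span(block 3): after
  the Bruhat decomposition it counts the pivots of the first \<open>am\<close> columns that fall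
  into block 3. The matrix U is the lower triangular factor, which preserves span(block 3), followed
  by a permutation that acts separately on blocks 1, 2 and on block 3 and sorts the pivots.\<close>

lemma relative_position:
  fixes T :: "complex mat"
  assumes n: "n = am + a0 + ap" and T: "inv_pair n T T'"
    and d: "d = am + ap - vec_space.rank n (bold_M am a0 ap T)"
  shows "d \<le> am" "d \<le> ap"
    "\<exists>U U' V. carries n {am + a0..<n} {am + a0..<n} U U' \<and>
      carries n {..<am} ({..<am - d} \<union> {am + a0..<am + a0 + d}) (U * T) V"
proof -
  obtain L L' R R' \<pi> where L: "inv_pair n L L'" and R: "inv_pair n R R'"
    and tri: "lower_tri n L" "lower_tri n L'" "upper_tri n R" "upper_tri n R'"
    and \<pi>: "bij_betw \<pi> {..<n} {..<n}" and LTR: "L * T * R = perm_mat n \<pi>"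
    using bruhat[OF T] unfolding perm_mat_def[symmetric] by metis
  note Lc = inv_pairD(1,2)[OF L] and Rc = inv_pairD(1,2)[OF R] and Tc = inv_pairD(1,2)[OF T]
  let ?I = "\<pi> ` {..<am}"
  define X1 where "X1 = {..<am + a0}"
  define X2 where "X2 = {am + a0..<n}"
  have I: "?I \<subseteq> {..<n}" and cI: "card ?I = am"
    using \<pi> n by (auto simp: bij_betw_def inj_on_def card_image)
  have X12: "{..<n} = X1 \<union> X2" "X1 \<inter> X2 = {}" "finite X1" "finite X2" "card X2 = ap"
    using n by (auto simp: X1_def X2_def)
  have "?I = (?I \<inter> X1) \<union> (?I \<inter> X2)" using I X12 by auto
  moreover have "card ((?I \<inter> X1) \<union> (?I \<inter> X2)) = card (?I \<inter> X1) + card (?I \<inter> X2)"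
    by (rule card_Un_disjoint) (use X12 in auto)
  ultimately have "card ?I = card (?I \<inter> X1) + card (?I \<inter> X2)" by simp
  then have c1: "card (?I \<inter> X1) + card (?I \<inter> X2) = am" using cI by simp
  have "?I \<union> X2 = (?I \<inter> X1) \<union> X2" using I X12 by auto
  then have "card (?I \<union> X2) = card (?I \<inter> X1) + ap"
    using X12 card_Un_disjoint[of "?I \<inter> X1" X2] by auto
  \<comment> \<open>The total \<open>am + ap\<close> minus the size of the union is the size of the
    overlap of the two index sets.\<close>
  then have d2: "d = card (?I \<inter> X2)"
    using c1 unfolding d rank_bold_M[OF n Tc(1) L R tri \<pi> LTR] X2_def[symmetric] by simp
  then show da: "d \<le> am" using c1 by simp
  show dp: "d \<le> ap" using d2 card_mono[of X2 "?I \<inter> X2"] X12 by simp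
  have "card (?I \<inter> X1) = card {..<am - d}" "{..<am - d} \<subseteq> X1"
    using c1 d2 by (auto simp: X1_def)
  then obtain \<sigma>1 where \<sigma>1: "bij_betw \<sigma>1 X1 X1" "\<sigma>1 ` (?I \<inter> X1) = {..<am - d}"
    using perm_of_subsets[of X1 "?I \<inter> X1" "{..<am - d}"] X12 by blast
  have "card (?I \<inter> X2) = card {am + a0..<am + a0 + d}" "{am + a0..<am + a0 + d} \<subseteq> X2"
    using d2 dp n by (auto simp: X2_def)
  then obtain \<sigma>2 where \<sigma>2: "bij_betw \<sigma>2 X2 X2" "\<sigma>2 ` (?I \<inter> X2) = {am + a0..<am + a0 + d}"
    using perm_of_subsets[of X2 "?I \<inter> X2" "{am + a0..<am + a0 + d}"] X12 by blast
  define \<sigma> where "\<sigma> = (\<lambda>x. if x \<in> X1 then \<sigma>1 x else \<sigma>2 x)"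
  have s1: "bij_betw \<sigma> X1 X1" using \<sigma>1 by (subst bij_betw_cong[of X1 \<sigma> \<sigma>1]) (auto simp: \<sigma>_def)
  have s2: "bij_betw \<sigma> X2 X2" using \<sigma>2 X12 by (subst bij_betw_cong[of X2 \<sigma> \<sigma>2]) (auto simp: \<sigma>_def)
  have \<sigma>: "bij_betw \<sigma> {..<n} {..<n}" unfolding X12(1) using s1 s2 X12 by (intro bij_betw_combine)
  have "\<sigma> ` (?I \<inter> X1) = {..<am - d}" "\<sigma> ` (?I \<inter> X2) = {am + a0..<am + a0 + d}"
    unfolding \<sigma>1(2)[symmetric] \<sigma>2(2)[symmetric] using X12 by (auto simp: \<sigma>_def intro!: image_cong)
  then have \<sigma>I: "\<sigma> ` ?I = {..<am - d} \<union> {am + a0..<am + a0 + d}"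
    using \<open>?I = (?I \<inter> X1) \<union> (?I \<inter> X2)\<close> by (metis image_Un)
  define S where "S = (perm_mat n \<sigma> :: complex mat)"
  define S' where "S' = (perm_mat n (inv_into {..<n} \<sigma>) :: complex mat)"
  have S: "inv_pair n S S'" unfolding S_def S'_def by (rule perm_mat_inv_pair[OF \<sigma>])
  have "maps_coords n X2 X2 L" "maps_coords n X2 X2 L'"
    using tri(1,2) unfolding lower_tri_def maps_coords_def X2_def by auto
  then have "carries n X2 X2 L L'" using L by (auto simp: carries_def)
  moreover have "carries n X2 X2 S S'"
    using perm_mat_carries[OF \<sigma>, of X2] X12 s2 unfolding S_def S'_def by (auto simp: bij_betw_def)
  ultimately have c1: "carries n X2 X2 (S * L) (L' * S')" by (rule carries_mult)
  \<comment> \<open>Upper triangular matrices preserve initial segments, so \<open>L * T\<close>,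
    which equals \<open>perm_mat n \<pi> * R'\<close>, takes span(block 1) to the coordinate
    subspace of the pivots.\<close>
  have "carries n {..<am} {..<am} R' R"
    using tri(3,4) inv_pair_sym[OF R] unfolding carries_def upper_tri_def by auto
  moreover have "carries n {..<am} ?I (perm_mat n \<pi>) (perm_mat n (inv_into {..<n} \<pi>) :: complex mat)"
    using perm_mat_carries[OF \<pi>, of "{..<am}"] n by auto
  moreover have "carries n ?I ({..<am - d} \<union> {am + a0..<am + a0 + d}) S S'"
    using perm_mat_carries[OF \<sigma> I] unfolding \<sigma>I S_def S'_def .
  ultimately have "\<exists>V. carries n {..<am} ({..<am - d} \<union> {am + a0..<am + a0 + d}) (S * (perm_mat n \<pi> * R')) V"
    by (meson carries_mult)
  moreover have "perm_mat n \<pi> * R' = L * T"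
    by (rule inv_pair_cancel_right[OF R, symmetric]) (use LTR Lc Tc in auto)
  moreover have "S * (L * T) = S * L * T"
    by (rule assoc_mult_mat[symmetric]) (use inv_pairD[OF S] Lc Tc in auto)
  ultimately show "\<exists>U U' V. carries n {am + a0..<n} {am + a0..<n} U U' \<and>
      carries n {..<am} ({..<am - d} \<union> {am + a0..<am + a0 + d}) (U * T) V"
    using c1 unfolding X2_def by metis
qed

text \<open>Transposing T inverts the permutation. As there is no middle block, the last block is
  the complement of the first and the rank is \<open>ap\<close> plus the number of i <
  \<open>am\<close> with \<open>\<pi> i\<close> < \<open>am\<close>; \<pi> itself maps these indices
  bijectively to those counted for its inverse.\<close>

lemma rank_bold_M_transpose:
  fixes T :: "complex mat"
  assumes n: "n = am + ap" and T: "inv_pair n T T'"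
  shows "vec_space.rank n (bold_M am 0 ap (transpose_mat T)) = vec_space.rank n (bold_M am 0 ap T)"
proof -
  obtain L L' R R' \<pi> where L: "inv_pair n L L'" and R: "inv_pair n R R'"
    and tri: "lower_tri n L" "lower_tri n L'" "upper_tri n R" "upper_tri n R'"
    and \<pi>: "bij_betw \<pi> {..<n} {..<n}" and LTR: "L * T * R = perm_mat n \<pi>"
    using bruhat[OF T] unfolding perm_mat_def[symmetric] by metis
  note Lc = inv_pairD(1,2)[OF L] and Rc = inv_pairD(1,2)[OF R] and Tc = inv_pairD(1,2)[OF T]
  define \<rho> where "\<rho> = inv_into {..<n} \<pi>"
  have \<rho>: "bij_betw \<rho> {..<n} {..<n}" unfolding \<rho>_def by (rule bij_betw_inv_into[OF \<pi>])
  have tri': "lower_tri n (transpose_mat R)" "lower_tri n (transpose_mat R')"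
    "upper_tri n (transpose_mat L)" "upper_tri n (transpose_mat L')"
    using tri Lc Rc lower_tri_transpose[of "transpose_mat L" n] lower_tri_transpose[of "transpose_mat L'" n]
    by (auto simp: lower_tri_transpose)
  have "transpose_mat R * transpose_mat T * transpose_mat L = transpose_mat (L * T * R)"
    using transpose_mult[of "L * T" n n R n] transpose_mult[of L n n T n] Lc Tc Rc
      assoc_mult_mat[of "transpose_mat R" n n "transpose_mat T" n "transpose_mat L" n]
    by simp
  also have "\<dots> = perm_mat n \<rho>" unfolding LTR \<rho>_def by (rule transpose_perm_mat[OF \<pi>])
  finally have RTL: "transpose_mat R * transpose_mat T * transpose_mat L = perm_mat n \<rho>" .
  have card: "card (\<tau> ` {..<am} \<union> {am..<n}) = card {i. i < am \<and> \<tau> i < am} + ap"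
    if \<tau>: "bij_betw \<tau> {..<n} {..<n}" for \<tau>
  proof -
    have "\<tau> i < n" if "i < am" for i using \<tau> n that bij_betwE[OF \<tau>] by auto
    then have "\<tau> ` {..<am} \<union> {am..<n} = \<tau> ` {i. i < am \<and> \<tau> i < am} \<union> {am..<n}"
      by auto
    also have "card \<dots> = card (\<tau> ` {i. i < am \<and> \<tau> i < am}) + card {am..<n}"
      by (rule card_Un_disjoint) auto
    also have "card (\<tau> ` {i. i < am \<and> \<tau> i < am}) = card {i. i < am \<and> \<tau> i < am}"
      by (rule card_image, rule inj_on_subset[OF bij_betw_imp_inj_on[OF \<tau>]]) (use n in auto)
    finally show ?thesis using n by simp
  qed
  have "bij_betw \<pi> {i. i < am \<and> \<pi> i < am} {i. i < am \<and> \<rho> i < am}"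
  proof (rule bij_betw_byWitness[where f' = \<rho>])
    have inv: "\<rho> (\<pi> i) = i" "\<pi> (\<rho> i) = i" if "i < am" for i
      using that n bij_betw_inv_into_left[OF \<pi>, of i] bij_betw_inv_into_right[OF \<pi>, of i]
      by (auto simp: \<rho>_def)
    show "\<pi> ` {i. i < am \<and> \<pi> i < am} \<subseteq> {i. i < am \<and> \<rho> i < am}"
      "\<rho> ` {i. i < am \<and> \<rho> i < am} \<subseteq> {i. i < am \<and> \<pi> i < am}" using inv by auto
    show "\<forall>a\<in>{i. i < am \<and> \<pi> i < am}. \<rho> (\<pi> a) = a" "\<forall>a\<in>{i. i < am \<and> \<rho> i < am}. \<pi> (\<rho> a) = a"
      using inv by auto
  qed
  then have "card {i. i < am \<and> \<pi> i < am} = card {i. i < am \<and> \<rho> i < am}" by (rule bij_betw_same_card)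
  moreover have "vec_space.rank n (bold_M am 0 ap (transpose_mat T)) = card (\<rho> ` {..<am} \<union> {am + 0..<n})"
    by (rule rank_bold_M[OF _ _ inv_pair_transpose[OF R] inv_pair_transpose[OF L] tri' \<rho> RTL]) (use n Tc in auto)
  moreover have "vec_space.rank n (bold_M am 0 ap T) = card (\<pi> ` {..<am} \<union> {am + 0..<n})"
    by (rule rank_bold_M[OF _ Tc(1) L R tri \<pi> LTR]) (use n in auto)
  ultimately show ?thesis using card[OF \<pi>] card[OF \<rho>] by simp
qed

subsection \<open>Modules over sl(2) without subtraction\<close>

text \<open>
  The axioms as identities, which transfer along bijections and to products.  Commutativity of
  the addition is omitted because it follows from expanding 2 (x + y) in two ways.
\<close>

definition sl2_laws :: "'v sl2_rep \<Rightarrow> bool" where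
  "sl2_laws M \<longleftrightarrow>
     \<zero>\<^bsub>M\<^esub> \<in> carrier M \<and>
     (\<forall>x\<in>carrier M. act_e M x \<in> carrier M \<and> act_f M x \<in> carrier M \<and> act_h M x \<in> carrier M \<and>
        \<zero>\<^bsub>M\<^esub> \<oplus>\<^bsub>M\<^esub> x = x \<and> 1 \<odot>\<^bsub>M\<^esub> x = x \<and> 0 \<odot>\<^bsub>M\<^esub> x = \<zero>\<^bsub>M\<^esub> \<and>
        act_h M (act_e M x) = act_e M (act_h M x) \<oplus>\<^bsub>M\<^esub> act_e M x \<and>
        act_f M (act_h M x) = act_h M (act_f M x) \<oplus>\<^bsub>M\<^esub> act_f M x \<and>
        act_e M (act_f M x) = act_f M (act_e M x) \<oplus>\<^bsub>M\<^esub> 2 \<odot>\<^bsub>M\<^esub> act_h M x) \<and>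
     (\<forall>x\<in>carrier M. \<forall>c. c \<odot>\<^bsub>M\<^esub> x \<in> carrier M \<and>
        act_e M (c \<odot>\<^bsub>M\<^esub> x) = c \<odot>\<^bsub>M\<^esub> act_e M x \<and> act_f M (c \<odot>\<^bsub>M\<^esub> x) = c \<odot>\<^bsub>M\<^esub> act_f M x \<and>
        act_h M (c \<odot>\<^bsub>M\<^esub> x) = c \<odot>\<^bsub>M\<^esub> act_h M x \<and>
        (\<forall>d. (c + d) \<odot>\<^bsub>M\<^esub> x = c \<odot>\<^bsub>M\<^esub> x \<oplus>\<^bsub>M\<^esub> d \<odot>\<^bsub>M\<^esub> x \<and> (c * d) \<odot>\<^bsub>M\<^esub> x = c \<odot>\<^bsub>M\<^esub> (d \<odot>\<^bsub>M\<^esub> x))) \<and>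
     (\<forall>x\<in>carrier M. \<forall>y\<in>carrier M. x \<oplus>\<^bsub>M\<^esub> y \<in> carrier M \<and>
        act_e M (x \<oplus>\<^bsub>M\<^esub> y) = act_e M x \<oplus>\<^bsub>M\<^esub> act_e M y \<and>
        act_f M (x \<oplus>\<^bsub>M\<^esub> y) = act_f M x \<oplus>\<^bsub>M\<^esub> act_f M y \<and>
        act_h M (x \<oplus>\<^bsub>M\<^esub> y) = act_h M x \<oplus>\<^bsub>M\<^esub> act_h M y \<and>
        (\<forall>c. c \<odot>\<^bsub>M\<^esub> (x \<oplus>\<^bsub>M\<^esub> y) = c \<odot>\<^bsub>M\<^esub> x \<oplus>\<^bsub>M\<^esub> c \<odot>\<^bsub>M\<^esub> y) \<and>
        (\<forall>z\<in>carrier M. x \<oplus>\<^bsub>M\<^esub> y \<oplus>\<^bsub>M\<^esub> z = x \<oplus>\<^bsub>M\<^esub> (y \<oplus>\<^bsub>M\<^esub> z)))"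

lemma sl2_laws_abelian_group:
  fixes M :: "'v sl2_rep"
  assumes laws: "sl2_laws M"
  shows "abelian_group M"
proof -
  have neg: "\<exists>y\<in>carrier M. y \<oplus>\<^bsub>M\<^esub> x = \<zero>\<^bsub>M\<^esub>" if x: "x \<in> carrier M" for x
  proof (rule bexI[of _ "(- 1) \<odot>\<^bsub>M\<^esub> x"])
    have "(- 1) \<odot>\<^bsub>M\<^esub> x \<oplus>\<^bsub>M\<^esub> x = (- 1 + 1) \<odot>\<^bsub>M\<^esub> x"
      using laws x unfolding sl2_laws_def by metis
    also have "\<dots> = \<zero>\<^bsub>M\<^esub>" using laws x by (simp add: sl2_laws_def)
    finally show "(- 1) \<odot>\<^bsub>M\<^esub> x \<oplus>\<^bsub>M\<^esub> x = \<zero>\<^bsub>M\<^esub>" .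
    show "(- 1) \<odot>\<^bsub>M\<^esub> x \<in> carrier M" using laws x by (simp add: sl2_laws_def)
  qed
  then have "group (add_monoid M)"
    using laws by (intro groupI) (simp_all add: sl2_laws_def)
  then interpret G: group "add_monoid M" .
  have comm: "x \<oplus>\<^bsub>M\<^esub> y = y \<oplus>\<^bsub>M\<^esub> x" if x: "x \<in> carrier M" and y: "y \<in> carrier M" for x y
  proof -
    have 2: "2 \<odot>\<^bsub>M\<^esub> z = z \<oplus>\<^bsub>M\<^esub> z" if "z \<in> carrier M" for z
    proof -
      have "(1 + 1) \<odot>\<^bsub>M\<^esub> z = 1 \<odot>\<^bsub>M\<^esub> z \<oplus>\<^bsub>M\<^esub> 1 \<odot>\<^bsub>M\<^esub> z"
        using laws that unfolding sl2_laws_def by metis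
      then show ?thesis using laws that by (simp add: sl2_laws_def)
    qed
    have c: "x \<oplus>\<^bsub>M\<^esub> y \<in> carrier M" "y \<oplus>\<^bsub>M\<^esub> x \<in> carrier M" "x \<oplus>\<^bsub>M\<^esub> y \<oplus>\<^bsub>M\<^esub> y \<in> carrier M"
      "y \<oplus>\<^bsub>M\<^esub> (x \<oplus>\<^bsub>M\<^esub> y) \<in> carrier M" "x \<oplus>\<^bsub>M\<^esub> (y \<oplus>\<^bsub>M\<^esub> y) \<in> carrier M"
      using laws x y by (simp_all add: sl2_laws_def)
    have "2 \<odot>\<^bsub>M\<^esub> (x \<oplus>\<^bsub>M\<^esub> y) = 2 \<odot>\<^bsub>M\<^esub> x \<oplus>\<^bsub>M\<^esub> 2 \<odot>\<^bsub>M\<^esub> y"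
      using laws x y by (simp add: sl2_laws_def)
    then have "(x \<oplus>\<^bsub>M\<^esub> y) \<oplus>\<^bsub>M\<^esub> (x \<oplus>\<^bsub>M\<^esub> y) = (x \<oplus>\<^bsub>M\<^esub> x) \<oplus>\<^bsub>M\<^esub> (y \<oplus>\<^bsub>M\<^esub> y)"
      by (simp only: 2[OF x] 2[OF y] 2[OF c(1)])
    then have "x \<oplus>\<^bsub>M\<^esub> (y \<oplus>\<^bsub>M\<^esub> (x \<oplus>\<^bsub>M\<^esub> y)) = x \<oplus>\<^bsub>M\<^esub> (x \<oplus>\<^bsub>M\<^esub> (y \<oplus>\<^bsub>M\<^esub> y))"
      using laws x y by (simp add: sl2_laws_def)
    then have "y \<oplus>\<^bsub>M\<^esub> (x \<oplus>\<^bsub>M\<^esub> y) = x \<oplus>\<^bsub>M\<^esub> (y \<oplus>\<^bsub>M\<^esub> y)"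
      using G.Units_l_cancel[of x "y \<oplus>\<^bsub>M\<^esub> (x \<oplus>\<^bsub>M\<^esub> y)" "x \<oplus>\<^bsub>M\<^esub> (y \<oplus>\<^bsub>M\<^esub> y)"] x c by (simp add: G.Units_eq)
    then have "(y \<oplus>\<^bsub>M\<^esub> x) \<oplus>\<^bsub>M\<^esub> y = (x \<oplus>\<^bsub>M\<^esub> y) \<oplus>\<^bsub>M\<^esub> y"
      using laws x y by (simp add: sl2_laws_def)
    then show ?thesis using G.right_cancel[of y "y \<oplus>\<^bsub>M\<^esub> x" "x \<oplus>\<^bsub>M\<^esub> y"] y c by simp
  qed
  show ?thesis
  proof (rule abelian_groupI)
    show "\<exists>y\<in>carrier M. y \<oplus>\<^bsub>M\<^esub> x = \<zero>\<^bsub>M\<^esub>" if "x \<in> carrier M" for x by (rule neg[OF that])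
    show "x \<oplus>\<^bsub>M\<^esub> y = y \<oplus>\<^bsub>M\<^esub> x" if "x \<in> carrier M" "y \<in> carrier M" for x y by (rule comm[OF that])
  qed (use laws in \<open>simp_all add: sl2_laws_def\<close>)
qed

lemma sl2_laws_imp_sl2_module:
  fixes M :: "'v sl2_rep"
  assumes laws: "sl2_laws M"
  shows "sl2_module M"
proof -
  have ab: "abelian_group M" by (rule sl2_laws_abelian_group[OF laws])
  interpret abelian_group M by (rule ab)
  have "module complex_field M"
    by (rule moduleI[OF class_cring.cring_axioms ab]) (use laws in \<open>simp_all add: sl2_laws_def\<close>)
  then have "vectorspace complex_field M"
    by (simp add: vectorspace_def class_field)
  moreover have cancel: "a \<oplus>\<^bsub>M\<^esub> b \<oplus>\<^bsub>M\<^esub> \<ominus>\<^bsub>M\<^esub> a = b" if "a \<in> carrier M" "b \<in> carrier M" for a b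
    using that a_comm[of a b] by (simp add: a_assoc r_neg)
  moreover have "act_h M (act_e M v) \<ominus>\<^bsub>M\<^esub> act_e M (act_h M v) = act_e M v"
    "act_h M (act_f M v) \<ominus>\<^bsub>M\<^esub> act_f M (act_h M v) = \<ominus>\<^bsub>M\<^esub> act_f M v"
    "act_e M (act_f M v) \<ominus>\<^bsub>M\<^esub> act_f M (act_e M v) = 2 \<odot>\<^bsub>M\<^esub> act_h M v" if v: "v \<in> carrier M" for v
  proof -
    have c: "act_e M (act_h M v) \<in> carrier M" "act_e M v \<in> carrier M" "act_f M v \<in> carrier M"
      "act_h M (act_f M v) \<in> carrier M" "act_f M (act_e M v) \<in> carrier M" "2 \<odot>\<^bsub>M\<^esub> act_h M v \<in> carrier M"
      "act_h M (act_e M v) = act_e M (act_h M v) \<oplus>\<^bsub>M\<^esub> act_e M v"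
      "act_f M (act_h M v) = act_h M (act_f M v) \<oplus>\<^bsub>M\<^esub> act_f M v"
      "act_e M (act_f M v) = act_f M (act_e M v) \<oplus>\<^bsub>M\<^esub> 2 \<odot>\<^bsub>M\<^esub> act_h M v"
      using laws v by (simp_all add: sl2_laws_def)
    show "act_h M (act_e M v) \<ominus>\<^bsub>M\<^esub> act_e M (act_h M v) = act_e M v"
      "act_e M (act_f M v) \<ominus>\<^bsub>M\<^esub> act_f M (act_e M v) = 2 \<odot>\<^bsub>M\<^esub> act_h M v"
      using c(1-6) cancel by (simp_all add: c(7,9) a_minus_def)
    show "act_h M (act_f M v) \<ominus>\<^bsub>M\<^esub> act_f M (act_h M v) = \<ominus>\<^bsub>M\<^esub> act_f M v"
      using c(1-6) by (simp add: c(8) a_minus_def minus_add r_neg2)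
  qed
  ultimately show ?thesis
    using laws unfolding sl2_module_def LinearCombinations.module_hom_def
    by (simp add: sl2_laws_def)
qed

lemma sl2_module_imp_sl2_laws:
  fixes M :: "'v sl2_rep"
  assumes M: "sl2_module M"
  shows "sl2_laws M"
proof -
  interpret vectorspace complex_field M using M by (simp add: sl2_module_def)
  have hom: "act_e M \<in> LinearCombinations.module_hom complex_field M M"
      "act_f M \<in> LinearCombinations.module_hom complex_field M M"
      "act_h M \<in> LinearCombinations.module_hom complex_field M M"
    and br: "\<And>v. v \<in> carrier M \<Longrightarrow> act_h M (act_e M v) \<ominus>\<^bsub>M\<^esub> act_e M (act_h M v) = act_e M v"
      "\<And>v. v \<in> carrier M \<Longrightarrow> act_h M (act_f M v) \<ominus>\<^bsub>M\<^esub> act_f M (act_h M v) = \<ominus>\<^bsub>M\<^esub> act_f M v"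
      "\<And>v. v \<in> carrier M \<Longrightarrow> act_e M (act_f M v) \<ominus>\<^bsub>M\<^esub> act_f M (act_e M v) = 2 \<odot>\<^bsub>M\<^esub> act_h M v"
    using M by (auto simp: sl2_module_def)
  have cl: "act_e M v \<in> carrier M" "act_f M v \<in> carrier M" "act_h M v \<in> carrier M" if "v \<in> carrier M" for v
    using hom that by (auto simp: LinearCombinations.module_hom_def)
  have sub: "a = b \<oplus>\<^bsub>M\<^esub> c" if "a \<ominus>\<^bsub>M\<^esub> b = c" "a \<in> carrier M" "b \<in> carrier M" for a b c
    using that by (auto simp: a_minus_def M.a_ac M.r_neg)
  have sub': "b = a \<oplus>\<^bsub>M\<^esub> c" if "a \<ominus>\<^bsub>M\<^esub> b = \<ominus>\<^bsub>M\<^esub> c" "a \<in> carrier M" "b \<in> carrier M" "c \<in> carrier M" for a b c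
  proof -
    have "a = b \<oplus>\<^bsub>M\<^esub> \<ominus>\<^bsub>M\<^esub> c" using sub[OF that(1-3)] .
    then show ?thesis using that(2-4) by (simp add: M.a_assoc M.l_neg)
  qed
  note smult_l = smult_l_distr smult_assoc1 smult_r_distr smult_closed smult_one lmult_0
  show ?thesis
    unfolding sl2_laws_def
    using hom cl sub[OF br(1)] sub'[OF br(2)] sub[OF br(3)] smult_l
    by (auto simp: LinearCombinations.module_hom_def M.a_assoc intro: M.a_comm)
qed

text \<open>Only N is known to be a module. As \<theta> is injective, each identity of
  \<open>sl2_laws\<close> for M can be tested after applying \<theta>, so the module axioms for M
  come with the isomorphism.\<close>

lemma sl2_iso_transport:
  fixes M :: "'v sl2_rep" and N :: "'w sl2_rep"
  assumes N: "sl2_laws N"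
    and bij: "bij_betw \<theta> (carrier M) (carrier N)"
    and zero: "\<zero>\<^bsub>M\<^esub> \<in> carrier M" "\<theta> \<zero>\<^bsub>M\<^esub> = \<zero>\<^bsub>N\<^esub>"
    and add: "\<And>x y. x \<in> carrier M \<Longrightarrow> y \<in> carrier M \<Longrightarrow> x \<oplus>\<^bsub>M\<^esub> y \<in> carrier M \<and> \<theta> (x \<oplus>\<^bsub>M\<^esub> y) = \<theta> x \<oplus>\<^bsub>N\<^esub> \<theta> y"
    and smult: "\<And>c x. x \<in> carrier M \<Longrightarrow> c \<odot>\<^bsub>M\<^esub> x \<in> carrier M \<and> \<theta> (c \<odot>\<^bsub>M\<^esub> x) = c \<odot>\<^bsub>N\<^esub> \<theta> x"
    and e: "\<And>x. x \<in> carrier M \<Longrightarrow> act_e M x \<in> carrier M \<and> \<theta> (act_e M x) = act_e N (\<theta> x)"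
    and f: "\<And>x. x \<in> carrier M \<Longrightarrow> act_f M x \<in> carrier M \<and> \<theta> (act_f M x) = act_f N (\<theta> x)"
    and h: "\<And>x. x \<in> carrier M \<Longrightarrow> act_h M x \<in> carrier M \<and> \<theta> (act_h M x) = act_h N (\<theta> x)"
  shows "M \<simeq>\<^sub>s N"
proof -
  have inj: "x = y \<longleftrightarrow> \<theta> x = \<theta> y" if "x \<in> carrier M" "y \<in> carrier M" for x y
    using bij that by (auto simp: bij_betw_def inj_on_def)
  have im: "\<theta> x \<in> carrier N" if "x \<in> carrier M" for x using bij that by (auto simp: bij_betw_def)
  have "sl2_laws M"
    using N unfolding sl2_laws_def by (simp add: inj zero add smult e f h im)
  moreover have "\<theta> \<in> LinearCombinations.module_hom complex_field M N"
    using add smult im by (auto simp: LinearCombinations.module_hom_def)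
  ultimately show ?thesis
    unfolding sl2_iso_def
    using sl2_laws_imp_sl2_module[OF N] sl2_laws_imp_sl2_module[of M] bij e f h
    by (intro conjI bexI[of _ \<theta>]) auto
qed

text \<open>The assumption is [e,f] = 2h evaluated on the basis vector of weight \<nu>; the other
  two brackets hold because e and f shift the weight by one.\<close>

lemma sl2_laws_degree1_family:
  assumes "\<And>\<nu>. q \<nu> * p (\<nu> - 1) - p \<nu> * q (\<nu> + 1) = 2 * \<nu>"
  shows "sl2_laws (degree1_family p q)"
proof -
  have fin_shift: "finite {\<nu>. r \<nu> * x (\<nu> + a) \<noteq> 0}" if "finite {\<nu>. x \<nu> \<noteq> (0 :: complex)}" for r x and a :: complex
  proof (rule finite_subset[OF _ finite_imageI[OF that, of "\<lambda>\<nu>. \<nu> - a"]])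
    show "{\<nu>. r \<nu> * x (\<nu> + a) \<noteq> 0} \<subseteq> (\<lambda>\<nu>. \<nu> - a) ` {\<nu>. x \<nu> \<noteq> 0}"
    proof
      fix \<nu> assume "\<nu> \<in> {\<nu>. r \<nu> * x (\<nu> + a) \<noteq> 0}"
      then show "\<nu> \<in> (\<lambda>\<nu>. \<nu> - a) ` {\<nu>. x \<nu> \<noteq> 0}" by (intro image_eqI[of _ _ "\<nu> + a"]) auto
    qed
  qed
  have fin_add: "finite {\<nu>. x \<nu> + y \<nu> \<noteq> 0}" if "finite {\<nu>. x \<nu> \<noteq> (0 :: complex)}" "finite {\<nu>. y \<nu> \<noteq> 0}" for x y
    by (rule finite_subset[OF _ finite_UnI[OF that]]) auto
  have br: "p (\<mu> - 1) * (q \<mu> * x \<mu>) = q (\<mu> + 1) * (p \<mu> * x \<mu>) + 2 * (\<mu> * x \<mu>)" for \<mu> x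
    using arg_cong[OF assms[of \<mu>], of "\<lambda>t. t * x \<mu>"] by (simp add: algebra_simps)
  show ?thesis
    unfolding sl2_laws_def degree1_family_def
    using fin_shift[of _ "\<lambda>\<nu>. p (\<nu> - 1)" "- 1"] fin_shift[of _ "\<lambda>\<nu>. q (\<nu> + 1)" 1]
      fin_shift[of _ _ 0] fin_add br
    by (auto simp: fun_eq_iff algebra_simps)
qed

lemma sl2_laws_direct_sum:
  fixes Ms :: "'v sl2_rep list"
  assumes "\<And>N. N \<in> set Ms \<Longrightarrow> sl2_laws N"
  shows "sl2_laws (sl2_direct_sum Ms)"
proof -
  let ?D = "sl2_direct_sum Ms"
  have laws: "sl2_laws (Ms ! i)" if "i < length Ms" for i using assms that by auto
  note laws' = laws[unfolded sl2_laws_def]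
  have C: "x i \<in> carrier (Ms ! i)" if "x \<in> carrier ?D" "i < length Ms" for x i
    using that by (auto simp: sl2_direct_sum_def)
  have eqI: "x = y" if "x \<in> carrier ?D" "y \<in> carrier ?D" "\<And>i. i < length Ms \<Longrightarrow> x i = y i" for x y
    using that by (auto simp: sl2_direct_sum_def intro: PiE_ext)
  have comp: "\<zero>\<^bsub>?D\<^esub> i = \<zero>\<^bsub>Ms ! i\<^esub>" "(x \<oplus>\<^bsub>?D\<^esub> y) i = x i \<oplus>\<^bsub>Ms ! i\<^esub> y i"
    "(c \<odot>\<^bsub>?D\<^esub> x) i = c \<odot>\<^bsub>Ms ! i\<^esub> x i" "act_e ?D x i = act_e (Ms ! i) (x i)"
    "act_f ?D x i = act_f (Ms ! i) (x i)" "act_h ?D x i = act_h (Ms ! i) (x i)" if "i < length Ms" for x y c i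
    using that by (auto simp: sl2_direct_sum_def)
  have cl: "\<zero>\<^bsub>?D\<^esub> \<in> carrier ?D"
    by (simp add: sl2_direct_sum_def restrict_PiE_iff laws')
  have cl1: "c \<odot>\<^bsub>?D\<^esub> x \<in> carrier ?D" "act_e ?D x \<in> carrier ?D" "act_f ?D x \<in> carrier ?D"
    "act_h ?D x \<in> carrier ?D" if "x \<in> carrier ?D" for x c
    using C[OF that] by (simp_all add: sl2_direct_sum_def restrict_PiE_iff laws')
  have cl2: "x \<oplus>\<^bsub>?D\<^esub> y \<in> carrier ?D" if "x \<in> carrier ?D" "y \<in> carrier ?D" for x y
    using C[OF that(1)] C[OF that(2)] by (simp add: sl2_direct_sum_def restrict_PiE_iff laws')
  show ?thesis
    unfolding sl2_laws_def
    by (intro conjI ballI allI; (simp add: cl cl1 cl2; fail)?;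
        rule eqI; (simp add: cl cl1 cl2; fail)?; simp add: comp C laws')
qed

subsection \<open>Intertwining families of matrices\<close>

lemma mat_diag_inv_pair:
  assumes "\<And>i. i < n \<Longrightarrow> f i \<noteq> 0"
  shows "inv_pair n (mat_diag n f) (mat_diag n (\<lambda>i. 1 / f i))"
proof (rule inv_pairI)
  have "mat_diag n (\<lambda>i. f i * (1 / f i)) = 1\<^sub>m n" using assms by (auto simp: mat_diag_def intro!: eq_matI)
  then show "mat_diag n f * mat_diag n (\<lambda>i. 1 / f i) = 1\<^sub>m n" by (simp only: mat_diag_diag)
qed auto

lemma maps_coords_cong:
  assumes "\<And>i. i < n \<Longrightarrow> i \<in> I \<longleftrightarrow> i \<in> I'" "\<And>i. i < n \<Longrightarrow> i \<in> J \<longleftrightarrow> i \<in> J'"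
  shows "maps_coords n I J X \<longleftrightarrow> maps_coords n I' J' X"
  using assms by (auto simp: maps_coords_def)

lemma carries_cong:
  assumes "carries n I J X X'" "\<And>i. i < n \<Longrightarrow> i \<in> I \<longleftrightarrow> i \<in> I'" "\<And>i. i < n \<Longrightarrow> i \<in> J \<longleftrightarrow> i \<in> J'"
  shows "carries n I' J' X X'"
  using assms maps_coords_cong[of n I I' J J' X] maps_coords_cong[of n J J' I I' X'] by (auto simp: carries_def)

lemma mat_diag_carries:
  assumes "\<And>i. i < n \<Longrightarrow> f i \<noteq> 0"
  shows "carries n I I (mat_diag n f) (mat_diag n (\<lambda>i. 1 / f i))"
  using mat_diag_inv_pair[OF assms] by (auto simp: carries_def maps_coords_def mat_diag_def)

text \<open>An isomorphism on two neighbouring weight spaces, X at weight \<mu> and Y at weight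
  \<mu> + 1. Between them f and e are \<open>p\<close> and \<open>p'\<close> on the source,
  \<open>q\<close> and \<open>q'\<close> on the target.\<close>

definition intertwine ::
    "nat \<Rightarrow> (nat \<Rightarrow> complex) \<Rightarrow> (nat \<Rightarrow> complex) \<Rightarrow> (nat \<Rightarrow> complex) \<Rightarrow> (nat \<Rightarrow> complex) \<Rightarrow>
     complex mat \<Rightarrow> complex mat \<Rightarrow> bool" where
  "intertwine n p p' q q' X Y \<longleftrightarrow>
     (\<exists>X'. inv_pair n X X') \<and> (\<exists>Y'. inv_pair n Y Y') \<and>
     X * mat_diag n p = mat_diag n q * Y \<and> Y * mat_diag n p' = mat_diag n q' * X"

lemma intertwine_sym: "intertwine n p p' q q' X Y \<Longrightarrow> intertwine n p' p q' q Y X"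
  by (auto simp: intertwine_def)

lemma intertwine_same:
  assumes "\<And>i. i < n \<Longrightarrow> p i = q i" "\<And>i. i < n \<Longrightarrow> p' i = q' i"
  shows "intertwine n p p' q q' (1\<^sub>m n) (1\<^sub>m n)"
proof -
  have "mat_diag n p = mat_diag n q" "mat_diag n p' = mat_diag n q'"
    using assms by (auto simp: mat_diag_def intro!: eq_matI)
  then show ?thesis using inv_pair_one by (auto simp: intertwine_def left_mult_one_mat[of _ n n] right_mult_one_mat[of _ n n])
qed

text \<open>The first relation forces Y, because \<open>q\<close> is invertible; the second follows
  since \<open>p'\<close> and \<open>q'\<close> are l times the inverses of \<open>p\<close> and
  \<open>q\<close>.\<close>

lemma intertwine_regular:
  assumes X: "inv_pair n X X'"
    and pq: "\<And>i. i < n \<Longrightarrow> p i * p' i = l" "\<And>i. i < n \<Longrightarrow> q i * q' i = l" and l: "l \<noteq> 0"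
  shows "intertwine n p p' q q' X (mat_diag n (\<lambda>i. 1 / q i) * (X * mat_diag n p))"
proof -
  let ?Q = "mat_diag n (\<lambda>i. 1 / q i)"
  have nz: "p i \<noteq> 0" "q i \<noteq> 0" if "i < n" for i using pq[OF that] l by auto
  note Xc = inv_pairD(1)[OF X]
  have Y: "?Q * (X * mat_diag n p) = Matrix.mat n n (\<lambda>(i, j). X $$ (i, j) * p j / q i)"
    using Xc by (subst mat_diag_mult_left[of _ n n], simp, subst mat_diag_mult_right[of _ n n])
      (auto intro!: eq_matI)
  have "inv_pair n ?Q (mat_diag n (\<lambda>i. 1 / (1 / q i)))"
    by (rule mat_diag_inv_pair) (use nz in auto)
  then have "\<exists>Y'. inv_pair n (?Q * (X * mat_diag n p)) Y'"
    using inv_pair_mult X mat_diag_inv_pair[of n p] nz by metis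
  moreover have "X * mat_diag n p = mat_diag n q * (?Q * (X * mat_diag n p))"
    unfolding Y using Xc nz by (subst mat_diag_mult_left[of _ n n], simp, subst mat_diag_mult_right[of _ n n])
      (auto intro!: eq_matI)
  moreover have "?Q * (X * mat_diag n p) * mat_diag n p' = mat_diag n q' * X"
    unfolding Y
  proof (subst mat_diag_mult_right[of _ n n], simp, subst mat_diag_mult_left[of _ n n], simp add: Xc, rule eq_matI)
    fix i j assume "i < dim_row (Matrix.mat n n (\<lambda>(i, j). q' i * X $$ (i, j)))"
      "j < dim_col (Matrix.mat n n (\<lambda>(i, j). q' i * X $$ (i, j)))"
    then have ij: "i < n" "j < n" by auto
    have "X $$ (i, j) * p j / q i * p' j = X $$ (i, j) * (p j * p' j) / q i" by simp
    also have "\<dots> = q' i * X $$ (i, j)"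
      using pq(1)[OF ij(2)] pq(2)[OF ij(1), symmetric] nz(2)[OF ij(1)] by (simp add: field_simps)
    finally show "Matrix.mat n n (\<lambda>(i, j). Matrix.mat n n (\<lambda>(i, j). X $$ (i, j) * p j / q i) $$ (i, j) * p' j) $$ (i, j)
        = Matrix.mat n n (\<lambda>(i, j). q' i * X $$ (i, j)) $$ (i, j)" using ij by simp
  qed auto
  ultimately show ?thesis using X by (auto simp: intertwine_def)
qed

text \<open>
  Y is \<open>q\<^sup>+ X p + q' X p'\<^sup>+\<close> with pseudoinverses \<open>+\<close> of diagonal matrices; the condition on X says that it
  maps the image of p onto the image of q.
\<close>

lemma intertwine_singular:
  assumes X: "carries n {i. p i \<noteq> 0} {i. q i \<noteq> 0} X X'"
    and p: "\<And>i. i < n \<Longrightarrow> p i = 0 \<longleftrightarrow> p' i \<noteq> 0" and q: "\<And>i. i < n \<Longrightarrow> q i = 0 \<longleftrightarrow> q' i \<noteq> 0"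
  shows "\<exists>Y. intertwine n p p' q q' X Y"
proof -
  have XX: "inv_pair n X X'" and m: "maps_coords n {i. p i \<noteq> 0} {i. q i \<noteq> 0} X"
    "maps_coords n {i. q i \<noteq> 0} {i. p i \<noteq> 0} X'" using X by (auto simp: carries_def)
  note Xc = inv_pairD(1,2)[OF XX]
  have X0: "X $$ (i, j) = 0" if "i < n" "j < n" "p j \<noteq> 0" "q i = 0" for i j
    using maps_coordsD[OF m(1)] that by auto
  have X'0: "X' $$ (i, j) = 0" if "i < n" "j < n" "q j \<noteq> 0" "p i = 0" for i j
    using maps_coordsD[OF m(2)] that by auto
  define Y where "Y = Matrix.mat n n (\<lambda>(i, j). if q i \<noteq> 0 then X $$ (i, j) * p j / q i else q' i * X $$ (i, j) / p' j)"
  define Y' where "Y' = Matrix.mat n n (\<lambda>(i, j). if p i \<noteq> 0 then X' $$ (i, j) * q j / p i else p' i * X' $$ (i, j) / q' j)"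
  have Yc: "Y \<in> carrier_mat n n" "Y' \<in> carrier_mat n n" by (auto simp: Y_def Y'_def)
  have "Y * Y' = 1\<^sub>m n"
  proof (rule eq_matI)
    fix i k assume "i < dim_row (1\<^sub>m n)" "k < dim_col (1\<^sub>m n)"
    then have ik: "i < n" "k < n" by auto
    \<comment> \<open>The factors depending on j cancel between Y and Y', and both sides vanish if
      exactly one of \<open>p j\<close> and \<open>q i\<close> is zero. The remaining scalar is 1
      for k = i.\<close>
    define c where "c = (if q i \<noteq> 0 then q k / q i else q' i / q' k)"
    have "(Y * Y') $$ (i, k) = (\<Sum>j = 0..<n. Y $$ (i, j) * Y' $$ (j, k))"
      using ik Yc by (auto simp: scalar_prod_def)
    also have "\<dots> = (\<Sum>j = 0..<n. X $$ (i, j) * X' $$ (j, k) * c)"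
    proof (intro sum.cong refl)
      fix j assume "j \<in> {0..<n}"
      then have j: "j < n" by auto
      show "Y $$ (i, j) * Y' $$ (j, k) = X $$ (i, j) * X' $$ (j, k) * c"
        using ik j X0[OF ik(1) j] X'0[OF j ik(2)] p[OF j] q[OF ik(1)] q[OF ik(2)]
        by (cases "q i = 0"; cases "p j = 0"; cases "q k = 0") (auto simp: Y_def Y'_def c_def)
    qed
    also have "\<dots> = (X * X') $$ (i, k) * c"
      using ik Xc by (simp add: scalar_prod_def sum_distrib_right)
    also have "\<dots> = 1\<^sub>m n $$ (i, k)"
      using ik q[OF ik(1)] inv_pairD(3)[OF XX] by (auto simp: c_def)
    finally show "(Y * Y') $$ (i, k) = 1\<^sub>m n $$ (i, k)" .
  qed (use Yc in auto)
  then have "inv_pair n Y Y'" using Yc by (intro inv_pairI)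
  moreover have "X * mat_diag n p = mat_diag n q * Y"
    using Xc X0 by (subst mat_diag_mult_left[OF Yc(1)], subst mat_diag_mult_right[OF Xc(1)])
      (auto intro!: eq_matI simp: Y_def)
  moreover have "Y * mat_diag n p' = mat_diag n q' * X"
    using Xc X0 p q by (subst mat_diag_mult_left[OF Xc(1)], subst mat_diag_mult_right[OF Yc(1)])
      (auto intro!: eq_matI simp: Y_def)
  ultimately show ?thesis using XX by (auto simp: intertwine_def)
qed

section \<open>Chains along cosets of the integers\<close>

text \<open>Links at regular weights extend a chain in both directions by dependent choice, so it is
  enough to construct it on a finite segment that contains all singular weights of the
  coset.\<close>

lemma coset_chain:
  fixes S :: "complex \<Rightarrow> 'x \<Rightarrow> 'x \<Rightarrow> bool" and \<psi> :: "nat \<Rightarrow> 'x"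
  assumes up: "\<And>\<mu> X. reg \<mu> \<Longrightarrow> good X \<Longrightarrow> \<exists>Y. good Y \<and> S \<mu> X Y"
    and down: "\<And>\<mu> Y. reg \<mu> \<Longrightarrow> good Y \<Longrightarrow> \<exists>X. good X \<and> S \<mu> X Y"
    and g: "good (\<psi> 0)" "good (\<psi> m)"
    and \<psi>: "\<And>j. j < m \<Longrightarrow> S (\<nu> + of_nat j) (\<psi> j) (\<psi> (Suc j))"
    and reg: "\<And>i :: int. i < 0 \<or> int m \<le> i \<Longrightarrow> reg (\<nu> + of_int i)"
  shows "\<exists>\<chi>. \<forall>i :: int. S (\<nu> + of_int i) (\<chi> i) (\<chi> (i + 1))"
proof -
  have "\<exists>u. \<forall>j. (good (u j) \<and> (j = 0 \<longrightarrow> u j = \<psi> m)) \<and> S (\<nu> + of_nat m + of_nat j) (u j) (u (Suc j))"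
  proof (rule dependent_nat_choice)
    show "\<exists>x. good x \<and> (0 = 0 \<longrightarrow> x = \<psi> m)" using g by auto
    fix x :: 'x and j :: nat assume "good x \<and> (j = 0 \<longrightarrow> x = \<psi> m)"
    moreover have "reg (\<nu> + of_nat m + of_nat j)" using reg[of "int m + int j"] by (simp add: add.assoc)
    ultimately show "\<exists>y. (good y \<and> (Suc j = 0 \<longrightarrow> y = \<psi> m)) \<and> S (\<nu> + of_nat m + of_nat j) x y"
      using up by auto
  qed
  then obtain u where u0: "u 0 = \<psi> m" and u: "\<And>j. S (\<nu> + of_nat m + of_nat j) (u j) (u (Suc j))" by metis
  have "\<exists>d. \<forall>j. (good (d j) \<and> (j = 0 \<longrightarrow> d j = \<psi> 0)) \<and> S (\<nu> - 1 - of_nat j) (d (Suc j)) (d j)"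
  proof (rule dependent_nat_choice)
    show "\<exists>x. good x \<and> (0 = 0 \<longrightarrow> x = \<psi> 0)" using g by auto
    fix x :: 'x and j :: nat assume "good x \<and> (j = 0 \<longrightarrow> x = \<psi> 0)"
    moreover have "reg (\<nu> - 1 - of_nat j)" using reg[of "- 1 - int j"] by (simp add: algebra_simps)
    ultimately show "\<exists>y. (good y \<and> (Suc j = 0 \<longrightarrow> y = \<psi> 0)) \<and> S (\<nu> - 1 - of_nat j) y x"
      using down by auto
  qed
  then obtain d where d0: "d 0 = \<psi> 0" and d: "\<And>j. S (\<nu> - 1 - of_nat j) (d (Suc j)) (d j)" by metis
  \<comment> \<open>\<open>d\<close> runs downwards from \<open>\<psi> 0\<close> and
    \<open>u\<close> upwards from \<open>\<psi> m\<close>; the three pieces agree at the seams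
    because \<open>d 0 = \<psi> 0\<close> and \<open>u 0 = \<psi> m\<close>.\<close>
  define \<chi> where "\<chi> i = (if i < 0 then d (nat (- i)) else if i < int m then \<psi> (nat i) else u (nat (i - int m)))" for i
  have "S (\<nu> + of_int i) (\<chi> i) (\<chi> (i + 1))" for i :: int
  proof -
    consider "i < 0" | "0 \<le> i" "i < int m" | "int m \<le> i" by linarith
    then show ?thesis
    proof cases
      case 1
      define j where "j = nat (- i - 1)"
      have i: "i = - 1 - int j" using 1 by (simp add: j_def)
      have "\<chi> i = d (Suc j)" "\<chi> (i + 1) = d j"
        using d0 u0 by (auto simp: \<chi>_def i nat_add_distrib)
      then show ?thesis using d[of j] by (simp add: i algebra_simps)
    next
      case 2
      define j where "j = nat i"
      have i: "i = int j" and j: "j < m" using 2 by (auto simp: j_def)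
      have "\<chi> i = \<psi> j" "\<chi> (i + 1) = \<psi> (Suc j)"
        using j u0 by (auto simp: \<chi>_def i nat_add_distrib not_less intro!: arg_cong[of _ _ \<psi>])
      then show ?thesis using \<psi>[OF j] by (simp add: i)
    next
      case 3
      define j where "j = nat (i - int m)"
      have i: "i = int m + int j" using 3 by (simp add: j_def)
      have "\<chi> i = u j" "\<chi> (i + 1) = u (Suc j)"
        by (auto simp: \<chi>_def i nat_add_distrib)
      then show ?thesis using u[of j] by (simp add: i add.assoc)
    qed
  qed
  then show ?thesis by blast
qed

text \<open>A link involves only \<mu> and \<mu> + 1, so chains on different cosets are combined by
  a choice of representatives. The integer k lets the chain be based at a convenient point of the
  coset, such as a singular weight.\<close>

lemma glue_cosets:
  fixes S :: "complex \<Rightarrow> 'x \<Rightarrow> 'x \<Rightarrow> bool"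
  assumes "\<And>\<nu>. \<exists>k :: int. \<exists>\<chi>. \<forall>i :: int. S (\<nu> + of_int k + of_int i) (\<chi> i) (\<chi> (i + 1))"
  shows "\<exists>\<phi>. \<forall>\<mu>. S \<mu> (\<phi> \<mu>) (\<phi> (\<mu> + 1))"
proof -
  have "\<exists>\<chi>. \<forall>i :: int. S (\<nu> + of_int i) (\<chi> i) (\<chi> (i + 1))" for \<nu>
  proof -
    obtain k :: int and \<chi> where \<chi>: "\<And>i :: int. S (\<nu> + of_int k + of_int i) (\<chi> i) (\<chi> (i + 1))"
      using assms by blast
    have "S (\<nu> + of_int i) (\<chi> (i - k)) (\<chi> (i + 1 - k))" for i :: int
      using \<chi>[of "i - k"] by (simp add: algebra_simps)
    then show ?thesis by (intro exI[of _ "\<lambda>i. \<chi> (i - k)"]) auto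
  qed
  then obtain \<chi> where \<chi>: "\<And>\<nu> i. S (\<nu> + of_int i) (\<chi> \<nu> i) (\<chi> \<nu> (i + 1))" by metis
  define rep where "rep \<mu> = (SOME \<nu>. \<exists>i :: int. \<mu> = \<nu> + of_int i)" for \<mu> :: complex
  have rep: "\<exists>i :: int. \<mu> = rep \<mu> + of_int i" for \<mu>
    unfolding rep_def by (rule someI[of _ \<mu>]) (auto intro: exI[of _ 0])
  \<comment> \<open>The candidates for the representatives of \<mu> + 1 and of \<mu> form the same
    set, hence \<open>SOME\<close> selects the same element.\<close>
  have rep1: "rep (\<mu> + 1) = rep \<mu>" for \<mu>
  proof -
    have "(\<exists>i :: int. \<mu> + 1 = \<nu> + of_int i) \<longleftrightarrow> (\<exists>i :: int. \<mu> = \<nu> + of_int i)" for \<nu>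
    proof
      assume "\<exists>i :: int. \<mu> + 1 = \<nu> + of_int i"
      then obtain i :: int where "\<mu> + 1 = \<nu> + of_int i" ..
      then show "\<exists>i :: int. \<mu> = \<nu> + of_int i" by (intro exI[of _ "i - 1"]) (simp add: algebra_simps)
    next
      assume "\<exists>i :: int. \<mu> = \<nu> + of_int i"
      then obtain i :: int where "\<mu> = \<nu> + of_int i" ..
      then show "\<exists>i :: int. \<mu> + 1 = \<nu> + of_int i" by (intro exI[of _ "i + 1"]) (simp add: algebra_simps)
    qed
    then show ?thesis by (simp add: rep_def)
  qed
  define off where "off \<mu> = (SOME i :: int. \<mu> = rep \<mu> + of_int i)" for \<mu>
  have off: "\<mu> = rep \<mu> + of_int (off \<mu>)" for \<mu> unfolding off_def using rep[of \<mu>] by (rule someI_ex)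
  have "off (\<mu> + 1) = off \<mu> + 1" for \<mu>
  proof -
    have "rep \<mu> + of_int (off (\<mu> + 1)) = rep \<mu> + of_int (off \<mu> + 1)"
      using off[of "\<mu> + 1"] off[of \<mu>] by (simp add: rep1 add.assoc[symmetric])
    then show ?thesis by (metis add_left_cancel of_int_eq_iff)
  qed
  then have "S \<mu> (\<chi> (rep \<mu>) (off \<mu>)) (\<chi> (rep (\<mu> + 1)) (off (\<mu> + 1)))" for \<mu>
    using \<chi>[of "rep \<mu>" "off \<mu>"] off[of \<mu>] by (simp add: rep1)
  then show ?thesis by (intro exI[of _ "\<lambda>\<mu>. \<chi> (rep \<mu>) (off \<mu>)"]) auto
qed


section \<open>Weight coefficients and linked families of matrices\<close>

text \<open>The coefficient of f from weight \<mu> + 1 to \<mu> on the i-th summand, in the order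
  \<open>F_minus\<close>, \<open>F_zero_plus\<close>, \<open>F_zero_minus\<close>,
  \<open>F_plus\<close>. For d = 0 these are the diagonal entries of P at \<mu>, so one function
  describes source and target.\<close>

definition f_weight :: "nat \<Rightarrow> nat \<Rightarrow> nat \<Rightarrow> complex \<Rightarrow> complex \<Rightarrow> nat \<Rightarrow> complex" where
  "f_weight am a0 d \<alpha> \<mu> i =
     (if i < am - d then 1 else if i < am + a0 then \<mu> - \<alpha> + 1
      else if i < am + a0 + d then \<mu> + \<alpha> else (\<mu> - \<alpha> + 1) * (\<mu> + \<alpha>))"

text \<open>The parameter \<mu> is the starting weight of e, the lower end of the edge, so that e
  and f on one edge share it.\<close>

definition e_weight :: "nat \<Rightarrow> nat \<Rightarrow> nat \<Rightarrow> complex \<Rightarrow> complex \<Rightarrow> nat \<Rightarrow> complex" where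
  "e_weight am a0 d \<alpha> \<mu> i =
     (if i < am - d then - ((\<mu> - \<alpha> + 1) * (\<mu> + \<alpha>)) else if i < am + a0 then - (\<mu> + \<alpha>)
      else if i < am + a0 + d then - (\<mu> - \<alpha> + 1) else - 1)"

lemma f_weight_e_weight: "f_weight am a0 d \<alpha> \<mu> i * e_weight am a0 d \<alpha> \<mu> i = - ((\<mu> - \<alpha> + 1) * (\<mu> + \<alpha>))"
  unfolding f_weight_def e_weight_def by (simp add: algebra_simps)

text \<open>The matrices at different weights are unrelated here; in the theorem they are the values
  of K(h).\<close>

locale weight_chain =
  fixes n am a0 d :: nat and \<alpha> :: complex and K K' :: "complex \<Rightarrow> complex mat"
  assumes K: "inv_pair n (K \<mu>) (K' \<mu>)"
begin

definition good :: "complex mat \<Rightarrow> bool" where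
  "good X \<longleftrightarrow> (\<exists>X'. inv_pair n X X')"

definition link :: "complex \<Rightarrow> complex mat \<Rightarrow> complex mat \<Rightarrow> bool" where
  "link \<mu> X Y \<longleftrightarrow> good X \<and> good Y \<and>
     X * (mat_diag n (f_weight am a0 0 \<alpha> \<mu>) * K \<mu>) = mat_diag n (f_weight am a0 d \<alpha> \<mu>) * Y \<and>
     Y * (K' \<mu> * mat_diag n (e_weight am a0 0 \<alpha> \<mu>)) = mat_diag n (e_weight am a0 d \<alpha> \<mu>) * X"

abbreviation intw :: "complex \<Rightarrow> complex mat \<Rightarrow> complex mat \<Rightarrow> bool" where
  "intw \<mu> \<equiv> intertwine n (f_weight am a0 0 \<alpha> \<mu>) (e_weight am a0 0 \<alpha> \<mu>)
     (f_weight am a0 d \<alpha> \<mu>) (e_weight am a0 d \<alpha> \<mu>)"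

definition reg :: "complex \<Rightarrow> bool" where
  "reg \<mu> \<longleftrightarrow> (\<mu> - \<alpha> + 1) * (\<mu> + \<alpha>) \<noteq> 0"

lemma not_reg_iff: "\<not> reg \<mu> \<longleftrightarrow> \<mu> = \<alpha> - 1 \<or> \<mu> = - \<alpha>"
proof -
  have "\<mu> - \<alpha> + 1 = 0 \<longleftrightarrow> \<mu> = \<alpha> - 1" by (auto simp: algebra_simps)
  then show ?thesis by (simp add: reg_def eq_neg_iff_add_eq_0)
qed

text \<open>\<open>K \<mu>\<close> is a mere change of coordinates at the upper weight: a solution
  of the diagonal problem becomes a link after multiplication by it.\<close>

lemma linkI:
  assumes "intw \<mu> X Y"
  shows "link \<mu> X (Y * K \<mu>)"
proof -
  obtain X' Y' where XY: "inv_pair n X X'" "inv_pair n Y Y'" using assms by (auto simp: intertwine_def)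
  note c = inv_pairD(1)[OF XY(1)] inv_pairD(1)[OF XY(2)] inv_pairD(1,2)[OF K[of \<mu>]]
  let ?p = "mat_diag n (f_weight am a0 0 \<alpha> \<mu>)" and ?q = "mat_diag n (f_weight am a0 d \<alpha> \<mu>)"
  let ?p' = "mat_diag n (e_weight am a0 0 \<alpha> \<mu>)" and ?q' = "mat_diag n (e_weight am a0 d \<alpha> \<mu>)"
  have e: "X * ?p = ?q * Y" "Y * ?p' = ?q' * X" using assms by (auto simp: intertwine_def)
  have "X * (?p * K \<mu>) = X * ?p * K \<mu>" by (rule assoc_mult_mat[of _ n n _ n _ n, symmetric]) (use c in auto)
  also have "\<dots> = ?q * (Y * K \<mu>)" unfolding e by (rule assoc_mult_mat[of _ n n _ n _ n]) (use c in auto)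
  finally have 1: "X * (?p * K \<mu>) = ?q * (Y * K \<mu>)" .
  have "Y * K \<mu> * (K' \<mu> * ?p') = Y * (K \<mu> * (K' \<mu> * ?p'))" by (rule assoc_mult_mat[of _ n n _ n _ n]) (use c in auto)
  also have "K \<mu> * (K' \<mu> * ?p') = K \<mu> * K' \<mu> * ?p'" by (rule assoc_mult_mat[of _ n n _ n _ n, symmetric]) (use c in auto)
  also have "\<dots> = ?p'" using inv_pairD(3)[OF K[of \<mu>]] by (simp add: left_mult_one_mat[of _ n n])
  finally have 2: "Y * K \<mu> * (K' \<mu> * ?p') = ?q' * X" unfolding e .
  show ?thesis using 1 2 XY inv_pair_mult[OF XY(2) K] by (auto simp: link_def good_def)
qed

lemma linkI':
  assumes "intw \<mu> X (Y * K' \<mu>)" "good Y"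
  shows "link \<mu> X Y"
proof -
  obtain Y' where Y: "inv_pair n Y Y'" using assms by (auto simp: good_def)
  have "Y * K' \<mu> * K \<mu> = Y * (K' \<mu> * K \<mu>)"
    by (rule assoc_mult_mat) (use inv_pairD(1)[OF Y] inv_pairD(1,2)[OF K[of \<mu>]] in auto)
  then show ?thesis using linkI[OF assms(1)] inv_pairD(4)[OF K[of \<mu>]] inv_pairD(1)[OF Y] by simp
qed

lemma good_mult: "good X \<Longrightarrow> good Y \<Longrightarrow> good (X * Y)"
  unfolding good_def using inv_pair_mult by metis

lemma good_K: "good (K \<mu>)" "good (K' \<mu>)"
  using K inv_pair_sym[OF K] by (auto simp: good_def)

lemma good_one: "good (1\<^sub>m n)"
  using inv_pair_one by (auto simp: good_def)

lemma link_reg: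
  assumes "reg \<mu>" "good X"
  shows "link \<mu> X (mat_diag n (\<lambda>i. 1 / f_weight am a0 d \<alpha> \<mu> i) * (X * mat_diag n (f_weight am a0 0 \<alpha> \<mu>)) * K \<mu>)"
proof -
  obtain X' where X: "inv_pair n X X'" using assms by (auto simp: good_def)
  show ?thesis
    by (rule linkI, rule intertwine_regular[OF X, where l = "- ((\<mu> - \<alpha> + 1) * (\<mu> + \<alpha>))"])
      (use assms in \<open>auto simp: f_weight_e_weight reg_def\<close>)
qed

lemma link_up:
  assumes "reg \<mu>" "good X"
  shows "\<exists>Y. good Y \<and> link \<mu> X Y"
  using link_reg[OF assms] by (auto simp: link_def)

text \<open>Exchanging e and f is a symmetry of \<open>intertwine\<close>, so the regular step can
  also be run from the upper weight to the lower one.\<close>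

lemma link_down:
  assumes "reg \<mu>" "good Y"
  shows "\<exists>X. good X \<and> link \<mu> X Y"
proof -
  obtain Z' where Z: "inv_pair n (Y * K' \<mu>) Z'"
    using good_mult[OF assms(2) good_K(2)[of \<mu>]] by (auto simp: good_def)
  let ?X = "mat_diag n (\<lambda>i. 1 / e_weight am a0 d \<alpha> \<mu> i) * (Y * K' \<mu> * mat_diag n (e_weight am a0 0 \<alpha> \<mu>))"
  have "intw \<mu> ?X (Y * K' \<mu>)"
    by (rule intertwine_sym, rule intertwine_regular[OF Z, where l = "- ((\<mu> - \<alpha> + 1) * (\<mu> + \<alpha>))"])
      (use assms f_weight_e_weight in \<open>auto simp: reg_def mult.commute\<close>)
  then have "link \<mu> ?X Y" by (rule linkI'[OF _ assms(2)])
  then show ?thesis by (auto simp: link_def)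
qed

text \<open>Two singular weights in one coset would differ by a nonzero integer equal to 2\<alpha> -
  1 up to sign, so a coset contains at most one. There the chain starts with the identity, since
  source and target have equal coefficients for d = 0. This includes the double zero for \<alpha> =
  1/2, where e and f can vanish simultaneously.\<close>

lemma chain_simple:
  assumes d: "d = 0" and \<alpha>: "\<alpha> \<notin> half_ints \<or> \<alpha> = 1 / 2"
  shows "\<exists>\<phi>. \<forall>\<mu>. link \<mu> (\<phi> \<mu>) (\<phi> (\<mu> + 1))"
proof (rule glue_cosets)
  fix \<nu> :: complex
  show "\<exists>k :: int. \<exists>\<chi>. \<forall>i :: int. link (\<nu> + of_int k + of_int i) (\<chi> i) (\<chi> (i + 1))"
  proof (cases "\<forall>i :: int. reg (\<nu> + of_int i)")
    case True
    have "\<exists>\<chi>. \<forall>i :: int. link (\<nu> + of_int 0 + of_int i) (\<chi> i) (\<chi> (i + 1))"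
      by (rule coset_chain[where reg = reg and good = good and \<psi> = "\<lambda>_. 1\<^sub>m n" and m = 0])
        (use True link_up link_down good_one in auto)
    then show ?thesis by blast
  next
    case False
    then obtain k :: int where k: "\<not> reg (\<nu> + of_int k)" by auto
    have reg: "reg (\<nu> + of_int k + of_int i)" if "i \<noteq> 0" for i :: int
    proof (rule ccontr)
      assume "\<not> reg (\<nu> + of_int k + of_int i)"
      then have "\<nu> + of_int k + of_int i = \<alpha> - 1 \<or> \<nu> + of_int k + of_int i = - \<alpha>"
        by (simp only: not_reg_iff)
      moreover have "\<nu> + of_int k = \<alpha> - 1 \<or> \<nu> + of_int k = - \<alpha>"
        using k by (simp only: not_reg_iff)
      moreover have "complex_of_int i = (\<nu> + of_int k + of_int i) - (\<nu> + of_int k)" by simp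
      ultimately have "complex_of_int i = (\<alpha> - 1) - (\<alpha> - 1) \<or> complex_of_int i = - \<alpha> - - \<alpha> \<or>
          complex_of_int i = - \<alpha> - (\<alpha> - 1) \<or> complex_of_int i = \<alpha> - 1 - - \<alpha>"
        by metis
      then have "of_int i = 2 * \<alpha> - 1 \<or> of_int i = 1 - 2 * \<alpha>"
        using that by (elim disjE) (auto simp: algebra_simps)
      then have "\<alpha> = of_int (i + 1) / 2 \<or> \<alpha> = of_int (1 - i) / 2"
        by (auto simp: field_simps)
      moreover from this have "\<alpha> \<noteq> 1 / 2" using that by auto
      ultimately show False using \<alpha> unfolding half_ints_def by blast
    qed
    have "intw \<mu> (1\<^sub>m n) (1\<^sub>m n)" for \<mu> by (rule intertwine_same) (auto simp: d)
    then have "link \<mu> (1\<^sub>m n) (K \<mu>)" for \<mu>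
      using linkI[of \<mu> "1\<^sub>m n" "1\<^sub>m n"] inv_pairD(1)[OF K[of \<mu>]] by simp
    then have "\<exists>\<chi>. \<forall>i :: int. link (\<nu> + of_int k + of_int i) (\<chi> i) (\<chi> (i + 1))"
      by (intro coset_chain[where reg = reg and good = good and m = 1 and
            \<psi> = "\<lambda>j. if j = 0 then 1\<^sub>m n else K (\<nu> + of_int k)"])
        (use reg link_up link_down good_one good_K in auto)
    then show ?thesis by blast
  qed
qed

text \<open>
  Here s is the smaller of the two zeros \<open>\<alpha> - 1\<close> and \<open>- \<alpha>\<close> of \<open>lam \<alpha>\<close>.  The family starts with \<open>U K(s)\<close> at
  weight s + 1 and reaches, up to an invertible diagonal factor, \<open>U T\<close> at the other zero.
\<close>

lemma chain_double:
  assumes s: "{s, s + of_nat (Suc m)} = {\<alpha> - 1, - \<alpha>}"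
    and T: "T = K s * ordered_prod n m (\<lambda>j. mat_diag n (f_weight am a0 0 \<alpha> (s + of_nat j)) * K (s + of_nat j))"
    and U: "carries n {i. e_weight am a0 0 \<alpha> s i \<noteq> 0} {i. e_weight am a0 d \<alpha> s i \<noteq> 0} U U'"
    and UT: "carries n {i. f_weight am a0 0 \<alpha> (s + of_nat (Suc m)) i \<noteq> 0}
       {i. f_weight am a0 d \<alpha> (s + of_nat (Suc m)) i \<noteq> 0} (U * T) V"
  shows "\<exists>\<phi>. \<forall>\<mu>. link \<mu> (\<phi> \<mu>) (\<phi> (\<mu> + 1))"
proof (rule glue_cosets)
  fix \<nu> :: complex
  let ?t = "s + of_nat (Suc m)"
  have sing: "\<not> reg \<mu> \<longleftrightarrow> \<mu> = s \<or> \<mu> = ?t" for \<mu>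
  proof -
    have "\<not> reg \<mu> \<longleftrightarrow> \<mu> \<in> {\<alpha> - 1, - \<alpha>}" by (simp add: not_reg_iff)
    then show ?thesis unfolding s[symmetric] by auto
  qed
  have reg_off: "reg (s + of_int i)" if "i \<noteq> 0" "i \<noteq> int (Suc m)" for i :: int
  proof (rule ccontr)
    assume "\<not> ?thesis"
    then have "(of_int i :: complex) = of_int 0 \<or> (of_int i :: complex) = of_int (int (Suc m))"
      unfolding sing by auto
    then have "i = 0 \<or> i = int (Suc m)" unfolding of_int_eq_iff .
    then show False using that by blast
  qed
  \<comment> \<open>The two linear factors never vanish together at a simple zero, and in every
    block their product is distributed between e and f; so at each index exactly one of the two
    coefficients is zero.\<close>
  have simple: "f_weight am a0 d' \<alpha> \<mu> i = 0 \<longleftrightarrow> e_weight am a0 d' \<alpha> \<mu> i \<noteq> 0" if "\<mu> = s \<or> \<mu> = ?t" for d' \<mu> i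
  proof -
    have "s \<noteq> ?t" by (metis add_cancel_right_right of_nat_eq_0_iff nat.distinct(1))
    then have "\<alpha> - 1 \<noteq> - \<alpha>" using s by (metis doubleton_eq_iff)
    then have ne: "2 * \<alpha> - 1 \<noteq> 0" by (auto simp: algebra_simps)
    define a where "a = \<mu> - \<alpha> + 1"
    define b where "b = \<mu> + \<alpha>"
    have "\<mu> = \<alpha> - 1 \<or> \<mu> = - \<alpha>" using that s by auto
    then have "a = 0 \<and> b = 2 * \<alpha> - 1 \<or> a = - (2 * \<alpha> - 1) \<and> b = 0" by (auto simp: a_def b_def)
    then have "a = 0 \<longleftrightarrow> b \<noteq> 0" using ne by auto
    then show ?thesis unfolding f_weight_def e_weight_def a_def[symmetric] b_def[symmetric] by auto
  qed
  show "\<exists>k :: int. \<exists>\<chi>. \<forall>i :: int. link (\<nu> + of_int k + of_int i) (\<chi> i) (\<chi> (i + 1))"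
  proof (cases "\<forall>i :: int. reg (\<nu> + of_int i)")
    case True
    have "\<exists>\<chi>. \<forall>i :: int. link (\<nu> + of_int 0 + of_int i) (\<chi> i) (\<chi> (i + 1))"
      by (rule coset_chain[where reg = reg and good = good and \<psi> = "\<lambda>_. 1\<^sub>m n" and m = 0])
        (use True link_up link_down good_one in auto)
    then show ?thesis by blast
  next
    case False
    then obtain k' :: int where "\<not> reg (\<nu> + of_int k')" by auto
    \<comment> \<open>If the singular weight found is the upper one, the base point moves down by m
      + 1 to s.\<close>
    then have "\<nu> + of_int k' = s \<or> \<nu> + of_int (k' - int (Suc m)) = s"
      unfolding sing by (auto simp: algebra_simps)
    then obtain k :: int where k: "\<nu> + of_int k = s" by blast
    define P where "P j = mat_diag n (f_weight am a0 0 \<alpha> (s + of_nat j)) * K (s + of_nat j)" for j :: nat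
    \<comment> \<open>Each regular step multiplies by the inverse of f of the target on the left and
      by the source factor P on the right. The former are collected in D, the latter build up the
      product in T.\<close>
    define D where "D j = mat_diag n (\<lambda>i. \<Prod>t\<in>{1..j}. 1 / f_weight am a0 d \<alpha> (s + of_nat t) i)" for j :: nat
    define W where "W j = D j * (U * (K s * ordered_prod n j P))" for j
    have Pc: "P j \<in> carrier_mat n n" for j unfolding P_def by (rule mult_carrier_mat[OF _ inv_pairD(1)[OF K]]) simp
    \<comment> \<open>A step of the chain appends a factor at the right end, whereas the fold in
      \<open>ordered_prod\<close> unwinds from the left.\<close>
    have OS: "ordered_prod n (Suc j) P = ordered_prod n j P * P (Suc j)" and Oc: "ordered_prod n j P \<in> carrier_mat n n" for j
    proof -
      have c: "foldr (*) (map P xs) A \<in> carrier_mat n n" if "A \<in> carrier_mat n n" for xs A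
        using that by (induction xs) (auto intro!: mult_carrier_mat[OF Pc])
      show "ordered_prod n j P \<in> carrier_mat n n" unfolding ordered_prod_def by (rule c) simp
      have "foldr (*) (map P xs) A = foldr (*) (map P xs) (1\<^sub>m n) * A" if A: "A \<in> carrier_mat n n" for xs A
      proof (induction xs)
        case (Cons x xs)
        have "P x * (foldr (*) (map P xs) (1\<^sub>m n) * A) = P x * foldr (*) (map P xs) (1\<^sub>m n) * A"
          by (rule assoc_mult_mat[of _ n n _ n _ n, symmetric]) (auto intro!: c Pc A)
        then show ?case using Cons by simp
      qed (use A in simp)
      from this[of "P (Suc j)" "[1..<Suc j]"]
      show "ordered_prod n (Suc j) P = ordered_prod n j P * P (Suc j)"
        using Pc by (simp add: ordered_prod_def right_mult_one_mat[of _ n n])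
    qed
    have inv: "inv_pair n U U'" "inv_pair n (U * T) V" using U UT by (auto simp: carries_def)
    note Uc = inv_pairD(1)[OF inv(1)]
    note Kc = inv_pairD(1)[OF K]
    have Wm: "W m = D m * (U * T)" unfolding W_def T P_def ..
    have "D 0 = 1\<^sub>m n" by (simp add: D_def)
    then have W0: "W 0 = U * K s"
      using Uc Kc by (simp add: W_def ordered_prod_def left_mult_one_mat[of _ n n] right_mult_one_mat[of _ n n])
    have f_nz: "f_weight am a0 d \<alpha> (s + of_nat t) i \<noteq> 0" if "1 \<le> t" "t \<le> m" for t i
    proof -
      have "reg (s + of_nat t)" using reg_off[of "int t"] that by simp
      then show ?thesis using f_weight_e_weight[of am a0 d \<alpha> "s + of_nat t" i] by (auto simp: reg_def)
    qed
    have links: "link (s + of_nat (Suc j)) (W j) (W (Suc j))" if "good (W j)" "Suc j \<le> m" for j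
    proof -
      let ?\<mu> = "s + of_nat (Suc j)"
      have r: "reg ?\<mu>" using reg_off[of "int (Suc j)"] that by simp
      let ?E = "mat_diag n (\<lambda>i. 1 / f_weight am a0 d \<alpha> ?\<mu> i)"
      let ?F = "mat_diag n (f_weight am a0 0 \<alpha> ?\<mu>)"
      let ?R = "U * (K s * ordered_prod n j P)"
      have Rc: "?R \<in> carrier_mat n n" by (intro mult_carrier_mat[of _ n n _ n] Uc Kc Oc)
      have Dc: "D i \<in> carrier_mat n n" for i by (simp add: D_def)
      have DS: "D (Suc j) = ?E * D j" by (simp add: D_def mult.commute)
      have 1: "?E * (W j * ?F) = ?E * (W j) * ?F"
        by (rule assoc_mult_mat[of _ n n _ n _ n, symmetric]) (auto simp: W_def intro!: mult_carrier_mat[of _ n n _ n] Rc Dc)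
      have 2: "?E * W j = D (Suc j) * ?R"
        unfolding W_def DS by (rule assoc_mult_mat[of _ n n _ n _ n, symmetric]) (auto intro!: mult_carrier_mat[of _ n n _ n] Rc Dc)
      have "?E * (W j * ?F) * K ?\<mu> = D (Suc j) * ?R * (?F * K ?\<mu>)"
        unfolding 1 2 by (rule assoc_mult_mat[of _ n n _ n _ n]) (auto intro!: mult_carrier_mat[of _ n n _ n] Rc Dc Kc)
      also have "\<dots> = D (Suc j) * (?R * P (Suc j))"
        unfolding P_def[of "Suc j", symmetric]
        by (rule assoc_mult_mat[of _ n n _ n _ n]) (auto intro!: Rc Dc Pc)
      also have "?R * P (Suc j) = U * (K s * ordered_prod n j P * P (Suc j))"
        by (rule assoc_mult_mat[of _ n n _ n _ n]) (auto intro!: mult_carrier_mat[of _ n n _ n] Uc Kc Oc Pc)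
      also have "K s * ordered_prod n j P * P (Suc j) = K s * ordered_prod n (Suc j) P"
        unfolding OS by (rule assoc_mult_mat[of _ n n _ n _ n]) (auto intro!: mult_carrier_mat[of _ n n _ n] Uc Kc Oc Pc)
      finally show ?thesis using link_reg[OF r that(1)] by (simp add: W_def)
    qed
    have goodW: "good (W j)" if "j \<le> m" for j
      using that
    proof (induction j)
      case 0
      then show ?case unfolding W0 using inv(1) good_K by (intro good_mult) (auto simp: good_def)
    next
      case (Suc j)
      then show ?case using links[of j] by (auto simp: link_def)
    qed
    \<comment> \<open>From weight s + 1 the chain is continued downwards: with e and f exchanged, U
      is the given matrix and X at weight s is the one to be found.\<close>
    have "\<exists>X. intertwine n (e_weight am a0 0 \<alpha> s) (f_weight am a0 0 \<alpha> s)
        (e_weight am a0 d \<alpha> s) (f_weight am a0 d \<alpha> s) U X"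
      by (rule intertwine_singular[OF U]) (use simple[of s] in auto)
    then obtain X where "intw s X U" using intertwine_sym by blast
    from linkI[OF this] have X: "link s X (W 0)" unfolding W0 .
    \<comment> \<open>The factor \<open>D m\<close> is diagonal and invertible, so it preserves
      every coordinate subspace and the condition on \<open>U * T\<close> passes to
      \<open>W m\<close>.\<close>
    have "carries n {i. f_weight am a0 d \<alpha> ?t i \<noteq> 0} {i. f_weight am a0 d \<alpha> ?t i \<noteq> 0} (D m)
        (mat_diag n (\<lambda>i. 1 / (\<Prod>t\<in>{1..m}. 1 / f_weight am a0 d \<alpha> (s + of_nat t) i)))"
      unfolding D_def by (rule mat_diag_carries) (use f_nz in auto)
    from carries_mult[OF UT this] have "\<exists>Y. intw ?t (W m) Y"
      unfolding Wm by (rule intertwine_singular) (use simple[of ?t] in auto)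
    then obtain Y where "intw ?t (W m) Y" by blast
    then have Y: "link ?t (W m) (Y * K ?t)" by (rule linkI)
    \<comment> \<open>Position j stands for weight s + j; the segment of length m + 2 contains both
      singular edges, those starting at s and at s + m + 1.\<close>
    define \<psi> where "\<psi> j = (if j = 0 then X else if j \<le> Suc m then W (j - 1) else Y * K ?t)" for j :: nat
    have "\<exists>\<chi>. \<forall>i :: int. link (s + of_int i) (\<chi> i) (\<chi> (i + 1))"
    proof (rule coset_chain[where reg = reg and good = good and \<psi> = \<psi> and m = "Suc (Suc m)"])
      show "good (\<psi> 0)" "good (\<psi> (Suc (Suc m)))" using X Y by (auto simp: \<psi>_def link_def)
      show "reg (s + of_int i)" if "i < 0 \<or> int (Suc (Suc m)) \<le> i" for i :: int
        using reg_off[of i] that by auto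
      show "link (s + of_nat j) (\<psi> j) (\<psi> (Suc j))" if "j < Suc (Suc m)" for j
      proof -
        consider "j = 0" | i where "j = Suc i" "Suc i \<le> m" | "j = Suc m" using \<open>j < Suc (Suc m)\<close>
          by (cases j) (auto simp: less_Suc_eq Suc_le_eq)
        then show ?thesis
        proof cases
          case 1
          then show ?thesis using X by (simp add: \<psi>_def)
        next
          case 2
          then show ?thesis using links[of i] goodW[of i] by (simp add: \<psi>_def)
        next
          case 3
          then show ?thesis using Y by (simp add: \<psi>_def)
        qed
      qed
    qed (use link_up link_down in auto)
    then show ?thesis using k by blast
  qed
qed

end

subsection \<open>The weighting in coordinates\<close>

text \<open>Transport along a map into M suits the weighting, since a coset is easily written down
  from its coordinates. Closure of M under the operations follows from the surjectivity of
  \<theta>.\<close>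

lemma sl2_iso_transport_surj:
  fixes M :: "'v sl2_rep" and N :: "'w sl2_rep"
  assumes N: "sl2_laws N"
    and bij: "bij_betw \<theta> (carrier N) (carrier M)"
    and zero: "\<theta> \<zero>\<^bsub>N\<^esub> = \<zero>\<^bsub>M\<^esub>"
    and add: "\<And>x y. x \<in> carrier N \<Longrightarrow> y \<in> carrier N \<Longrightarrow> \<theta> (x \<oplus>\<^bsub>N\<^esub> y) = \<theta> x \<oplus>\<^bsub>M\<^esub> \<theta> y"
    and smult: "\<And>c x. x \<in> carrier N \<Longrightarrow> \<theta> (c \<odot>\<^bsub>N\<^esub> x) = c \<odot>\<^bsub>M\<^esub> \<theta> x"
    and e: "\<And>x. x \<in> carrier N \<Longrightarrow> \<theta> (act_e N x) = act_e M (\<theta> x)"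
    and f: "\<And>x. x \<in> carrier N \<Longrightarrow> \<theta> (act_f N x) = act_f M (\<theta> x)"
    and h: "\<And>x. x \<in> carrier N \<Longrightarrow> \<theta> (act_h N x) = act_h M (\<theta> x)"
  shows "M \<simeq>\<^sub>s N"
proof -
  define \<rho> where "\<rho> = inv_into (carrier N) \<theta>"
  have \<rho>: "bij_betw \<rho> (carrier M) (carrier N)" unfolding \<rho>_def by (rule bij_betw_inv_into[OF bij])
  have \<rho>N: "\<rho> x \<in> carrier N" and \<theta>\<rho>: "\<theta> (\<rho> x) = x" if "x \<in> carrier M" for x
    using that bij_betwE[OF \<rho>] bij_betw_inv_into_right[OF bij] by (auto simp: \<rho>_def)
  have \<theta>M: "\<theta> y \<in> carrier M" and \<rho>\<theta>: "\<rho> (\<theta> y) = y" if "y \<in> carrier N" for y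
    using that bij_betwE[OF bij] bij_betw_inv_into_left[OF bij] by (auto simp: \<rho>_def)
  note cl = N[unfolded sl2_laws_def]
  show ?thesis
  proof (rule sl2_iso_transport[OF N \<rho>])
    show "\<zero>\<^bsub>M\<^esub> \<in> carrier M" "\<rho> \<zero>\<^bsub>M\<^esub> = \<zero>\<^bsub>N\<^esub>"
      unfolding zero[symmetric] using cl \<theta>M \<rho>\<theta> by auto
    show "x \<oplus>\<^bsub>M\<^esub> y \<in> carrier M \<and> \<rho> (x \<oplus>\<^bsub>M\<^esub> y) = \<rho> x \<oplus>\<^bsub>N\<^esub> \<rho> y" if "x \<in> carrier M" "y \<in> carrier M" for x y
      using add[OF \<rho>N[OF that(1)] \<rho>N[OF that(2)]] \<theta>M[of "\<rho> x \<oplus>\<^bsub>N\<^esub> \<rho> y"] \<rho>\<theta>[of "\<rho> x \<oplus>\<^bsub>N\<^esub> \<rho> y"] \<theta>\<rho> \<rho>N that cl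
      by auto
    show "c \<odot>\<^bsub>M\<^esub> x \<in> carrier M \<and> \<rho> (c \<odot>\<^bsub>M\<^esub> x) = c \<odot>\<^bsub>N\<^esub> \<rho> x" if "x \<in> carrier M" for c x
      using smult[OF \<rho>N[OF that], of c] \<theta>M[of "c \<odot>\<^bsub>N\<^esub> \<rho> x"] \<rho>\<theta>[of "c \<odot>\<^bsub>N\<^esub> \<rho> x"] \<theta>\<rho> \<rho>N that cl
      by auto
    show "act_e M x \<in> carrier M \<and> \<rho> (act_e M x) = act_e N (\<rho> x)" if "x \<in> carrier M" for x
      using e[OF \<rho>N[OF that]] \<theta>M[of "act_e N (\<rho> x)"] \<rho>\<theta>[of "act_e N (\<rho> x)"] \<theta>\<rho> \<rho>N that cl by auto
    show "act_f M x \<in> carrier M \<and> \<rho> (act_f M x) = act_f N (\<rho> x)" if "x \<in> carrier M" for x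
      using f[OF \<rho>N[OF that]] \<theta>M[of "act_f N (\<rho> x)"] \<rho>\<theta>[of "act_f N (\<rho> x)"] \<theta>\<rho> \<rho>N that cl by auto
    show "act_h M x \<in> carrier M \<and> \<rho> (act_h M x) = act_h N (\<rho> x)" if "x \<in> carrier M" for x
      using h[OF \<rho>N[OF that]] \<theta>M[of "act_h N (\<rho> x)"] \<rho>\<theta>[of "act_h N (\<rho> x)"] \<theta>\<rho> \<rho>N that cl by auto
  qed
qed

section \<open>Cosets modulo (h - \<nu>)M as fibres of evaluation\<close>

definition ev :: "complex \<Rightarrow> complex poly vec \<Rightarrow> complex vec" where
  "ev \<nu> g = map_vec (\<lambda>p. poly p \<nu>) g"

definition fibre :: "nat \<Rightarrow> complex \<Rightarrow> complex vec \<Rightarrow> complex poly vec set" where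
  "fibre n \<nu> c = {g \<in> carrier_vec n. ev \<nu> g = c}"

lemma const_in_fibre: "c \<in> carrier_vec n \<Longrightarrow> vec n (\<lambda>i. [:c $ i:]) \<in> fibre n \<nu> c"
  by (auto simp: fibre_def ev_def)

text \<open>A vector of constants lies in the fibre, which is therefore nonempty and remembers its
  value.\<close>

lemma fibre_inj:
  assumes "fibre n \<nu> c = fibre n \<nu> d" "c \<in> carrier_vec n"
  shows "c = d"
proof -
  have "vec n (\<lambda>i. [:c $ i:]) \<in> fibre n \<nu> c" by (rule const_in_fibre[OF assms(2)])
  moreover from this have "vec n (\<lambda>i. [:c $ i:]) \<in> fibre n \<nu> d" unfolding assms(1) .
  ultimately show ?thesis unfolding fibre_def by simp
qed

lemma ev_carrier [simp]: "g \<in> carrier_vec n \<Longrightarrow> ev \<nu> g \<in> carrier_vec n"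
  by (simp add: ev_def)

lemma ev_add: "g \<in> carrier_vec n \<Longrightarrow> g' \<in> carrier_vec n \<Longrightarrow> ev \<nu> (g + g') = ev \<nu> g + ev \<nu> g'"
  by (intro eq_vecI) (auto simp: ev_def)

lemma ev_smult: "ev \<nu> (p \<cdot>\<^sub>v g) = poly p \<nu> \<cdot>\<^sub>v ev \<nu> g"
  by (intro eq_vecI) (auto simp: ev_def)

lemma ev_mult_mat_vec:
  assumes "A \<in> carrier_mat m n" "g \<in> carrier_vec n"
  shows "ev \<nu> (A *\<^sub>v g) = eval_mat A \<nu> *\<^sub>v ev \<nu> g"
  using assms by (intro eq_vecI) (auto simp: ev_def eval_mat_def scalar_prod_def poly_sum)

lemma ev_shift: "ev \<mu> (map_vec shift g) = ev (\<mu> - 1) g"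
  by (intro eq_vecI) (auto simp: ev_def shift_def poly_pcompose)

lemma ev_unshift: "ev \<mu> (map_vec unshift g) = ev (\<mu> + 1) g"
  by (intro eq_vecI) (auto simp: ev_def unshift_def poly_pcompose add.commute)

lemma M_EF_abelian_group: "abelian_group (M_EF n E F)"
proof (rule abelian_groupI)
  fix x assume "x \<in> carrier (M_EF n E F)"
  then show "\<exists>y\<in>carrier (M_EF n E F). y \<oplus>\<^bsub>M_EF n E F\<^esub> x = \<zero>\<^bsub>M_EF n E F\<^esub>"
    by (intro bexI[of _ "- x"]) (auto simp: M_EF_def)
qed (auto simp: M_EF_def comm_add_vec assoc_add_vec[of _ n])

text \<open>A polynomial that vanishes at \<nu> is divisible by h - \<nu>, so (h - \<nu>)M is the
  kernel of evaluation at \<nu>.\<close>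

lemma h_image_M_EF: "h_image (M_EF n E F) \<nu> = fibre n \<nu> (0\<^sub>v n)"
proof -
  let ?M = "M_EF n E F"
  interpret abelian_group ?M by (rule M_EF_abelian_group)
  have minus: "x \<ominus>\<^bsub>?M\<^esub> y = x - y" if "x \<in> carrier_vec n" "y \<in> carrier_vec n" for x y
  proof -
    have "\<ominus>\<^bsub>?M\<^esub> y = - y"
      by (rule minus_equality) (use that in \<open>auto simp: M_EF_def\<close>)
    then show ?thesis using that by (auto simp: a_minus_def M_EF_def)
  qed
  have "h_image ?M \<nu> = (\<lambda>g. [:0, 1:] \<cdot>\<^sub>v g - [:\<nu>:] \<cdot>\<^sub>v g) ` carrier_vec n"
    unfolding h_image_def by (rule image_cong) (auto simp: M_EF_def minus[unfolded M_EF_def, simplified])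
  also have "\<dots> = fibre n \<nu> (0\<^sub>v n)"
  proof (intro equalityI subsetI)
    fix w assume "w \<in> fibre n \<nu> (0\<^sub>v n)"
    then have w: "w \<in> carrier_vec n" and ev0: "ev \<nu> w = 0\<^sub>v n" by (auto simp: fibre_def)
    then have root: "poly (w $ i) \<nu> = 0" if "i < n" for i
    proof -
      have "ev \<nu> w $ i = 0" using that by (simp add: ev0)
      then show ?thesis using w that by (simp add: ev_def)
    qed
    define g where "g = vec n (\<lambda>i. w $ i div [:- \<nu>, 1:])"
    have "w = [:0, 1:] \<cdot>\<^sub>v g - [:\<nu>:] \<cdot>\<^sub>v g"
    proof (rule eq_vecI)
      fix i assume "i < dim_vec ([:0, 1:] \<cdot>\<^sub>v g - [:\<nu>:] \<cdot>\<^sub>v g)"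
      then have i: "i < n" by (simp add: g_def)
      have "w $ i = [:- \<nu>, 1:] * (w $ i div [:- \<nu>, 1:])"
        using root[OF i] unfolding poly_eq_0_iff_dvd by (rule dvd_mult_div_cancel[symmetric])
      also have "\<dots> = [:0, 1:] * (w $ i div [:- \<nu>, 1:]) - [:\<nu>:] * (w $ i div [:- \<nu>, 1:])"
        by (simp add: left_diff_distrib[symmetric])
      finally show "w $ i = ([:0, 1:] \<cdot>\<^sub>v g - [:\<nu>:] \<cdot>\<^sub>v g) $ i" using i by (simp add: g_def)
    qed (use w in \<open>simp add: g_def\<close>)
    then show "w \<in> (\<lambda>g. [:0, 1:] \<cdot>\<^sub>v g - [:\<nu>:] \<cdot>\<^sub>v g) ` carrier_vec n"
      by (intro image_eqI[of _ _ g]) (auto simp: g_def)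
  next
    fix w assume "w \<in> (\<lambda>g. [:0, 1:] \<cdot>\<^sub>v g - [:\<nu>:] \<cdot>\<^sub>v g) ` carrier_vec n"
    then show "w \<in> fibre n \<nu> (0\<^sub>v n)"
      by (auto simp: fibre_def ev_def intro!: eq_vecI)
  qed
  finally show ?thesis .
qed

lemma r_coset_fibre:
  assumes v: "v \<in> carrier_vec n"
  shows "fibre n \<nu> (0\<^sub>v n) +>\<^bsub>M_EF n E F\<^esub> v = fibre n \<nu> (ev \<nu> v)"
proof -
  have "fibre n \<nu> (0\<^sub>v n) +>\<^bsub>M_EF n E F\<^esub> v = (\<lambda>g. g + v) ` fibre n \<nu> (0\<^sub>v n)"
    by (auto simp: a_r_coset_def' M_EF_def)
  also have "\<dots> = fibre n \<nu> (ev \<nu> v)"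
  proof (intro equalityI subsetI)
    fix w assume "w \<in> fibre n \<nu> (ev \<nu> v)"
    then have w: "w \<in> carrier_vec n" "ev \<nu> w = ev \<nu> v" by (auto simp: fibre_def)
    have "ev \<nu> (w - v) = 0\<^sub>v n"
    proof (rule eq_vecI)
      fix i assume "i < dim_vec (0\<^sub>v n :: complex vec)"
      then show "ev \<nu> (w - v) $ i = 0\<^sub>v n $ i"
        using arg_cong[OF w(2), of "\<lambda>u. u $ i"] w(1) v by (simp add: ev_def)
    qed (use v w in \<open>simp add: ev_def\<close>)
    then show "w \<in> (\<lambda>g. g + v) ` fibre n \<nu> (0\<^sub>v n)"
      using w v by (intro image_eqI[of _ _ "w - v"]) (auto simp: fibre_def)
  qed (use v in \<open>auto simp: fibre_def ev_add\<close>)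
  finally show ?thesis .
qed

lemma fibre_add:
  assumes "c \<in> carrier_vec n" "d \<in> carrier_vec n"
  shows "fibre n \<nu> c <+>\<^bsub>M_EF n E F\<^esub> fibre n \<nu> d = fibre n \<nu> (c + d)"
proof -
  have "fibre n \<nu> c <+>\<^bsub>M_EF n E F\<^esub> fibre n \<nu> d = {x + y | x y. x \<in> fibre n \<nu> c \<and> y \<in> fibre n \<nu> d}"
    by (auto simp: set_add_def' M_EF_def)
  also have "\<dots> = fibre n \<nu> (c + d)"
  proof (intro equalityI subsetI)
    fix w assume "w \<in> fibre n \<nu> (c + d)"
    then have w: "w \<in> carrier_vec n" "ev \<nu> w = c + d" by (auto simp: fibre_def)
    define x where "x = vec n (\<lambda>i. [:c $ i:])"
    have x: "x \<in> carrier_vec n" "ev \<nu> x = c" using const_in_fibre[OF assms(1), of \<nu>] by (auto simp: x_def fibre_def)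
    have "ev \<nu> (w - x) = d"
    proof (rule eq_vecI)
      fix i assume "i < dim_vec d"
      then show "ev \<nu> (w - x) $ i = d $ i"
        using arg_cong[OF w(2), of "\<lambda>u. u $ i"] arg_cong[OF x(2), of "\<lambda>u. u $ i"] w(1) x(1) assms
        by (simp add: ev_def)
    qed (use w x assms in \<open>simp add: ev_def\<close>)
    moreover have "w = x + (w - x)" using w x by auto
    ultimately show "w \<in> {x + y | x y. x \<in> fibre n \<nu> c \<and> y \<in> fibre n \<nu> d}"
      unfolding fibre_def using w(1) x by (intro CollectI exI[of _ x] exI[of _ "w - x"]) auto
  qed (auto simp: fibre_def ev_add)
  finally show ?thesis .
qed

text \<open>The value of \<open>G v\<close> at \<mu> is the same for all representatives, so all
  members of the union coincide; the vector of constants shows that there is at least one.\<close>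

lemma Union_r_coset_fibre:
  assumes "c \<in> carrier_vec n"
    and "\<And>v. v \<in> fibre n \<nu> c \<Longrightarrow> G v \<in> carrier_vec n \<and> ev \<mu> (G v) = d"
  shows "(\<Union>v\<in>fibre n \<nu> c. fibre n \<mu> (0\<^sub>v n) +>\<^bsub>M_EF n E F\<^esub> G v) = fibre n \<mu> d"
proof -
  have "fibre n \<mu> (0\<^sub>v n) +>\<^bsub>M_EF n E F\<^esub> G v = fibre n \<mu> d" if "v \<in> fibre n \<nu> c" for v
    using r_coset_fibre[of "G v" n E F \<mu>] assms(2)[OF that] by simp
  then show ?thesis using const_in_fibre[OF assms(1), of \<nu>] by blast
qed

lemma a_rcosets_fibre:
  "a_rcosets\<^bsub>M_EF n E F\<^esub> (fibre n \<nu> (0\<^sub>v n)) = fibre n \<nu> ` carrier_vec n"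
proof -
  have "a_rcosets\<^bsub>M_EF n E F\<^esub> (fibre n \<nu> (0\<^sub>v n)) = (\<lambda>v. fibre n \<nu> (ev \<nu> v)) ` carrier_vec n"
    using r_coset_fibre[of _ n E F \<nu>] by (auto simp: A_RCOSETS_def' M_EF_def)
  also have "\<dots> = fibre n \<nu> ` carrier_vec n"
  proof (intro equalityI subsetI)
    fix S assume "S \<in> fibre n \<nu> ` carrier_vec n"
    then obtain c where c: "c \<in> carrier_vec n" "S = fibre n \<nu> c" by auto
    then show "S \<in> (\<lambda>v. fibre n \<nu> (ev \<nu> v)) ` carrier_vec n"
      using const_in_fibre[OF c(1), of \<nu>] by (intro image_eqI[of _ _ "vec n (\<lambda>i. [:c $ i:])"]) (auto simp: fibre_def)
  qed auto
  finally show ?thesis .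
qed

text \<open>Since E \<sigma>(g) at \<mu> + 1 uses the value of g at \<mu>, evaluation turns e into
  E(\<mu> + 1) from weight \<mu> to \<mu> + 1; likewise f becomes F(\<mu>) from weight \<mu> + 1 to
  \<mu>. The bijection runs against \<phi>: coordinates x at weight \<nu> go to the coset of vectors
  with value \<open>\<phi>' \<nu>\<close> x.\<close>

lemma weighting_iso_direct_sum:
  assumes E: "E \<in> carrier_mat n n" and F: "F \<in> carrier_mat n n"
    and len: "length Ms = n"
    and Ms: "\<And>i. i < n \<Longrightarrow> Ms ! i = degree1_family (\<lambda>\<nu>. b \<nu> i) (\<lambda>\<nu>. a (\<nu> - 1) i)"
    and laws: "\<And>N. N \<in> set Ms \<Longrightarrow> sl2_laws N"
    and \<phi>: "\<And>\<mu>. inv_pair n (\<phi> \<mu>) (\<phi>' \<mu>)"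
    and \<phi>F: "\<And>\<mu>. \<phi> \<mu> * eval_mat F \<mu> = mat_diag n (a \<mu>) * \<phi> (\<mu> + 1)"
    and \<phi>E: "\<And>\<mu>. \<phi> (\<mu> + 1) * eval_mat E (\<mu> + 1) = mat_diag n (b \<mu>) * \<phi> \<mu>"
  shows "weighting (M_EF n E F) \<simeq>\<^sub>s sl2_direct_sum Ms"
proof -
  let ?M = "M_EF n E F" and ?N = "sl2_direct_sum Ms"
  note \<phi>c = inv_pairD(1,2)[OF \<phi>]
  have Ec: "eval_mat E \<mu> \<in> carrier_mat n n" and Fc: "eval_mat F \<mu> \<in> carrier_mat n n" for \<mu>
    using E F by (auto simp: eval_mat_def)
  \<comment> \<open>The intertwining relations are rewritten for the inverse matrices, which define
    \<theta>.\<close>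
  have F': "eval_mat F \<mu> * \<phi>' (\<mu> + 1) = \<phi>' \<mu> * mat_diag n (a \<mu>)" for \<mu>
  proof -
    have "eval_mat F \<mu> = \<phi>' \<mu> * (mat_diag n (a \<mu>) * \<phi> (\<mu> + 1))"
      by (rule inv_pair_cancel_left[OF \<phi> Fc \<phi>F])
    also have "\<dots> = \<phi>' \<mu> * mat_diag n (a \<mu>) * \<phi> (\<mu> + 1)"
      by (rule assoc_mult_mat[of _ n n _ n _ n, symmetric]) (auto intro: \<phi>c)
    finally have "\<phi>' \<mu> * mat_diag n (a \<mu>) * \<phi> (\<mu> + 1) = eval_mat F \<mu>" ..
    then show ?thesis
      by (intro inv_pair_cancel_right[OF \<phi>, symmetric] mult_carrier_mat[of _ n n _ n] \<phi>c) simp_all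
  qed
  have E': "eval_mat E (\<mu> + 1) * \<phi>' \<mu> = \<phi>' (\<mu> + 1) * mat_diag n (b \<mu>)" for \<mu>
  proof -
    have "eval_mat E (\<mu> + 1) = \<phi>' (\<mu> + 1) * (mat_diag n (b \<mu>) * \<phi> \<mu>)"
      by (rule inv_pair_cancel_left[OF \<phi> Ec \<phi>E])
    also have "\<dots> = \<phi>' (\<mu> + 1) * mat_diag n (b \<mu>) * \<phi> \<mu>"
      by (rule assoc_mult_mat[of _ n n _ n _ n, symmetric]) (auto intro: \<phi>c)
    finally have "\<phi>' (\<mu> + 1) * mat_diag n (b \<mu>) * \<phi> \<mu> = eval_mat E (\<mu> + 1)" ..
    then show ?thesis
      by (intro inv_pair_cancel_right[OF \<phi>, symmetric] mult_carrier_mat[of _ n n _ n] \<phi>c) simp_all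
  qed
  define col where "col x \<nu> = vec n (\<lambda>i. x i \<nu>)" for x :: "nat \<Rightarrow> complex \<Rightarrow> complex" and \<nu>
  have colc: "col x \<nu> \<in> carrier_vec n" for x \<nu> by (simp add: col_def)
  define cc where "cc x \<nu> = \<phi>' \<nu> *\<^sub>v col x \<nu>" for x \<nu>
  have ccc: "cc x \<nu> \<in> carrier_vec n" for x \<nu> unfolding cc_def by (rule mult_mat_vec_carrier[OF \<phi>c(2) colc])
  define \<theta> where "\<theta> x \<nu> = fibre n \<nu> (cc x \<nu>)" for x \<nu>
  have Ncar: "carrier ?N = (\<Pi>\<^sub>E i\<in>{..<n}. {x. finite {\<nu>. x \<nu> \<noteq> 0}})"
    unfolding sl2_direct_sum_def using len by (auto simp: Ms degree1_family_def intro!: PiE_cong)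
  have Wcar: "carrier (weighting ?M) = {\<Phi>. (\<forall>\<nu>. \<Phi> \<nu> \<in> fibre n \<nu> ` carrier_vec n) \<and> finite {\<nu>. \<Phi> \<nu> \<noteq> fibre n \<nu> (0\<^sub>v n)}}"
    by (simp add: weighting_def h_image_M_EF a_rcosets_fibre)
  have diag: "mat_diag n g *\<^sub>v v = vec n (\<lambda>i. g i * v $ i)" if "v \<in> carrier_vec n" for g and v :: "complex vec"
  proof (rule eq_vecI)
    fix i assume "i < dim_vec (vec n (\<lambda>i. g i * v $ i))"
    then have i: "i < n" by simp
    have "(mat_diag n g *\<^sub>v v) $ i = (\<Sum>j = 0..<n. (if i = j then g j else 0) * v $ j)"
      using i that by (simp add: mat_diag_def scalar_prod_def)
    also have "\<dots> = (\<Sum>j = 0..<n. if j = i then g i * v $ i else 0)" by (intro sum.cong) auto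
    finally show "(mat_diag n g *\<^sub>v v) $ i = vec n (\<lambda>i. g i * v $ i) $ i" using i by simp
  qed (simp add: mat_diag_def)
  have bij: "bij_betw \<theta> (carrier ?N) (carrier (weighting ?M))"
  proof (rule bij_betw_imageI)
    show "inj_on \<theta> (carrier ?N)"
    proof (rule inj_onI)
      fix x y assume xy: "x \<in> carrier ?N" "y \<in> carrier ?N" "\<theta> x = \<theta> y"
      have ceq: "col x \<nu> = col y \<nu>" for \<nu>
      proof -
        have "cc x \<nu> = cc y \<nu>" using fun_cong[OF xy(3), of \<nu>] fibre_inj[OF _ ccc] by (simp add: \<theta>_def)
        then have "\<phi> \<nu> *\<^sub>v (\<phi>' \<nu> *\<^sub>v col x \<nu>) = \<phi> \<nu> *\<^sub>v (\<phi>' \<nu> *\<^sub>v col y \<nu>)" by (simp add: cc_def)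
        then show ?thesis
          using inv_pairD(3)[OF \<phi>[of \<nu>]] assoc_mult_mat_vec[OF \<phi>c(1)[of \<nu>] \<phi>c(2)[of \<nu>] colc[of x \<nu>]]
            assoc_mult_mat_vec[OF \<phi>c(1)[of \<nu>] \<phi>c(2)[of \<nu>] colc[of y \<nu>]] one_mult_mat_vec[OF colc] by simp
      qed
      have "x i \<nu> = y i \<nu>" if "i < n" for i \<nu>
        using arg_cong[OF ceq[of \<nu>], of "\<lambda>v. v $ i"] that by (simp add: col_def)
      then show "x = y" using xy(1,2) unfolding Ncar by (intro PiE_ext) auto
    qed
    show "\<theta> ` carrier ?N = carrier (weighting ?M)"
    proof (intro equalityI subsetI)
      fix \<Phi> assume "\<Phi> \<in> \<theta> ` carrier ?N"
      then obtain x where x: "x \<in> carrier ?N" "\<Phi> = \<theta> x" by auto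
      have "{\<nu>. \<Phi> \<nu> \<noteq> fibre n \<nu> (0\<^sub>v n)} \<subseteq> (\<Union>i\<in>{..<n}. {\<nu>. x i \<nu> \<noteq> 0})"
      proof
        fix \<nu> assume "\<nu> \<in> {\<nu>. \<Phi> \<nu> \<noteq> fibre n \<nu> (0\<^sub>v n)}"
        then have "cc x \<nu> \<noteq> 0\<^sub>v n" using x(2) by (auto simp: \<theta>_def)
        moreover have "cc x \<nu> = 0\<^sub>v n" if "\<forall>i<n. x i \<nu> = 0"
        proof -
          have "col x \<nu> = 0\<^sub>v n" using that by (auto simp: col_def)
          then show ?thesis using \<phi>c(2)[of \<nu>] by (auto simp: cc_def)
        qed
        ultimately show "\<nu> \<in> (\<Union>i\<in>{..<n}. {\<nu>. x i \<nu> \<noteq> 0})" by auto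
      qed
      then have "finite {\<nu>. \<Phi> \<nu> \<noteq> fibre n \<nu> (0\<^sub>v n)}"
        by (rule finite_subset) (use x(1) in \<open>auto simp: Ncar\<close>)
      then show "\<Phi> \<in> carrier (weighting ?M)"
        unfolding Wcar using ccc x(2) by (auto simp: \<theta>_def)
    next
      fix \<Phi> assume "\<Phi> \<in> carrier (weighting ?M)"
      then have "\<forall>\<nu>. \<exists>c\<in>carrier_vec n. \<Phi> \<nu> = fibre n \<nu> c" and fin: "finite {\<nu>. \<Phi> \<nu> \<noteq> fibre n \<nu> (0\<^sub>v n)}"
        unfolding Wcar by auto
      then obtain c where c: "\<And>\<nu>. c \<nu> \<in> carrier_vec n" "\<And>\<nu>. \<Phi> \<nu> = fibre n \<nu> (c \<nu>)" by metis
      define x where "x = (\<lambda>i\<in>{..<n}. \<lambda>\<nu>. (\<phi> \<nu> *\<^sub>v c \<nu>) $ i)"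
      have col: "col x \<nu> = \<phi> \<nu> *\<^sub>v c \<nu>" for \<nu>
        using carrier_matD[OF \<phi>c(1)[of \<nu>]] by (intro eq_vecI) (auto simp: col_def x_def)
      have "cc x \<nu> = c \<nu>" for \<nu>
        unfolding cc_def col
        using assoc_mult_mat_vec[OF \<phi>c(2) \<phi>c(1) c(1), of \<nu> \<nu> \<nu>] inv_pairD(4)[OF \<phi>[of \<nu>]] c(1)[of \<nu>] by simp
      then have "\<Phi> = \<theta> x" using c(2) by (auto simp: \<theta>_def)
      moreover have "finite {\<nu>. (\<phi> \<nu> *\<^sub>v c \<nu>) $ i \<noteq> 0}" if "i < n" for i
      proof (rule finite_subset[OF _ fin], rule subsetI, rule CollectI)
        fix \<nu> assume "\<nu> \<in> {\<nu>. (\<phi> \<nu> *\<^sub>v c \<nu>) $ i \<noteq> 0}"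
        then have "c \<nu> \<noteq> 0\<^sub>v n" using \<phi>c(1)[of \<nu>] that by auto
        then show "\<Phi> \<nu> \<noteq> fibre n \<nu> (0\<^sub>v n)" using fibre_inj[OF _ c(1)] c(2) by metis
      qed
      then have "x \<in> carrier ?N" unfolding Ncar by (auto simp: x_def)
      ultimately show "\<Phi> \<in> \<theta> ` carrier ?N" by blast
    qed
  qed
  have colm: "col (\<lambda>i\<in>{..<n}. \<lambda>\<nu>. g \<nu> i * y i \<nu>) \<nu> = mat_diag n (g \<nu>) *\<^sub>v vec n (\<lambda>i. y i \<nu>)"
    for g :: "complex \<Rightarrow> nat \<Rightarrow> complex" and y :: "nat \<Rightarrow> complex \<Rightarrow> complex" and \<nu>
    by (subst diag) (auto simp: col_def)
  show ?thesis
  proof (rule sl2_iso_transport_surj[OF sl2_laws_direct_sum[OF laws] bij])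
    have zero: "\<zero>\<^bsub>?N\<^esub> = (\<lambda>i\<in>{..<n}. \<lambda>_. 0)"
      using len by (auto simp: sl2_direct_sum_def Ms degree1_family_def)
    have "cc \<zero>\<^bsub>?N\<^esub> \<nu> = 0\<^sub>v n" for \<nu>
    proof -
      have "col \<zero>\<^bsub>?N\<^esub> \<nu> = 0\<^sub>v n" by (auto simp: zero col_def)
      then show ?thesis using \<phi>c(2)[of \<nu>] by (auto simp: cc_def)
    qed
    then show "\<theta> \<zero>\<^bsub>?N\<^esub> = \<zero>\<^bsub>weighting ?M\<^esub>"
      by (auto simp: \<theta>_def weighting_def h_image_M_EF)
  next
    fix x y assume xy: "x \<in> carrier ?N" "y \<in> carrier ?N"
    have "cc (x \<oplus>\<^bsub>?N\<^esub> y) \<nu> = cc x \<nu> + cc y \<nu>" for \<nu>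
    proof -
      have "col (x \<oplus>\<^bsub>?N\<^esub> y) \<nu> = col x \<nu> + col y \<nu>"
        using len by (auto simp: sl2_direct_sum_def Ms degree1_family_def col_def)
      then show ?thesis unfolding cc_def using mult_add_distrib_mat_vec[OF \<phi>c(2) colc colc] by simp
    qed
    then show "\<theta> (x \<oplus>\<^bsub>?N\<^esub> y) = \<theta> x \<oplus>\<^bsub>weighting ?M\<^esub> \<theta> y"
      using ccc by (auto simp: \<theta>_def weighting_def fibre_add)
  next
    fix c x assume x: "x \<in> carrier ?N"
    have cc: "cc (c \<odot>\<^bsub>?N\<^esub> x) \<nu> = c \<cdot>\<^sub>v cc x \<nu>" for \<nu>
    proof -
      have "col (c \<odot>\<^bsub>?N\<^esub> x) \<nu> = c \<cdot>\<^sub>v col x \<nu>"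
        using len by (auto simp: sl2_direct_sum_def Ms degree1_family_def col_def)
      then show ?thesis unfolding cc_def using mult_mat_vec[OF \<phi>c(2) colc] by simp
    qed
    have "(\<Union>v\<in>fibre n \<nu> (cc x \<nu>). fibre n \<nu> (0\<^sub>v n) +>\<^bsub>?M\<^esub> (c \<odot>\<^bsub>?M\<^esub> v)) = fibre n \<nu> (c \<cdot>\<^sub>v cc x \<nu>)" for \<nu>
      by (rule Union_r_coset_fibre[OF ccc]) (auto simp: M_EF_def fibre_def ev_smult)
    then show "\<theta> (c \<odot>\<^bsub>?N\<^esub> x) = c \<odot>\<^bsub>weighting ?M\<^esub> \<theta> x"
      by (auto simp: \<theta>_def weighting_def h_image_M_EF cc)
  next
    fix x assume x: "x \<in> carrier ?N"
    have cc: "cc (act_h ?N x) \<nu> = \<nu> \<cdot>\<^sub>v cc x \<nu>" for \<nu>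
    proof -
      have "col (act_h ?N x) \<nu> = \<nu> \<cdot>\<^sub>v col x \<nu>"
        using len by (auto simp: sl2_direct_sum_def Ms degree1_family_def col_def)
      then show ?thesis unfolding cc_def using mult_mat_vec[OF \<phi>c(2) colc] by simp
    qed
    have "(\<Union>v\<in>fibre n \<nu> (cc x \<nu>). fibre n \<nu> (0\<^sub>v n) +>\<^bsub>?M\<^esub> act_h ?M v) = fibre n \<nu> (\<nu> \<cdot>\<^sub>v cc x \<nu>)" for \<nu>
      by (rule Union_r_coset_fibre[OF ccc]) (auto simp: M_EF_def fibre_def ev_smult)
    then show "\<theta> (act_h ?N x) = act_h (weighting ?M) (\<theta> x)"
      by (auto simp: \<theta>_def weighting_def h_image_M_EF cc)
  next
    fix x assume x: "x \<in> carrier ?N"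
    have cc: "cc (act_e ?N x) \<mu> = eval_mat E \<mu> *\<^sub>v cc x (\<mu> - 1)" for \<mu>
    proof -
      have "col (act_e ?N x) \<mu> = mat_diag n (b (\<mu> - 1)) *\<^sub>v col x (\<mu> - 1)"
        unfolding diag[OF colc] using len by (auto simp: sl2_direct_sum_def Ms degree1_family_def col_def)
      then have "cc (act_e ?N x) \<mu> = (\<phi>' \<mu> * mat_diag n (b (\<mu> - 1))) *\<^sub>v col x (\<mu> - 1)"
        unfolding cc_def using assoc_mult_mat_vec[OF \<phi>c(2) _ colc] by simp
      also have "\<phi>' \<mu> * mat_diag n (b (\<mu> - 1)) = eval_mat E \<mu> * \<phi>' (\<mu> - 1)"
        using E'[of "\<mu> - 1"] by simp
      also have "\<dots> *\<^sub>v col x (\<mu> - 1) = eval_mat E \<mu> *\<^sub>v cc x (\<mu> - 1)"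
        unfolding cc_def by (rule assoc_mult_mat_vec[OF Ec \<phi>c(2) colc])
      finally show ?thesis .
    qed
    have "(\<Union>v\<in>fibre n (\<mu> - 1) (cc x (\<mu> - 1)). fibre n \<mu> (0\<^sub>v n) +>\<^bsub>?M\<^esub> act_e ?M v)
        = fibre n \<mu> (eval_mat E \<mu> *\<^sub>v cc x (\<mu> - 1))" for \<mu>
      by (rule Union_r_coset_fibre[OF ccc])
        (use E in \<open>auto simp: M_EF_def fibre_def ev_mult_mat_vec[of _ n n] ev_shift\<close>)
    then show "\<theta> (act_e ?N x) = act_e (weighting ?M) (\<theta> x)"
      by (auto simp: \<theta>_def weighting_def h_image_M_EF cc)
  next
    fix x assume x: "x \<in> carrier ?N"
    have cc: "cc (act_f ?N x) \<mu> = eval_mat F \<mu> *\<^sub>v cc x (\<mu> + 1)" for \<mu>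
    proof -
      have "col (act_f ?N x) \<mu> = mat_diag n (a \<mu>) *\<^sub>v col x (\<mu> + 1)"
        unfolding diag[OF colc] using len by (auto simp: sl2_direct_sum_def Ms degree1_family_def col_def)
      then have "cc (act_f ?N x) \<mu> = (\<phi>' \<mu> * mat_diag n (a \<mu>)) *\<^sub>v col x (\<mu> + 1)"
        unfolding cc_def using assoc_mult_mat_vec[OF \<phi>c(2) _ colc] by simp
      also have "\<phi>' \<mu> * mat_diag n (a \<mu>) = eval_mat F \<mu> * \<phi>' (\<mu> + 1)"
        using F'[of \<mu>] by simp
      also have "\<dots> *\<^sub>v col x (\<mu> + 1) = eval_mat F \<mu> *\<^sub>v cc x (\<mu> + 1)"
        unfolding cc_def by (rule assoc_mult_mat_vec[OF Fc \<phi>c(2) colc])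
      finally show ?thesis .
    qed
    have "(\<Union>v\<in>fibre n (\<mu> + 1) (cc x (\<mu> + 1)). fibre n \<mu> (0\<^sub>v n) +>\<^bsub>?M\<^esub> act_f ?M v)
        = fibre n \<mu> (eval_mat F \<mu> *\<^sub>v cc x (\<mu> + 1))" for \<mu>
      by (rule Union_r_coset_fibre[OF ccc])
        (use F in \<open>auto simp: M_EF_def fibre_def ev_mult_mat_vec[of _ n n] ev_unshift\<close>)
    then show "\<theta> (act_f ?N x) = act_f (weighting ?M) (\<theta> x)"
      by (auto simp: \<theta>_def weighting_def h_image_M_EF cc)
  qed
qed

subsection \<open>Coherent families of degree 1\<close>

lemma finsum_degree1_family:
  assumes ab: "abelian_group (degree1_family p q)" and "finite A"
    and "\<And>a. a \<in> A \<Longrightarrow> f a \<in> carrier (degree1_family p q)"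
  shows "(\<Oplus>\<^bsub>degree1_family p q\<^esub>a\<in>A. f a) = (\<lambda>\<mu>. \<Sum>a\<in>A. f a \<mu>)"
proof -
  interpret abelian_group "degree1_family p q" by (rule ab)
  show ?thesis
    using assms(2,3)
  proof (induction A rule: finite_induct)
    case (insert a A)
    then have "(\<Oplus>\<^bsub>degree1_family p q\<^esub>a\<in>insert a A. f a) = f a \<oplus>\<^bsub>degree1_family p q\<^esub> (\<Oplus>\<^bsub>degree1_family p q\<^esub>a\<in>A. f a)"
      by (intro finsum_insert) auto
    then show ?case using insert by (simp add: degree1_family_def)
  next
    case empty
    have "\<zero>\<^bsub>degree1_family p q\<^esub> = (\<lambda>_. 0)" by (simp add: degree1_family_def)
    then show ?case by simp
  qed
qed

text \<open>Each weight space is the line through one basis vector, so the trace of c is the scalar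
  by which c acts there, and P makes this scalar polynomial in \<nu>.\<close>

lemma coherent_family_degree1_family:
  assumes com: "\<And>\<nu>. q \<nu> * p (\<nu> - 1) - p \<nu> * q (\<nu> + 1) = 2 * \<nu>"
    and P: "\<And>\<nu>. (2 * \<nu> + 1)^2 + 4 * (p \<nu> * q (\<nu> + 1)) = poly P \<nu>"
  shows "coherent_family 1 (degree1_family p q)"
proof -
  let ?M = "degree1_family p q"
  define \<delta> where "\<delta> \<nu> c = (\<lambda>\<mu>. if \<mu> = \<nu> then c else 0)" for \<nu> c :: complex
  have laws: "sl2_laws ?M" by (rule sl2_laws_degree1_family[OF com])
  note ab = sl2_laws_abelian_group[OF laws]
  have M: "sl2_module ?M" by (rule sl2_laws_imp_sl2_module[OF laws])
  have fin\<delta>: "finite {\<mu>. \<delta> \<nu> c \<mu> \<noteq> 0}" for \<nu> c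
    by (rule finite_subset[of _ "{\<nu>}"]) (auto simp: \<delta>_def)
  then have \<delta>M: "\<delta> \<nu> c \<in> carrier ?M" for \<nu> c by (simp add: degree1_family_def)
  have ws: "weight_space ?M \<nu> = range (\<delta> \<nu>)" for \<nu>
  proof (intro equalityI subsetI)
    fix x assume "x \<in> weight_space ?M \<nu>"
    then have "\<mu> * x \<mu> = \<nu> * x \<mu>" for \<mu>
      by (auto simp: weight_space_def degree1_family_def dest: fun_cong)
    then have "x \<mu> = 0" if "\<mu> \<noteq> \<nu>" for \<mu> using that by auto
    then have "x = \<delta> \<nu> (x \<nu>)" by (auto simp: \<delta>_def)
    then show "x \<in> range (\<delta> \<nu>)" by blast
  next
    fix x assume "x \<in> range (\<delta> \<nu>)"
    then obtain c where "x = \<delta> \<nu> c" by auto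
    then show "x \<in> weight_space ?M \<nu>"
      using \<delta>M[of \<nu> c] by (auto simp: weight_space_def degree1_family_def \<delta>_def)
  qed
  have zero: "\<zero>\<^bsub>?M\<^esub> = (\<lambda>_. 0)" by (simp add: degree1_family_def)
  have \<delta>0: "\<delta> \<nu> c = \<zero>\<^bsub>?M\<^esub> \<longleftrightarrow> c = 0" for \<nu> c
    by (auto simp: \<delta>_def zero fun_eq_iff)
  have sum\<delta>: "(\<Oplus>\<^bsub>?M\<^esub>\<nu>\<in>{\<nu>. \<delta> \<nu> (c \<nu>) \<noteq> \<zero>\<^bsub>?M\<^esub>}. \<delta> \<nu> (c \<nu>)) = c" if "finite {\<nu>. c \<nu> \<noteq> 0}" for c
  proof
    fix \<mu>
    have "(\<Oplus>\<^bsub>?M\<^esub>\<nu>\<in>{\<nu>. \<delta> \<nu> (c \<nu>) \<noteq> \<zero>\<^bsub>?M\<^esub>}. \<delta> \<nu> (c \<nu>)) = (\<lambda>\<mu>. \<Sum>\<nu>\<in>{\<nu>. c \<nu> \<noteq> 0}. \<delta> \<nu> (c \<nu>) \<mu>)"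
      unfolding \<delta>0 by (rule finsum_degree1_family[OF ab that \<delta>M])
    moreover have "(\<Sum>\<nu>\<in>{\<nu>. c \<nu> \<noteq> 0}. \<delta> \<nu> (c \<nu>) \<mu>) = c \<mu>"
      using that by (simp add: \<delta>_def)
    ultimately show "(\<Oplus>\<^bsub>?M\<^esub>\<nu>\<in>{\<nu>. \<delta> \<nu> (c \<nu>) \<noteq> \<zero>\<^bsub>?M\<^esub>}. \<delta> \<nu> (c \<nu>)) \<mu> = c \<mu>" by simp
  qed
  have wm: "weight_module ?M"
    unfolding weight_module_def
  proof (intro conjI ballI M)
    fix v assume "v \<in> carrier ?M"
    then have fin: "finite {\<nu>. v \<nu> \<noteq> 0}" by (simp add: degree1_family_def)
    show "\<exists>!x. (\<forall>\<nu>. x \<nu> \<in> weight_space ?M \<nu>) \<and> finite {\<nu>. x \<nu> \<noteq> \<zero>\<^bsub>?M\<^esub>} \<and>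
        v = (\<Oplus>\<^bsub>?M\<^esub>\<nu>\<in>{\<nu>. x \<nu> \<noteq> \<zero>\<^bsub>?M\<^esub>}. x \<nu>)"
    proof (rule ex1I[of _ "\<lambda>\<nu>. \<delta> \<nu> (v \<nu>)"])
      show "(\<forall>\<nu>. \<delta> \<nu> (v \<nu>) \<in> weight_space ?M \<nu>) \<and> finite {\<nu>. \<delta> \<nu> (v \<nu>) \<noteq> \<zero>\<^bsub>?M\<^esub>} \<and>
        v = (\<Oplus>\<^bsub>?M\<^esub>\<nu>\<in>{\<nu>. \<delta> \<nu> (v \<nu>) \<noteq> \<zero>\<^bsub>?M\<^esub>}. \<delta> \<nu> (v \<nu>))"
        unfolding sum\<delta>[OF fin] using fin by (auto simp: ws \<delta>0)
    next
      fix x assume x: "(\<forall>\<nu>. x \<nu> \<in> weight_space ?M \<nu>) \<and> finite {\<nu>. x \<nu> \<noteq> \<zero>\<^bsub>?M\<^esub>} \<and>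
        v = (\<Oplus>\<^bsub>?M\<^esub>\<nu>\<in>{\<nu>. x \<nu> \<noteq> \<zero>\<^bsub>?M\<^esub>}. x \<nu>)"
      \<comment> \<open>Uniqueness: every component is a multiple of the basis vector of its weight,
        and the sum has these multipliers as its coefficients.\<close>
      then have "\<forall>\<nu>. \<exists>c. x \<nu> = \<delta> \<nu> c" unfolding ws by auto
      then obtain c where c: "x = (\<lambda>\<nu>. \<delta> \<nu> (c \<nu>))" by (metis ext)
      have "finite {\<nu>. c \<nu> \<noteq> 0}" using x unfolding c \<delta>0 by blast
      then have "v = c" using x sum\<delta> unfolding c by metis
      then show "x = (\<lambda>\<nu>. \<delta> \<nu> (v \<nu>))" using c by simp
    qed
  qed
  have "vectorspace.fin_dim complex_field (?M\<lparr>carrier := weight_space ?M \<nu>\<rparr>) \<and>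
      vectorspace.dim complex_field (?M\<lparr>carrier := weight_space ?M \<nu>\<rparr>) = 1 \<and>
      has_trace (?M\<lparr>carrier := weight_space ?M \<nu>\<rparr>) (casimir ?M) (poly P \<nu>)" for \<nu>
  proof -
    let ?V = "?M\<lparr>carrier := weight_space ?M \<nu>\<rparr>"
    let ?b = "\<delta> \<nu> 1"
    have carV: "carrier ?V = range (\<delta> \<nu>)" by (simp add: ws)
    have ops: "x \<oplus>\<^bsub>?M\<^esub> y = (\<lambda>\<mu>. x \<mu> + y \<mu>)" "a \<odot>\<^bsub>?M\<^esub> x = (\<lambda>\<mu>. a * x \<mu>)" "\<zero>\<^bsub>?M\<^esub> = (\<lambda>_. 0)" for x y a
      by (simp_all add: degree1_family_def)
    have abV: "abelian_group ?V"
    proof (rule abelian_groupI)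
      fix x assume "x \<in> carrier ?V"
      then obtain c where "x = \<delta> \<nu> c" by (auto simp: carV)
      then show "\<exists>y\<in>carrier ?V. y \<oplus>\<^bsub>?V\<^esub> x = \<zero>\<^bsub>?V\<^esub>"
        by (intro bexI[of _ "\<delta> \<nu> (- c)"]) (auto simp: ops \<delta>_def carV)
    next
      fix x y assume "x \<in> carrier ?V" "y \<in> carrier ?V"
      then obtain c d where "x = \<delta> \<nu> c" "y = \<delta> \<nu> d" by (auto simp: carV)
      then have "x \<oplus>\<^bsub>?V\<^esub> y = \<delta> \<nu> (c + d)" by (auto simp: ops \<delta>_def)
      then show "x \<oplus>\<^bsub>?V\<^esub> y \<in> carrier ?V" by (simp add: carV)
    next
      have "\<zero>\<^bsub>?V\<^esub> = \<delta> \<nu> 0" by (auto simp: ops \<delta>_def)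
      then show "\<zero>\<^bsub>?V\<^esub> \<in> carrier ?V" by (simp add: carV)
    qed (auto simp: ops)
    have "module complex_field ?V"
    proof (rule moduleI[OF class_cring.cring_axioms abV])
      fix a x assume "x \<in> carrier ?V"
      then obtain c where "x = \<delta> \<nu> c" by (auto simp: carV)
      then have "a \<odot>\<^bsub>?V\<^esub> x = \<delta> \<nu> (a * c)" by (auto simp: ops \<delta>_def)
      then show "a \<odot>\<^bsub>?V\<^esub> x \<in> carrier ?V" by (simp add: carV)
    qed (auto simp: ops algebra_simps)
    then interpret V: vectorspace complex_field ?V by (simp add: vectorspace_def class_field)
    have bV: "?b \<in> carrier ?V" by (auto simp: ws)
    have sm: "a \<odot>\<^bsub>?M\<^esub> ?b = \<delta> \<nu> a" for a by (auto simp: ops \<delta>_def)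
    have radd: "\<delta> \<nu> a \<oplus>\<^bsub>?M\<^esub> \<zero>\<^bsub>?M\<^esub> = \<delta> \<nu> a" for a by (simp add: ops)
    have lc: "V.lincomb a {?b} = \<delta> \<nu> (a ?b)" for a
      unfolding V.lincomb_def using V.smult_closed[OF _ bV] by (simp add: sm radd)
    have "V.basis {?b}"
      unfolding V.basis_def
    proof (intro conjI)
      show "V.lin_indpt {?b}"
        by (rule V.finite_lin_indpt2) (use bV in \<open>auto simp: lc \<delta>0\<close>)
      show "{?b} \<subseteq> carrier ?V" using bV by auto
      show "V.span {?b} = carrier ?V"
      proof (intro equalityI subsetI)
        fix x assume "x \<in> carrier ?V"
        then obtain c where "x = \<delta> \<nu> c" by (auto simp: carV)
        then have "x = V.lincomb (\<lambda>_. c) {?b}" by (simp only: lc)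
        then show "x \<in> V.span {?b}" unfolding V.span_def by (auto intro!: exI[of _ "\<lambda>_. c"] exI[of _ "{?b}"])
      qed (use V.span_is_subset2[of "{?b}"] bV in auto)
    qed
    then have bas: "V.basis (set [?b])" by simp
    have "V.fin_dim" unfolding V.fin_dim_def using bas unfolding V.basis_def by (intro exI[of _ "{?b}"]) auto
    moreover have "V.dim = 1" using V.dim_basis[of "{?b}"] bas by simp
    moreover have "has_trace ?V (casimir ?M) (poly P \<nu>)"
      unfolding has_trace_def
    proof (intro exI conjI)
      show "distinct [?b]" by simp
      show "V.basis (set [?b])" by (rule bas)
      have "casimir ?M ?b = \<delta> \<nu> (poly P \<nu>)"
        unfolding P[symmetric] by (auto simp: casimir_def degree1_family_def \<delta>_def Let_def power2_eq_square algebra_simps)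
      moreover have "(\<Oplus>\<^bsub>?V\<^esub>i\<in>{..<length [?b]}. poly P \<nu> \<odot>\<^bsub>?V\<^esub> [?b] ! i) = \<delta> \<nu> (poly P \<nu>)"
        using V.smult_closed[OF _ bV, of "poly P \<nu>"] by (simp add: lessThan_Suc sm radd)
      ultimately show "\<forall>j<length [?b]. casimir ?M ([?b] ! j) = (\<Oplus>\<^bsub>?V\<^esub>i\<in>{..<length [?b]}. (\<lambda>_ _. poly P \<nu>) i j \<odot>\<^bsub>?V\<^esub> [?b] ! i)"
        by simp
    qed simp
    ultimately show ?thesis by blast
  qed
  then show ?thesis unfolding coherent_family_def using wm by blast
qed

text \<open>In all four families f e acts on weight \<nu> by - (\<nu> - \<alpha> + 1)(\<nu> +
  \<alpha>), with the factors distributed differently between e and f. Hence c acts by (2\<nu> +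
  1)^2 - 4 (\<nu> - \<alpha> + 1)(\<nu> + \<alpha>) = (2\<alpha> - 1)^2, independently of
  \<nu>.\<close>

lemma coherent_families:
  "coherent_family 1 (F_minus \<alpha>)" "coherent_family 1 (F_zero_plus \<alpha>)"
  "coherent_family 1 (F_zero_minus \<alpha>)" "coherent_family 1 (F_plus \<alpha>)"
  unfolding F_minus_def F_zero_plus_def F_zero_minus_def F_plus_def
  by (rule coherent_family_degree1_family[where P = "[:(2 * \<alpha> - 1)^2:]"];
      simp add: algebra_simps power2_eq_square)+

subsection \<open>The decomposition\<close>

lemma eval_mat_mult:
  assumes "A \<in> carrier_mat m k" "B \<in> carrier_mat k n"
  shows "eval_mat (A * B) z = eval_mat A z * eval_mat B z"
  using assms by (intro eq_matI) (auto simp: eval_mat_def scalar_prod_def poly_sum)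

lemma eval_mat_one: "eval_mat (1\<^sub>m n) z = 1\<^sub>m n"
  by (intro eq_matI) (auto simp: eval_mat_def)

lemma GL_poly_inverse:
  assumes "K \<in> GL_poly n"
  shows "K \<in> carrier_mat n n" "inv\<^bsub>poly_mat_ring n\<^esub> K \<in> carrier_mat n n"
    "inv_pair n (eval_mat K z) (eval_mat (inv\<^bsub>poly_mat_ring n\<^esub> K) z)"
proof -
  interpret ring "poly_mat_ring n" by (rule ring_mat)
  let ?K' = "inv\<^bsub>poly_mat_ring n\<^esub> K"
  show K: "K \<in> carrier_mat n n" and K': "?K' \<in> carrier_mat n n"
    using Units_closed[OF assms] Units_inv_closed[OF assms] by (simp_all add: ring_mat_simps)
  have "K * ?K' = 1\<^sub>m n" using Units_r_inv[OF assms] by (simp add: ring_mat_simps)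
  then have "eval_mat K z * eval_mat ?K' z = 1\<^sub>m n"
    using eval_mat_mult[OF K K', of z] eval_mat_one[of n z] by simp
  then show "inv_pair n (eval_mat K z) (eval_mat ?K' z)"
    using K K' by (intro inv_pairI) (auto simp: eval_mat_def)
qed

lemma eval_P_mat: "eval_mat (P_mat am a0 ap \<alpha>) \<mu> = mat_diag (am + a0 + ap) (f_weight am a0 0 \<alpha> \<mu>)"
  by (intro eq_matI) (auto simp: eval_mat_def P_mat_def mat_diag_def f_weight_def algebra_simps)

lemma eval_Pbar_mat: "eval_mat (Pbar_mat am a0 ap \<alpha>) \<mu> = mat_diag (am + a0 + ap) (e_weight am a0 0 \<alpha> \<mu>)"
  by (intro eq_matI) (auto simp: eval_mat_def Pbar_mat_def mat_diag_def e_weight_def algebra_simps)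

lemma eval_mat_shift: "eval_mat (map_mat shift A) \<mu> = eval_mat A (\<mu> - 1)"
  by (intro eq_matI) (auto simp: eval_mat_def shift_def poly_pcompose)

definition degree1_summands :: "nat \<Rightarrow> nat \<Rightarrow> nat \<Rightarrow> nat \<Rightarrow> complex \<Rightarrow> (complex \<Rightarrow> complex) sl2_rep list" where
  "degree1_summands am a0 ap d \<alpha> =
     replicate (am - d) (F_minus \<alpha>) @ replicate (a0 + d) (F_zero_plus \<alpha>) @
     replicate d (F_zero_minus \<alpha>) @ replicate (ap - d) (F_plus \<alpha>)"

text \<open>The shift in the matrix of e cancels against its evaluation at \<mu> + 1, so both
  matrices of an edge are taken at \<mu>, as in \<open>link\<close>. The bounds on d ensure that the
  truncated differences give n summands.\<close>

lemma weighting_M_aK_iso: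
  assumes n: "am + a0 + ap = n" and K: "K \<in> GL_poly n" and d: "d \<le> am" "d \<le> ap"
    and chain: "\<exists>\<phi>. \<forall>\<mu>. weight_chain.link n am a0 d \<alpha> (eval_mat K) (eval_mat (inv\<^bsub>poly_mat_ring n\<^esub> K))
       \<mu> (\<phi> \<mu>) (\<phi> (\<mu> + 1))"
  shows "weighting (M_aK \<alpha> am a0 ap K) \<simeq>\<^sub>s sl2_direct_sum (degree1_summands am a0 ap d \<alpha>)"
proof -
  let ?K' = "inv\<^bsub>poly_mat_ring n\<^esub> K"
  let ?P = "P_mat am a0 ap \<alpha>" and ?Pb = "Pbar_mat am a0 ap \<alpha>"
  note Kc = GL_poly_inverse(1,2)[OF K]
  interpret weight_chain n am a0 d \<alpha> "eval_mat K" "eval_mat ?K'"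
    by unfold_locales (rule GL_poly_inverse(3)[OF K])
  have Pc: "?P \<in> carrier_mat n n" "?Pb \<in> carrier_mat n n" using n by (auto simp: P_mat_def Pbar_mat_def)
  obtain \<phi> where \<phi>: "\<And>\<mu>. link \<mu> (\<phi> \<mu>) (\<phi> (\<mu> + 1))" using chain by auto
  then have "\<forall>\<mu>. \<exists>X'. inv_pair n (\<phi> \<mu>) X'" by (auto simp: link_def good_def)
  then obtain \<phi>' where \<phi>': "\<And>\<mu>. inv_pair n (\<phi> \<mu>) (\<phi>' \<mu>)" by metis
  have M: "M_aK \<alpha> am a0 ap K = M_EF n (map_mat shift (?K' * ?Pb)) (?P * K)"
    by (simp add: M_aK_def Let_def n)
  show ?thesis
    unfolding M
  proof (rule weighting_iso_direct_sum[where \<phi> = \<phi> and \<phi>' = \<phi>' and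
        a = "f_weight am a0 d \<alpha>" and b = "e_weight am a0 d \<alpha>"])
    show "map_mat shift (?K' * ?Pb) \<in> carrier_mat n n" "?P * K \<in> carrier_mat n n" using Kc Pc by auto
    show "length (degree1_summands am a0 ap d \<alpha>) = n" using n d by (simp add: degree1_summands_def)
    show "degree1_summands am a0 ap d \<alpha> ! i
        = degree1_family (\<lambda>\<nu>. e_weight am a0 d \<alpha> \<nu> i) (\<lambda>\<nu>. f_weight am a0 d \<alpha> (\<nu> - 1) i)" if i: "i < n" for i
    proof -
      have "degree1_summands am a0 ap d \<alpha> ! i = (if i < am - d then F_minus \<alpha> else if i < am + a0 then F_zero_plus \<alpha>
          else if i < am + a0 + d then F_zero_minus \<alpha> else F_plus \<alpha>)"
        using i n d by (auto simp: degree1_summands_def nth_append)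
      also have "\<dots> = degree1_family (\<lambda>\<nu>. e_weight am a0 d \<alpha> \<nu> i) (\<lambda>\<nu>. f_weight am a0 d \<alpha> (\<nu> - 1) i)"
        by (auto simp: F_minus_def F_zero_plus_def F_zero_minus_def F_plus_def e_weight_def f_weight_def
            algebra_simps intro!: arg_cong2[of _ _ _ _ degree1_family])
      finally show ?thesis .
    qed
    show "sl2_laws N" if "N \<in> set (degree1_summands am a0 ap d \<alpha>)" for N
      using that coherent_families[of \<alpha>]
      by (auto simp: degree1_summands_def coherent_family_def weight_module_def split: if_splits
          intro!: sl2_module_imp_sl2_laws)
    show "inv_pair n (\<phi> \<mu>) (\<phi>' \<mu>)" for \<mu> by (rule \<phi>')
    show "\<phi> \<mu> * eval_mat (?P * K) \<mu> = mat_diag n (f_weight am a0 d \<alpha> \<mu>) * \<phi> (\<mu> + 1)" for \<mu>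
      using \<phi>[of \<mu>] unfolding eval_mat_mult[OF Pc(1) Kc(1)] eval_P_mat n by (simp add: link_def)
    show "\<phi> (\<mu> + 1) * eval_mat (map_mat shift (?K' * ?Pb)) (\<mu> + 1) = mat_diag n (e_weight am a0 d \<alpha> \<mu>) * \<phi> \<mu>" for \<mu>
      using \<phi>[of \<mu>] unfolding eval_mat_shift add_diff_cancel_right' eval_mat_mult[OF Kc(2) Pc(2)] eval_Pbar_mat n
      by (simp add: link_def)
  qed
qed

section \<open>The two positions of the zeros for half-integral \<alpha>\<close>

text \<open>The four cases of \<open>calK\<close> become two, as an empty product accounts for
  \<alpha> = 1 and \<alpha> = 0. The number m is one less than the distance between the zeros, so
  the product runs over the weights strictly between them.\<close>

lemma half_int_cases:
  assumes \<alpha>: "\<alpha> \<in> half_ints - {1 / 2}" and K: "K \<in> carrier_mat (am + a0 + ap) (am + a0 + ap)"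
  obtains (pos) m :: nat where "Re \<alpha> \<ge> 1" "- \<alpha> + of_nat (Suc m) = \<alpha> - 1"
      "calK \<alpha> am a0 ap K = eval_mat K (- \<alpha>) * ordered_prod (am + a0 + ap) m
         (\<lambda>j. mat_diag (am + a0 + ap) (f_weight am a0 0 \<alpha> (- \<alpha> + of_nat j)) * eval_mat K (- \<alpha> + of_nat j))"
    | (nonpos) m :: nat where "Re \<alpha> \<le> 0" "\<alpha> - 1 + of_nat (Suc m) = - \<alpha>"
      "calK \<alpha> am a0 ap K = eval_mat K (\<alpha> - 1) * ordered_prod (am + a0 + ap) m
         (\<lambda>j. mat_diag (am + a0 + ap) (f_weight am a0 0 \<alpha> (\<alpha> - 1 + of_nat j)) * eval_mat K (\<alpha> - 1 + of_nat j))"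
proof -
  let ?n = "am + a0 + ap"
  let ?PK = "\<lambda>z. mat_diag ?n (f_weight am a0 0 \<alpha> z) * eval_mat K z"
  obtain k :: int where k: "\<alpha> = of_int k / 2" "k \<noteq> 1" using \<alpha> by (auto simp: half_ints_def)
  have Re: "Re \<alpha> = of_int k / 2" by (simp add: k)
  have empty: "eval_mat K z * ordered_prod ?n 0 A = eval_mat K z" for z A
    using K by (simp add: ordered_prod_def eval_mat_def right_mult_one_mat[of _ ?n ?n])
  show thesis
  proof (cases "k \<ge> 2")
    case True
    define m where "m = nat (k - 2)"
    have km: "k = int m + 2" using True by (simp add: m_def)
    have \<alpha>m: "\<alpha> = (of_nat m + 2) / 2" by (simp add: k km)
    show ?thesis
    proof (rule pos)
      show "Re \<alpha> \<ge> 1" unfolding Re km by simp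
      show "- \<alpha> + of_nat (Suc m) = \<alpha> - 1" by (simp add: \<alpha>m field_simps)
      show "calK \<alpha> am a0 ap K = eval_mat K (- \<alpha>) * ordered_prod ?n m (\<lambda>j. ?PK (- \<alpha> + of_nat j))"
      proof (cases "m = 0")
        case True
        then have "\<alpha> = 1" by (simp add: \<alpha>m)
        then have "calK \<alpha> am a0 ap K = eval_mat K (- \<alpha>)" by (simp add: calK_def)
        then show ?thesis unfolding True empty .
      next
        case False
        then have "Re \<alpha> \<ge> 3 / 2" unfolding Re km by simp
        moreover have "2 * Re \<alpha> - 2 = of_nat m" unfolding Re km by (simp add: field_simps)
        then have "nat \<lfloor>2 * Re \<alpha> - 2\<rfloor> = m" by simp
        ultimately show ?thesis by (simp only: calK_def Let_def eval_P_mat if_True)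
      qed
    qed
  next
    case False
    then have "k \<le> 0" using k by simp
    define m where "m = nat (- k)"
    have km: "k = - int m" using \<open>k \<le> 0\<close> by (simp add: m_def)
    have \<alpha>m: "\<alpha> = - of_nat m / 2" by (simp add: k km)
    have Re0: "Re \<alpha> \<le> 0" unfolding Re km by simp
    show ?thesis
    proof (rule nonpos)
      show "Re \<alpha> \<le> 0" by (rule Re0)
      show "\<alpha> - 1 + of_nat (Suc m) = - \<alpha>" by (simp add: \<alpha>m field_simps)
      have no: "\<not> Re \<alpha> \<ge> 3 / 2" "\<alpha> \<noteq> 1" using Re0 by auto
      show "calK \<alpha> am a0 ap K = eval_mat K (\<alpha> - 1) * ordered_prod ?n m (\<lambda>j. ?PK (\<alpha> - 1 + of_nat j))"
      proof (cases "m = 0")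
        case True
        then have "\<alpha> = 0" by (simp add: \<alpha>m)
        then have "calK \<alpha> am a0 ap K = eval_mat K (\<alpha> - 1)" by (simp add: calK_def)
        then show ?thesis unfolding True empty .
      next
        case False
        then have "\<alpha> \<noteq> 0" by (simp add: \<alpha>m)
        moreover have "nat \<lfloor>- 2 * Re \<alpha>\<rfloor> = m" unfolding Re km by simp
        ultimately show ?thesis using no by (simp only: calK_def Let_def eval_P_mat if_False)
      qed
    qed
  qed
qed

lemma ordered_prod_inv_pair:
  assumes "\<And>j. 1 \<le> j \<Longrightarrow> j \<le> m \<Longrightarrow> \<exists>X'. inv_pair n (A j) X'"
  shows "\<exists>X'. inv_pair n (ordered_prod n m A) X'"
proof -
  have "\<exists>X'. inv_pair n (foldr (*) (map A xs) (1\<^sub>m n)) X'" if "\<forall>x\<in>set xs. \<exists>X'. inv_pair n (A x) X'" for xs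
    using that
  proof (induction xs)
    case Nil
    then show ?case using inv_pair_one by auto
  next
    case (Cons x xs)
    then obtain X X' where "inv_pair n (A x) X" "inv_pair n (foldr (*) (map A xs) (1\<^sub>m n)) X'" by auto
    from inv_pair_mult[OF this] show ?case by auto
  qed
  from this[of "[1..<Suc m]"] show ?thesis unfolding ordered_prod_def using assms by (simp del: upt_Suc)
qed

context weight_chain
begin

text \<open>The diagonal factors belong to weights strictly between the two zeros, where no
  coefficient of f vanishes.\<close>

lemma T_inv_pair:
  assumes s: "{s, s + of_nat (Suc m)} = {\<alpha> - 1, - \<alpha>}"
  shows "\<exists>T'. inv_pair n
    (K s * ordered_prod n m (\<lambda>j. mat_diag n (f_weight am a0 0 \<alpha> (s + of_nat j)) * K (s + of_nat j))) T'"
proof -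
  have "\<exists>X'. inv_pair n (mat_diag n (f_weight am a0 0 \<alpha> (s + of_nat j)) * K (s + of_nat j)) X'"
    if j: "1 \<le> j" "j \<le> m" for j
  proof -
    have "s + of_nat j \<noteq> s" "s + of_nat j \<noteq> s + of_nat (Suc m)"
      using j by (auto simp del: of_nat_Suc)
    then have "s + of_nat j \<notin> {\<alpha> - 1, - \<alpha>}" unfolding s[symmetric] by auto
    then have "reg (s + of_nat j)" using not_reg_iff[of "s + of_nat j"] by auto
    then have "f_weight am a0 0 \<alpha> (s + of_nat j) i \<noteq> 0" for i
      using f_weight_e_weight[of am a0 0 \<alpha> "s + of_nat j" i] by (auto simp: reg_def)
    then show ?thesis using inv_pair_mult[OF mat_diag_inv_pair K] by blast
  qed
  then have "\<exists>X'. inv_pair n (ordered_prod n m (\<lambda>j. mat_diag n (f_weight am a0 0 \<alpha> (s + of_nat j)) * K (s + of_nat j))) X'"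
    by (rule ordered_prod_inv_pair)
  then show ?thesis using inv_pair_mult[OF K] by blast
qed

text \<open>At the lower zero - \<alpha> the coefficient of e survives on the third and fourth kind
  of summand; at \<alpha> - 1 that of f survives on the first and third kind. These supports are the
  index sets imposed on U and \<open>U * T\<close>.\<close>

lemma chain_pos:
  assumes n: "n = am + a0 + ap" and s: "- \<alpha> + of_nat (Suc m) = \<alpha> - 1"
    and T: "T = K (- \<alpha>) * ordered_prod n m (\<lambda>j. mat_diag n (f_weight am a0 0 \<alpha> (- \<alpha> + of_nat j)) * K (- \<alpha> + of_nat j))"
    and U: "carries n {am + a0..<n} {am + a0..<n} U U'"
    and UT: "carries n {..<am} ({..<am - d} \<union> {am + a0..<am + a0 + d}) (U * T) V"
  shows "\<exists>\<phi>. \<forall>\<mu>. link \<mu> (\<phi> \<mu>) (\<phi> (\<mu> + 1))"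
proof (rule chain_double[where s = "- \<alpha>" and m = m and U = U and U' = U' and V = V, OF _ T])
  have ne: "2 * \<alpha> - 1 \<noteq> 0"
  proof -
    have "2 * \<alpha> - 1 = of_nat (Suc m)" using s by (simp add: algebra_simps)
    then show ?thesis by (simp del: of_nat_Suc)
  qed
  then have ne': "1 - 2 * \<alpha> \<noteq> 0" by (auto simp: algebra_simps)
  show "{- \<alpha>, - \<alpha> + of_nat (Suc m)} = {\<alpha> - 1, - \<alpha>}" unfolding s by auto
  have e: "- \<alpha> - \<alpha> + 1 = 1 - 2 * \<alpha>" "- \<alpha> + \<alpha> = 0" "\<alpha> - 1 - \<alpha> + 1 = 0" "\<alpha> - 1 + \<alpha> = 2 * \<alpha> - 1" by simp_all
  show "carries n {i. e_weight am a0 0 \<alpha> (- \<alpha>) i \<noteq> 0} {i. e_weight am a0 d \<alpha> (- \<alpha>) i \<noteq> 0} U U'"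
    by (rule carries_cong[OF U]; unfold e_weight_def e) (use ne' n in auto)
  show "carries n {i. f_weight am a0 0 \<alpha> (- \<alpha> + of_nat (Suc m)) i \<noteq> 0}
      {i. f_weight am a0 d \<alpha> (- \<alpha> + of_nat (Suc m)) i \<noteq> 0} (U * T) V"
    unfolding s by (rule carries_cong[OF UT]; unfold f_weight_def e) (use ne n in auto)
qed

text \<open>The zeros come in the other order than in \<open>chain_pos\<close>, so e and f exchange
  roles at each of them. As exactly one of the two coefficients vanishes at a simple zero, the
  supports are replaced by their complements, the form in which \<open>carries_dual\<close> delivers
  the matrices.\<close>

lemma chain_nonpos:
  assumes n: "n = am + a0 + ap" and s: "\<alpha> - 1 + of_nat (Suc m) = - \<alpha>"
    and T: "T = K (\<alpha> - 1) * ordered_prod n m (\<lambda>j. mat_diag n (f_weight am a0 0 \<alpha> (\<alpha> - 1 + of_nat j)) * K (\<alpha> - 1 + of_nat j))"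
    and U: "carries n (- {..<am}) (- ({..<am - d} \<union> {am + a0..<am + a0 + d})) U U'"
    and UT: "carries n (- {am + a0..<n}) (- {am + a0..<n}) (U * T) V"
  shows "\<exists>\<phi>. \<forall>\<mu>. link \<mu> (\<phi> \<mu>) (\<phi> (\<mu> + 1))"
proof (rule chain_double[where s = "\<alpha> - 1" and m = m and U = U and U' = U' and V = V, OF _ T])
  have ne': "1 - 2 * \<alpha> \<noteq> 0"
  proof -
    have "1 - 2 * \<alpha> = of_nat (Suc m)" using s by (simp add: algebra_simps)
    then show ?thesis by (simp del: of_nat_Suc)
  qed
  then have ne: "2 * \<alpha> - 1 \<noteq> 0" by (auto simp: algebra_simps)
  show "{\<alpha> - 1, \<alpha> - 1 + of_nat (Suc m)} = {\<alpha> - 1, - \<alpha>}" unfolding s by auto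
  have e: "- \<alpha> - \<alpha> + 1 = 1 - 2 * \<alpha>" "- \<alpha> + \<alpha> = 0" "\<alpha> - 1 - \<alpha> + 1 = 0" "\<alpha> - 1 + \<alpha> = 2 * \<alpha> - 1" by simp_all
  show "carries n {i. e_weight am a0 0 \<alpha> (\<alpha> - 1) i \<noteq> 0} {i. e_weight am a0 d \<alpha> (\<alpha> - 1) i \<noteq> 0} U U'"
    by (rule carries_cong[OF U]; unfold e_weight_def e) (use ne n in auto)
  show "carries n {i. f_weight am a0 0 \<alpha> (\<alpha> - 1 + of_nat (Suc m)) i \<noteq> 0}
      {i. f_weight am a0 d \<alpha> (\<alpha> - 1 + of_nat (Suc m)) i \<noteq> 0} (U * T) V"
    unfolding s by (rule carries_cong[OF UT]; unfold f_weight_def e) (use ne' n in auto)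
qed

end

lemma carries_empty: "inv_pair n X X' \<Longrightarrow> carries n {} {} X X'"
  by (auto simp: carries_def maps_coords_def)

lemma carries_full: "inv_pair n X X' \<Longrightarrow> {..<n} \<subseteq> I \<Longrightarrow> carries n I I X X'"
  by (auto simp: carries_def maps_coords_def)

lemma carries_one: "carries n I I (1\<^sub>m n) (1\<^sub>m n)"
  using inv_pair_one by (auto simp: carries_def maps_coords_def)

theorem theorem2p11:
  fixes \<alpha> :: complex and am a0 ap n :: nat and K :: "complex poly mat"
  assumes "am + a0 + ap = n" and "n \<ge> 1"
    and "K \<in> GL_poly n"
  shows "(coherent_family 1 (F_minus \<alpha>) \<and> coherent_family 1 (F_zero_plus \<alpha>) \<and>
          coherent_family 1 (F_zero_minus \<alpha>) \<and> coherent_family 1 (F_plus \<alpha>)) \<and>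
    ((am, ap) \<in> {(0, 0)} \<union> {(m, 0) |m. m \<ge> 1} \<union> {(0, m) |m. m \<ge> 1} \<or>
       (am \<ge> 1 \<and> ap \<ge> 1 \<and> \<alpha> \<in> (UNIV - half_ints) \<union> {1 / 2})
     \<longrightarrow> weighting (M_aK \<alpha> am a0 ap K) \<simeq>\<^sub>s
           sl2_direct_sum (replicate am (F_minus \<alpha>) @ replicate a0 (F_zero_plus \<alpha>) @
                           replicate ap (F_plus \<alpha>))) \<and>
    (am \<ge> 1 \<and> ap \<ge> 1 \<and> \<alpha> \<in> half_ints - {1 / 2}
     \<longrightarrow> (let T = calK \<alpha> am a0 ap K;
              T' = (if Re \<alpha> \<le> 0 \<and> a0 \<ge> 1 then transpose_mat T else T);
              d = am + ap - vec_space.rank n (bold_M am a0 ap T')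
          in
          d \<le> am \<and> d \<le> ap \<and>
          weighting (M_aK \<alpha> am a0 ap K) \<simeq>\<^sub>s
            sl2_direct_sum (replicate (am - d) (F_minus \<alpha>) @ replicate (a0 + d) (F_zero_plus \<alpha>) @
                            replicate d (F_zero_minus \<alpha>) @ replicate (ap - d) (F_plus \<alpha>))))"
proof (intro conjI impI)
  let ?K = "eval_mat K" and ?K' = "eval_mat (inv\<^bsub>poly_mat_ring n\<^esub> K)"
  have n: "n = am + a0 + ap" using assms(1) ..
  note KG = GL_poly_inverse[OF assms(3)]
  have chain: "weight_chain n ?K ?K'" by unfold_locales (rule KG(3))
  note iso = weighting_M_aK_iso[OF assms(1,3), unfolded degree1_summands_def]
  have Kc: "K \<in> carrier_mat (am + a0 + ap) (am + a0 + ap)" using KG(1) n by simp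
  show "coherent_family 1 (F_minus \<alpha>)" "coherent_family 1 (F_zero_plus \<alpha>)"
    "coherent_family 1 (F_zero_minus \<alpha>)" "coherent_family 1 (F_plus \<alpha>)"
    by (rule coherent_families)+
  {
    assume "(am, ap) \<in> {(0, 0)} \<union> {(m, 0) |m. m \<ge> 1} \<union> {(0, m) |m. m \<ge> 1} \<or>
       (am \<ge> 1 \<and> ap \<ge> 1 \<and> \<alpha> \<in> (UNIV - half_ints) \<union> {1 / 2})"
    then have c: "am = 0 \<or> ap = 0 \<or> \<alpha> \<notin> half_ints \<or> \<alpha> = 1 / 2" by auto
    have "\<exists>\<phi>. \<forall>\<mu>. weight_chain.link n am a0 0 \<alpha> ?K ?K' \<mu> (\<phi> \<mu>) (\<phi> (\<mu> + 1))"
    proof (cases "\<alpha> \<in> half_ints - {1 / 2}")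
      case False
      then show ?thesis by (intro weight_chain.chain_simple[OF chain]) auto
    next
      case True
      then have c: "am = 0 \<or> ap = 0" using c by auto
      from True Kc show ?thesis
      proof (cases rule: half_int_cases)
        case (pos m)
        let ?T = "calK \<alpha> am a0 ap K"
        note T = pos(3)[folded n]
        have "{- \<alpha>, - \<alpha> + of_nat (Suc m)} = {\<alpha> - 1, - \<alpha>}" unfolding pos(2) by auto
        from weight_chain.T_inv_pair[OF chain this] obtain T' where T': "inv_pair n ?T T'" unfolding T by blast
        note Tc = inv_pairD(1)[OF T']
        \<comment> \<open>An empty outer block makes one of the two conditions vacuous; the identity
          or the inverse of T as U satisfies the other.\<close>
        show ?thesis
        proof (cases "am = 0")
          case True
          have "carries n {..<am} ({..<am - 0} \<union> {am + a0..<am + a0 + 0}) (1\<^sub>m n * ?T) T'"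
            using T' Tc True by (simp add: carries_empty)
          from weight_chain.chain_pos[OF chain n pos(2) T carries_one this] show ?thesis .
        next
          case False
          then have 1: "{am + a0..<n} = {}" using c n by auto
          have U: "carries n {am + a0..<n} {am + a0..<n} T' ?T"
            unfolding 1 by (rule carries_empty[OF inv_pair_sym[OF T']])
          have "carries n {..<am} ({..<am - 0} \<union> {am + a0..<am + a0 + 0}) (T' * ?T) (1\<^sub>m n)"
            using inv_pairD(4)[OF T'] by (simp add: carries_one)
          from weight_chain.chain_pos[OF chain n pos(2) T U this] show ?thesis .
        qed
      next
        case (nonpos m)
        let ?T = "calK \<alpha> am a0 ap K"
        note T = nonpos(3)[folded n]
        have "{\<alpha> - 1, \<alpha> - 1 + of_nat (Suc m)} = {\<alpha> - 1, - \<alpha>}" unfolding nonpos(2) by auto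
        from weight_chain.T_inv_pair[OF chain this] obtain T' where T': "inv_pair n ?T T'" unfolding T by blast
        note Tc = inv_pairD(1)[OF T']
        \<comment> \<open>With complements as index sets, an empty block gives the whole space,
          which every invertible matrix preserves.\<close>
        show ?thesis
        proof (cases "ap = 0")
          case True
          have U: "carries n (- {..<am}) (- ({..<am - 0} \<union> {am + a0..<am + a0 + 0})) (1\<^sub>m n) (1\<^sub>m n)"
            by (simp add: carries_one)
          have "carries n (- {am + a0..<n}) (- {am + a0..<n}) (1\<^sub>m n * ?T) T'"
            using T' Tc True n by (simp add: carries_full)
          from weight_chain.chain_nonpos[OF chain n nonpos(2) T U this] show ?thesis .
        next
          case False
          then have "am = 0" using c by auto
          then have U: "carries n (- {..<am}) (- ({..<am - 0} \<union> {am + a0..<am + a0 + 0})) T' ?T"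
            using inv_pair_sym[OF T'] by (simp add: carries_full)
          have "carries n (- {am + a0..<n}) (- {am + a0..<n}) (T' * ?T) (1\<^sub>m n)"
            using inv_pairD(4)[OF T'] by (simp add: carries_one)
          from weight_chain.chain_nonpos[OF chain n nonpos(2) T U this] show ?thesis .
        qed
      qed
    qed
    from iso[OF le0 le0 this] show "weighting (M_aK \<alpha> am a0 ap K) \<simeq>\<^sub>s
        sl2_direct_sum (replicate am (F_minus \<alpha>) @ replicate a0 (F_zero_plus \<alpha>) @ replicate ap (F_plus \<alpha>))"
      by simp
  }
  assume hyp: "am \<ge> 1 \<and> ap \<ge> 1 \<and> \<alpha> \<in> half_ints - {1 / 2}"
  define T where "T = calK \<alpha> am a0 ap K"
  define T' where "T' = (if Re \<alpha> \<le> 0 \<and> a0 \<ge> 1 then transpose_mat T else T)"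
  define d where "d = am + ap - vec_space.rank n (bold_M am a0 ap T')"
  have "d \<le> am \<and> d \<le> ap \<and> (\<exists>\<phi>. \<forall>\<mu>. weight_chain.link n am a0 d \<alpha> ?K ?K' \<mu> (\<phi> \<mu>) (\<phi> (\<mu> + 1)))"
  proof -
    from hyp have "\<alpha> \<in> half_ints - {1 / 2}" by blast
    from this Kc show ?thesis
    proof (cases rule: half_int_cases)
      case (pos m)
      note T = pos(3)[folded n T_def]
      have "{- \<alpha>, - \<alpha> + of_nat (Suc m)} = {\<alpha> - 1, - \<alpha>}" unfolding pos(2) by auto
      from weight_chain.T_inv_pair[OF chain this] obtain Ti where Ti: "inv_pair n T Ti" unfolding T by blast
      have "T' = T" using pos(1) by (simp add: T'_def)
      note rp = relative_position[OF n Ti d_def[unfolded this]]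
      then show ?thesis using weight_chain.chain_pos[OF chain n pos(2) T] by blast
    next
      case (nonpos m)
      note T = nonpos(3)[folded n T_def]
      have "{\<alpha> - 1, \<alpha> - 1 + of_nat (Suc m)} = {\<alpha> - 1, - \<alpha>}" unfolding nonpos(2) by auto
      from weight_chain.T_inv_pair[OF chain this] obtain Ti where Ti: "inv_pair n T Ti" unfolding T by blast
      \<comment> \<open>For a0 = 0 the statement does not transpose T, but transposing then
        preserves the rank; so d can be computed from the transpose in both cases.\<close>
      have "vec_space.rank n (bold_M am a0 ap T') = vec_space.rank n (bold_M am a0 ap (transpose_mat T))"
        using rank_bold_M_transpose[of n am ap T Ti] Ti n nonpos(1) by (cases "a0 = 0") (auto simp: T'_def)
      then have d: "d = am + ap - vec_space.rank n (bold_M am a0 ap (transpose_mat T))" by (simp add: d_def)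
      note TT = inv_pair_transpose[OF Ti]
      note rp = relative_position[OF n TT d]
      obtain U U' V where U: "carries n {am + a0..<n} {am + a0..<n} U U'"
        and UT: "carries n {..<am} ({..<am - d} \<union> {am + a0..<am + a0 + d}) (U * transpose_mat T) V"
        using rp(3) by blast
      have invU: "inv_pair n U U'" and invUT: "inv_pair n (U * transpose_mat T) V" using U UT by (auto simp: carries_def)
      \<comment> \<open>The inverse V came from an existential statement; uniqueness of inverses
        gives the formula needed to compute \<open>transpose_mat V * T\<close>.\<close>
      have V: "V = transpose_mat Ti * U'"
        by (rule inv_pair_unique[OF invUT inv_pair_mult[OF invU TT]])
      have c: "U' \<in> carrier_mat n n" "Ti \<in> carrier_mat n n" "T \<in> carrier_mat n n"
        using inv_pairD[OF invU] inv_pairD[OF Ti] by auto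
      have "transpose_mat V = transpose_mat U' * Ti"
        unfolding V using c by (subst transpose_mult[of _ n n _ n]) auto
      then have "transpose_mat V * T = transpose_mat U' * (Ti * T)"
        using c assoc_mult_mat[of "transpose_mat U'" n n Ti n T n] by simp
      then have VT: "transpose_mat V * T = transpose_mat U'"
        using c inv_pairD(4)[OF Ti] by (simp add: right_mult_one_mat[of _ n n])
      \<comment> \<open>The starting matrix is \<open>transpose_mat V\<close>, the inverse transpose
        of \<open>U * transpose_mat T\<close>: under duality the two conditions trade
        places.\<close>
      have "\<exists>\<phi>. \<forall>\<mu>. weight_chain.link n am a0 d \<alpha> ?K ?K' \<mu> (\<phi> \<mu>) (\<phi> (\<mu> + 1))"
        by (rule weight_chain.chain_nonpos[OF chain n nonpos(2) T carries_dual[OF UT] carries_dual[OF U, folded VT]])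
      then show ?thesis using rp(1,2) by blast
    qed
  qed
  then show "let T = calK \<alpha> am a0 ap K;
              T' = (if Re \<alpha> \<le> 0 \<and> a0 \<ge> 1 then transpose_mat T else T);
              d = am + ap - vec_space.rank n (bold_M am a0 ap T')
          in
          d \<le> am \<and> d \<le> ap \<and>
          weighting (M_aK \<alpha> am a0 ap K) \<simeq>\<^sub>s
            sl2_direct_sum (replicate (am - d) (F_minus \<alpha>) @ replicate (a0 + d) (F_zero_plus \<alpha>) @
                            replicate d (F_zero_minus \<alpha>) @ replicate (ap - d) (F_plus \<alpha>))"
    using iso[of d] unfolding Let_def T_def[symmetric] T'_def[symmetric] d_def[symmetric] by blast
qed

end
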